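(* The subspace $\mathfrak M\mathrm{NSym}$ is a Hopf subalgebra of $\mathfrak M\mathrm{MR}$ (continuously) dual to $\mathfrak m\mathrm{QSym}$, and the basis $\{\tilde R_\alpha\}\subset\mathfrak M\mathrm{NSym}$ is dual to $\{\tilde L_\alpha\}\subset\mathfrak m\mathrm{QSym}$.
   Context: Hopf algebra $\mathfrak M\mathrm{MR}$: a set composition of a finite set $S$ of positive integers is a word $w_1\cdots w_k$ of nonempty disjoint sets with union $S$. An $\mathfrak M$-permutation of $[n]$ is a set composition of $[n]$ with no $w_i$ containing two consecutive integers; $S^{\mathfrak M}_n$ is the set of these, $S^{\mathfrak M}_0=\{\emptyset\}$, $S^{\mathfrak M}_\infty=\bigcup_nS^{\mathfrak M}_n$. $\mathfrak M\mathrm{MR}=\bigoplus_{w\in S^{\mathfrak M}_\infty}\mathbb Z w$. For a set composition $w$, $\mathrm{st}(w)\in S^{\mathfrak M}_\infty$ is obtained by repeatedly (R1) deleting $i+1$ if $i,i+1$ lie in the same $w_j$, (R2) reducing all letters larger than $i$ by $1$ if the positive integer $i$ is not present. $w|_T$ is obtained by intersecting each $w_i$ with $T$ and removing empty sets. For $w\in S^{\mathfrak M}_m,u\in S^{\mathfrak M}_n$, $w\bullet u=\sum v$ over all $v\in S^{\mathfrak M}_{m+n}$ with $v|_{[m]}=w$, $\mathrm{st}(v|_{[m+1,m+n]})=u$, and all $v\in S^{\mathfrak M}_{m+n-1}$ with $v|_{[m]}=w$, $\mathrm{st}(v|_{[m,m+n-1]})=u$. The coproduct is $\vartriangle w=\sum_{[u,v]=w}\mathrm{st}(u)\otimes\mathrm{st}(v)$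 over all ways to write $w$ as a concatenation of two (possibly empty) set compositions. Unit $1\mapsto\emptyset$, counit the coefficient of $\emptyset$; this is a Hopf algebra. For a composition $\alpha=(\alpha_1,\dots,\alpha_k)$ of $n$, $D(\alpha)=\{\alpha_1,\alpha_1+\alpha_2,\dots,\alpha_1+\cdots+\alpha_{k-1}\}\subset[n-1]$. For $w=w_1\cdots w_k\in S^{\mathfrak M}_n$ let $w^{-1}$ be the word of length $n$ whose $i$-th letter is the index $j$ with $i\in w_j$; $w$ has type $\alpha$ (a composition of $n$) if the descent set $\{i\in[n-1]:(w^{-1})_i>(w^{-1})_{i+1}\}$ equals $D(\alpha)$. $\tilde R_\alpha\in\mathfrak M\mathrm{MR}$ is the sum of all $w\in S^{\mathfrak M}_n$ of type $\alpha$ (with $\tilde R_\emptyset=\emptyset$). $\mathfrak M\mathrm{NSym}$ is the span of all $\tilde R_\alpha$ over all compositions; the $\tilde R_\alpha$ are linearly independent. Hopf algebra $\mathfrak m\mathrm{QSym}$: for a composition $\alpha$ of $n$ choose $w\in S_n$ with descent set $D(\alpha)$. $\tilde L_\alpha\in\mathbb Z[[x_1,x_2,\dots]]$ is the sum, over all sequences $(\sigma_1,\dots,\sigma_n)$ of nonempty finite sets of positive integers with $\max\sigma_i\le\min\sigma_{i+1}$ if $w_i<w_{i+1}$ and $\max\sigma_i<\min\sigma_{i+1}$ if $w_i>w_{i+1}$, of $\prod_i\prod_{r\in\sigma_i}x_r$ (with $\tilde L_\emptyset=1$). $\mathfrak m\mathrm{QSym}=\prod_\alpha\mathbb Z\tilde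 L_\alpha$ (arbitrary linear combinations), with the product of power series and coproduct $f(x)\mapsto f(x,y)$ (evaluation on the ordered variables $x_1<x_2<\cdots<y_1<y_2<\cdots$, in the completed tensor square). Continuous duality: the space $V$ of arbitrary $\mathbb Z$-linear combinations of elements $v_s$ ($s\in S$) and its continuous dual $V_c^*$ (functionals respecting infinite linear combinations; free with basis $f_s$, $f_s(v_{s'})=\delta_{ss'}$) are called continuous duals with dual bases $\{v_s\},\{f_s\}$; for Hopf algebras, the structure maps are required to be transposes of each other. *)

theory Defs
  imports "HOL-Library.Poly_Mapping" "HOL-Library.FuncSet"
    "HOL-Combinatorics.Multiset_Permutations"
begin

section \<open>Hopf algebras that are free as abelian groups\<close>

text \<open>
  The free abelian group on a set \<open>X\<close> of type \<open>'a set\<close> consists of the finitely supported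
  functions \<open>'a \<Rightarrow>\<^sub>0 int\<close> whose keys lie in \<open>X\<close> (\<open>frag_of\<close>, \<open>frag_cmul\<close>, \<open>frag_extend\<close> are the
  library's basis vectors, scalar multiplication, and linear extension).  The tensor product of
  the free groups on \<open>X\<close> and \<open>Y\<close> is the free group on \<open>X \<times> Y\<close>.  A multiplication is
  a linear map on the tensor square, the product of \<open>x\<close> and \<open>y\<close> being \<open>mu (tens x y)\<close>.
\<close>

definition free_on :: "'a set \<Rightarrow> ('a \<Rightarrow>\<^sub>0 int) set" where
  "free_on X = {x. Poly_Mapping.keys x \<subseteq> X}"

definition tens :: "('a \<Rightarrow>\<^sub>0 int) \<Rightarrow> ('b \<Rightarrow>\<^sub>0 int) \<Rightarrow> ('a \<times> 'b \<Rightarrow>\<^sub>0 int)" where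
  "tens x y = frag_extend (\<lambda>a. frag_extend (\<lambda>b. frag_of (a, b)) y) x"

definition tensor_map ::
  "(('a \<Rightarrow>\<^sub>0 int) \<Rightarrow> ('c \<Rightarrow>\<^sub>0 int)) \<Rightarrow> (('b \<Rightarrow>\<^sub>0 int) \<Rightarrow> ('d \<Rightarrow>\<^sub>0 int))
     \<Rightarrow> ('a \<times> 'b \<Rightarrow>\<^sub>0 int) \<Rightarrow> ('c \<times> 'd \<Rightarrow>\<^sub>0 int)" where
  "tensor_map f g = frag_extend (\<lambda>(a, b). tens (f (frag_of a)) (g (frag_of b)))"

definition additive_map ::
  "'a::ab_group_add set \<Rightarrow> 'b::ab_group_add set \<Rightarrow> ('a \<Rightarrow> 'b) \<Rightarrow> bool" where
  "additive_map H K f \<longleftrightarrow> (\<forall>x\<in>H. f x \<in> K) \<and> (\<forall>x\<in>H. \<forall>y\<in>H. f (x + y) = f x + f y)"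

definition hopf_algebra ::
  "'a set \<Rightarrow> (('a \<times> 'a \<Rightarrow>\<^sub>0 int) \<Rightarrow> ('a \<Rightarrow>\<^sub>0 int)) \<Rightarrow> ('a \<Rightarrow>\<^sub>0 int)
    \<Rightarrow> (('a \<Rightarrow>\<^sub>0 int) \<Rightarrow> ('a \<times> 'a \<Rightarrow>\<^sub>0 int)) \<Rightarrow> (('a \<Rightarrow>\<^sub>0 int) \<Rightarrow> int)
    \<Rightarrow> (('a \<Rightarrow>\<^sub>0 int) \<Rightarrow> ('a \<Rightarrow>\<^sub>0 int)) \<Rightarrow> bool" where
  "hopf_algebra X mu eta Delta eps anti \<longleftrightarrow>
    additive_map (free_on (X \<times> X)) (free_on X) mu \<and>
    eta \<in> free_on X \<and>
    additive_map (free_on X) (free_on (X \<times> X)) Delta \<and>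
    additive_map (free_on X) UNIV eps \<and>
    additive_map (free_on X) (free_on X) anti \<and>
    (\<forall>x\<in>free_on X. \<forall>y\<in>free_on X. \<forall>z\<in>free_on X.
       mu (tens (mu (tens x y)) z) = mu (tens x (mu (tens y z)))) \<and>
    (\<forall>x\<in>free_on X. mu (tens eta x) = x \<and> mu (tens x eta) = x) \<and>
    (\<forall>x\<in>free_on X.
       frag_extend (\<lambda>((a, b), c). frag_of (a, (b, c))) (tensor_map Delta id (Delta x))
         = tensor_map id Delta (Delta x)) \<and>
    (\<forall>x\<in>free_on X.
       frag_extend (\<lambda>(a, b). frag_cmul (eps (frag_of a)) (frag_of b)) (Delta x) = x \<and>
       frag_extend (\<lambda>(a, b). frag_cmul (eps (frag_of b)) (frag_of a)) (Delta x) = x) \<and>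
    (\<forall>x\<in>free_on X. \<forall>y\<in>free_on X.
       Delta (mu (tens x y)) =
         tensor_map mu mu
           (frag_extend (\<lambda>((a, b), (c, d)). frag_of ((a, c), (b, d))) (tens (Delta x) (Delta y)))) \<and>
    Delta eta = tens eta eta \<and>
    (\<forall>x\<in>free_on X. \<forall>y\<in>free_on X. eps (mu (tens x y)) = eps x * eps y) \<and>
    eps eta = 1 \<and>
    (\<forall>x\<in>free_on X.
       mu (tensor_map anti id (Delta x)) = frag_cmul (eps x) eta \<and>
       mu (tensor_map id anti (Delta x)) = frag_cmul (eps x) eta)"

text \<open>
  For a subgroup \<open>A\<close> of a free abelian group, \<open>A \<otimes> A\<close> embeds in the tensor square of the
  free group, with image the span of the pure tensors.
\<close>

definition hopf_subalgebra ::
  "('a \<Rightarrow>\<^sub>0 int) set \<Rightarrow> 'a set \<Rightarrow> (('a \<times> 'a \<Rightarrow>\<^sub>0 int) \<Rightarrow> ('a \<Rightarrow>\<^sub>0 int)) \<Rightarrow> ('a \<Rightarrow>\<^sub>0 int)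
    \<Rightarrow> (('a \<Rightarrow>\<^sub>0 int) \<Rightarrow> ('a \<times> 'a \<Rightarrow>\<^sub>0 int)) \<Rightarrow> (('a \<Rightarrow>\<^sub>0 int) \<Rightarrow> int)
    \<Rightarrow> (('a \<Rightarrow>\<^sub>0 int) \<Rightarrow> ('a \<Rightarrow>\<^sub>0 int)) \<Rightarrow> bool" where
  "hopf_subalgebra A X mu eta Delta eps anti \<longleftrightarrow>
    hopf_algebra X mu eta Delta eps anti \<and>
    A \<subseteq> free_on X \<and> module.subspace frag_cmul A \<and>
    (\<forall>x\<in>A. \<forall>y\<in>A. mu (tens x y) \<in> A) \<and> eta \<in> A \<and>
    (\<forall>x\<in>A. Delta x \<in> module.span frag_cmul {tens y z | y z. y \<in> A \<and> z \<in> A}) \<and>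
    (\<forall>x\<in>A. anti x \<in> A)"

section \<open>Infinite linear combinations and continuous duality\<close>

text \<open>
  Infinite linear combinations are formed coordinatewise in the space of functions \<open>'m \<Rightarrow> int\<close>
  (for power series, \<open>'m\<close> is the type of monomials).  They make sense when each coordinate is
  nonzero for only finitely many \<open>v s\<close>, which is the first part of \<open>infinite_basis\<close>.
\<close>

definition inf_comb :: "'s set \<Rightarrow> ('s \<Rightarrow> 'm \<Rightarrow> int) \<Rightarrow> ('s \<Rightarrow> int) \<Rightarrow> 'm \<Rightarrow> int" where
  "inf_comb I v c = (\<lambda>m. \<Sum>s\<in>{s\<in>I. v s m \<noteq> 0}. c s * v s m)"

definition inf_span :: "'s set \<Rightarrow> ('s \<Rightarrow> 'm \<Rightarrow> int) \<Rightarrow> ('m \<Rightarrow> int) set" where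
  "inf_span I v = range (inf_comb I v)"

definition infinite_basis :: "'s set \<Rightarrow> ('s \<Rightarrow> 'm \<Rightarrow> int) \<Rightarrow> bool" where
  "infinite_basis I v \<longleftrightarrow>
    (\<forall>m. finite {s\<in>I. v s m \<noteq> 0}) \<and>
    (\<forall>c d. inf_comb I v c = inf_comb I v d \<longrightarrow> (\<forall>s\<in>I. c s = d s))"

text \<open>
  A functional respecting infinite linear combinations satisfies
  \<open>\<phi> (\<Sum> c\<^sub>s v\<^sub>s) = \<Sum> c\<^sub>s \<phi> (v\<^sub>s)\<close> for all coefficients \<open>c\<close>, which forces the right-hand
  side to be a finite sum.
\<close>

definition continuous_functional ::
  "'s set \<Rightarrow> ('s \<Rightarrow> 'm \<Rightarrow> int) \<Rightarrow> (('m \<Rightarrow> int) \<Rightarrow> int) \<Rightarrow> bool" where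
  "continuous_functional I v \<phi> \<longleftrightarrow>
    finite {s\<in>I. \<phi> (v s) \<noteq> 0} \<and>
    (\<forall>c. \<phi> (inf_comb I v c) = (\<Sum>s\<in>{s\<in>I. \<phi> (v s) \<noteq> 0}. c s * \<phi> (v s)))"

definition continuous_dual ::
  "'s set \<Rightarrow> ('s \<Rightarrow> 'm \<Rightarrow> int) \<Rightarrow> (('m \<Rightarrow> int) \<Rightarrow> int) set" where
  "continuous_dual I v = {\<phi> \<in> extensional (inf_span I v). continuous_functional I v \<phi>}"

definition continuous_map ::
  "'s set \<Rightarrow> ('s \<Rightarrow> 'm \<Rightarrow> int) \<Rightarrow> ('k \<Rightarrow> int) set \<Rightarrow> (('m \<Rightarrow> int) \<Rightarrow> ('k \<Rightarrow> int)) \<Rightarrow> bool" where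
  "continuous_map I v W \<phi> \<longleftrightarrow>
    (\<forall>g\<in>inf_span I v. \<phi> g \<in> W) \<and> (\<forall>k. continuous_functional I v (\<lambda>g. \<phi> g k))"

text \<open>
  \<open>B\<close> is a pairing that identifies the span of the \<open>f\<^sub>s\<close> with the continuous dual of the
  space of arbitrary linear combinations of the \<open>v\<^sub>s\<close>, such that the two bases are dual.
\<close>

definition continuous_duals_via ::
  "'s set \<Rightarrow> ('s \<Rightarrow> 'm \<Rightarrow> int) \<Rightarrow> ('s \<Rightarrow> ('a \<Rightarrow>\<^sub>0 int))
    \<Rightarrow> (('a \<Rightarrow>\<^sub>0 int) \<Rightarrow> ('m \<Rightarrow> int) \<Rightarrow> int) \<Rightarrow> bool" where
  "continuous_duals_via I v f B \<longleftrightarrow>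
    infinite_basis I v \<and>
    (\<forall>x\<in>module.span frag_cmul (f ` I). \<forall>y\<in>module.span frag_cmul (f ` I). \<forall>g\<in>inf_span I v.
       B (x + y) g = B x g + B y g) \<and>
    bij_betw (\<lambda>x. restrict (B x) (inf_span I v))
      (module.span frag_cmul (f ` I)) (continuous_dual I v) \<and>
    (\<forall>s\<in>I. \<forall>t\<in>I. B (f s) (v t) = (if s = t then 1 else 0))"

subsection \<open>Complete Hopf algebras\<close>

definition tensf :: "('m \<Rightarrow> int) \<Rightarrow> ('k \<Rightarrow> int) \<Rightarrow> 'm \<times> 'k \<Rightarrow> int" where
  "tensf g h = (\<lambda>(a, b). g a * h b)"

text \<open>
  The completed tensor square of \<open>inf_span I v\<close> is \<open>inf_span (I \<times> I) (tensf_family v)\<close>, inside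
  the functions on \<open>'m \<times> 'm\<close>.  On such functions, \<open>map_left \<phi>\<close> and \<open>map_right \<phi>\<close> apply \<open>\<phi>\<close> in
  one of the two arguments; for continuous linear \<open>\<phi>\<close> these are \<open>\<phi> \<otimes> id\<close> and
  \<open>id \<otimes> \<phi>\<close> on the completed tensor square.
\<close>

definition tensf_family :: "('s \<Rightarrow> 'm \<Rightarrow> int) \<Rightarrow> 's \<times> 's \<Rightarrow> 'm \<times> 'm \<Rightarrow> int" where
  "tensf_family v = (\<lambda>(s, t). tensf (v s) (v t))"

definition map_left ::
  "(('m \<Rightarrow> int) \<Rightarrow> ('k \<Rightarrow> int)) \<Rightarrow> ('m \<times> 'n \<Rightarrow> int) \<Rightarrow> ('k \<times> 'n \<Rightarrow> int)" where
  "map_left \<phi> z = (\<lambda>(k, b). \<phi> (\<lambda>a. z (a, b)) k)"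

definition map_right ::
  "(('m \<Rightarrow> int) \<Rightarrow> ('k \<Rightarrow> int)) \<Rightarrow> ('n \<times> 'm \<Rightarrow> int) \<Rightarrow> ('n \<times> 'k \<Rightarrow> int)" where
  "map_right \<phi> z = (\<lambda>(a, k). \<phi> (\<lambda>b. z (a, b)) k)"

definition complete_hopf_algebra ::
  "'s set \<Rightarrow> ('s \<Rightarrow> 'm \<Rightarrow> int) \<Rightarrow> (('m \<times> 'm \<Rightarrow> int) \<Rightarrow> ('m \<Rightarrow> int)) \<Rightarrow> ('m \<Rightarrow> int)
    \<Rightarrow> (('m \<Rightarrow> int) \<Rightarrow> ('m \<times> 'm \<Rightarrow> int)) \<Rightarrow> (('m \<Rightarrow> int) \<Rightarrow> int)
    \<Rightarrow> (('m \<Rightarrow> int) \<Rightarrow> ('m \<Rightarrow> int)) \<Rightarrow> bool" where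
  "complete_hopf_algebra I v mu eta Delta eps anti \<longleftrightarrow>
    infinite_basis I v \<and>
    continuous_map (I \<times> I) (tensf_family v) (inf_span I v) mu \<and>
    eta \<in> inf_span I v \<and>
    continuous_map I v (inf_span (I \<times> I) (tensf_family v)) Delta \<and>
    continuous_functional I v eps \<and>
    continuous_map I v (inf_span I v) anti \<and>
    (\<forall>f\<in>inf_span I v. \<forall>g\<in>inf_span I v. \<forall>h\<in>inf_span I v.
       mu (tensf (mu (tensf f g)) h) = mu (tensf f (mu (tensf g h)))) \<and>
    (\<forall>f\<in>inf_span I v. mu (tensf eta f) = f \<and> mu (tensf f eta) = f) \<and>
    (\<forall>f\<in>inf_span I v. \<forall>a b c.
       map_left Delta (Delta f) ((a, b), c) = map_right Delta (Delta f) (a, (b, c))) \<and>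
    (\<forall>f\<in>inf_span I v.
       (\<lambda>b. eps (\<lambda>a. Delta f (a, b))) = f \<and> (\<lambda>a. eps (\<lambda>b. Delta f (a, b))) = f) \<and>
    (\<forall>f\<in>inf_span I v. \<forall>g\<in>inf_span I v.
       Delta (mu (tensf f g)) =
         map_right mu (map_left mu
           (\<lambda>((a, c), (b, d)). Delta f (a, b) * Delta g (c, d)))) \<and>
    Delta eta = tensf eta eta \<and>
    (\<forall>f\<in>inf_span I v. \<forall>g\<in>inf_span I v. eps (mu (tensf f g)) = eps f * eps g) \<and>
    eps eta = 1 \<and>
    (\<forall>f\<in>inf_span I v.
       mu (map_left anti (Delta f)) = (\<lambda>m. eps f * eta m) \<and>
       mu (map_right anti (Delta f)) = (\<lambda>m. eps f * eta m))"

text \<open>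
  Duality of Hopf algebras: \<open>B\<close> pairs the span \<open>A\<close> of the \<open>f\<^sub>s\<close> with the space \<open>V\<close> of
  arbitrary combinations of the \<open>v\<^sub>s\<close>, \<open>B2\<close> is the induced pairing of \<open>A \<otimes> A\<close> with
  the completed tensor square of \<open>V\<close>, and the structure maps of \<open>A\<close> (unprimed) and of \<open>V\<close>
  (primed) are transposes of each other.
\<close>

definition hopf_continuous_duals ::
  "'s set \<Rightarrow> ('s \<Rightarrow> ('a \<Rightarrow>\<^sub>0 int)) \<Rightarrow> ('s \<Rightarrow> 'm \<Rightarrow> int)
    \<Rightarrow> (('a \<times> 'a \<Rightarrow>\<^sub>0 int) \<Rightarrow> ('a \<Rightarrow>\<^sub>0 int)) \<Rightarrow> ('a \<Rightarrow>\<^sub>0 int)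
    \<Rightarrow> (('a \<Rightarrow>\<^sub>0 int) \<Rightarrow> ('a \<times> 'a \<Rightarrow>\<^sub>0 int)) \<Rightarrow> (('a \<Rightarrow>\<^sub>0 int) \<Rightarrow> int)
    \<Rightarrow> (('a \<Rightarrow>\<^sub>0 int) \<Rightarrow> ('a \<Rightarrow>\<^sub>0 int))
    \<Rightarrow> (('m \<times> 'm \<Rightarrow> int) \<Rightarrow> ('m \<Rightarrow> int)) \<Rightarrow> ('m \<Rightarrow> int)
    \<Rightarrow> (('m \<Rightarrow> int) \<Rightarrow> ('m \<times> 'm \<Rightarrow> int)) \<Rightarrow> (('m \<Rightarrow> int) \<Rightarrow> int)
    \<Rightarrow> (('m \<Rightarrow> int) \<Rightarrow> ('m \<Rightarrow> int)) \<Rightarrow> bool" where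
  "hopf_continuous_duals I f v mu eta Delta eps anti mu' eta' Delta' eps' anti' \<longleftrightarrow>
    (let A = module.span frag_cmul (f ` I);
         A2 = module.span frag_cmul {tens x y | x y. x \<in> A \<and> y \<in> A};
         V = inf_span I v;
         V2 = inf_span (I \<times> I) (tensf_family v)
     in \<exists>B B2.
       continuous_duals_via I v f B \<and>
       continuous_duals_via (I \<times> I) (tensf_family v) (\<lambda>(s, t). tens (f s) (f t)) B2 \<and>
       (\<forall>x\<in>A. \<forall>y\<in>A. \<forall>g\<in>V. \<forall>h\<in>V. B2 (tens x y) (tensf g h) = B x g * B y h) \<and>
       (\<forall>z\<in>A2. \<forall>g\<in>V. B (mu z) g = B2 z (Delta' g)) \<and>
       (\<forall>g\<in>V. B eta g = eps' g) \<and>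
       (\<forall>x\<in>A. \<forall>h\<in>V2. B2 (Delta x) h = B x (mu' h)) \<and>
       (\<forall>x\<in>A. eps x = B x eta') \<and>
       (\<forall>x\<in>A. \<forall>g\<in>V. B (anti x) g = B x (anti' g)))"

section \<open>The Hopf algebra \<open>\<MM>MR\<close>\<close>

definition set_composition :: "nat set \<Rightarrow> nat set list \<Rightarrow> bool" where
  "set_composition T w \<longleftrightarrow>
    finite T \<and> 0 \<notin> T \<and> (\<forall>P\<in>set w. P \<noteq> {}) \<and> sorted_wrt disjnt w \<and> \<Union>(set w) = T"

definition M_perms :: "nat \<Rightarrow> nat set list set" where
  "M_perms n =
    {w. set_composition {1..n} w \<and> (\<forall>P\<in>set w. \<forall>i. \<not> (i \<in> P \<and> Suc i \<in> P))}"

definition M_perms_all :: "nat set list set" where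
  "M_perms_all = (\<Union>n. M_perms n)"

definition size_of :: "nat set list \<Rightarrow> nat" where
  "size_of w = card (\<Union>(set w))"

inductive st_step :: "nat set list \<Rightarrow> nat set list \<Rightarrow> bool" where
  R1: "P \<in> set w \<Longrightarrow> i \<in> P \<Longrightarrow> Suc i \<in> P \<Longrightarrow> st_step w (map (\<lambda>Q. Q - {Suc i}) w)"
| R2: "1 \<le> i \<Longrightarrow> i \<notin> \<Union>(set w) \<Longrightarrow>
        st_step w (map (\<lambda>Q. (\<lambda>x. if i < x then x - 1 else x) ` Q) w)"

definition st :: "nat set list \<Rightarrow> nat set list" where
  "st w = (THE v. st_step\<^sup>*\<^sup>* w v \<and> v \<in> M_perms_all)"

definition restr :: "nat set list \<Rightarrow> nat set \<Rightarrow> nat set list" where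
  "restr w T = filter (\<lambda>P. P \<noteq> {}) (map (\<lambda>P. P \<inter> T) w)"

text \<open>
  When \<open>m = n = 0\<close> there are no \<open>\<MM>\<close>-permutations of \<open>[m + n - 1] = [-1]\<close>; subtraction on
  \<open>nat\<close> truncates, so this case is excluded explicitly from the second sum.
\<close>

definition M_prod :: "nat set list \<Rightarrow> nat set list \<Rightarrow> (nat set list \<Rightarrow>\<^sub>0 int)" where
  "M_prod w u = (let m = size_of w; n = size_of u in
     (\<Sum>v\<in>{v \<in> M_perms (m + n). restr v {1..m} = w \<and> st (restr v {m+1..m+n}) = u}. frag_of v) +
     (\<Sum>v\<in>{v \<in> M_perms (m + n - 1). 1 \<le> m + n \<and>
            restr v {1..m} = w \<and> st (restr v {m..m+n-1}) = u}. frag_of v))"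

definition MMR_mult :: "(nat set list \<times> nat set list \<Rightarrow>\<^sub>0 int) \<Rightarrow> (nat set list \<Rightarrow>\<^sub>0 int)" where
  "MMR_mult = frag_extend (\<lambda>(w, u). M_prod w u)"

definition MMR_unit :: "nat set list \<Rightarrow>\<^sub>0 int" where
  "MMR_unit = frag_of []"

definition MMR_comult :: "(nat set list \<Rightarrow>\<^sub>0 int) \<Rightarrow> (nat set list \<times> nat set list \<Rightarrow>\<^sub>0 int)" where
  "MMR_comult = frag_extend (\<lambda>w. \<Sum>(u, v)\<in>{(u, v). u @ v = w}. frag_of (st u, st v))"

definition MMR_counit :: "(nat set list \<Rightarrow>\<^sub>0 int) \<Rightarrow> int" where
  "MMR_counit x = Poly_Mapping.lookup x []"

section \<open>The subspace \<open>\<MM>NSym\<close>\<close>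

definition compositions :: "nat list set" where
  "compositions = {\<alpha>. 0 \<notin> set \<alpha>}"

definition D :: "nat list \<Rightarrow> nat set" where
  "D \<alpha> = {sum_list (take j \<alpha>) | j. 1 \<le> j \<and> j < length \<alpha>}"

text \<open>Positions in words are counted from 1.\<close>

definition descents :: "nat list \<Rightarrow> nat set" where
  "descents p = {i. 1 \<le> i \<and> i < length p \<and> p ! (i - 1) > p ! i}"

definition inv_word :: "nat set list \<Rightarrow> nat list" where
  "inv_word w = map (\<lambda>i. THE j. j \<in> {1..length w} \<and> i \<in> w ! (j - 1)) [1..<size_of w + 1]"

definition Rtilde :: "nat list \<Rightarrow> (nat set list \<Rightarrow>\<^sub>0 int)" where
  "Rtilde \<alpha> = (\<Sum>w\<in>{w \<in> M_perms (sum_list \<alpha>). descents (inv_word w) = D \<alpha>}. frag_of w)"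

definition MNSym :: "(nat set list \<Rightarrow>\<^sub>0 int) set" where
  "MNSym = module.span frag_cmul (Rtilde ` compositions)"

section \<open>The Hopf algebra \<open>\<mm>QSym\<close>\<close>

text \<open>
  Power series in \<open>x\<^sub>1, x\<^sub>2, \<dots>\<close> are functions on exponent vectors, the index \<open>i :: nat\<close>
  standing for the variable \<open>x\<^sub>i\<^sub>+\<^sub>1\<close>; only the order of the variables matters below.
\<close>

type_synonym monom = "nat \<Rightarrow>\<^sub>0 nat"
type_synonym series = "monom \<Rightarrow> int"

text \<open>
  \<open>L_word p\<close> is the sum over all admissible sequences \<open>\<sigma>\<close>: its coefficient at \<open>m\<close> is the
  number of \<open>\<sigma>\<close> whose monomial is \<open>m\<close>.
\<close>

definition L_word :: "nat list \<Rightarrow> series" where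
  "L_word p = (\<lambda>m. int (card {\<sigma> :: nat set list.
     length \<sigma> = length p \<and>
     (\<forall>P\<in>set \<sigma>. finite P \<and> P \<noteq> {}) \<and>
     (\<forall>i. Suc i < length p \<longrightarrow>
        (p ! i < p ! Suc i \<longrightarrow> Max (\<sigma> ! i) \<le> Min (\<sigma> ! Suc i)) \<and>
        (p ! i > p ! Suc i \<longrightarrow> Max (\<sigma> ! i) < Min (\<sigma> ! Suc i))) \<and>
     (\<Sum>i<length \<sigma>. \<Sum>r\<in>\<sigma> ! i. Poly_Mapping.single r 1) = m}))"

definition Ltilde :: "nat list \<Rightarrow> series" where
  "Ltilde \<alpha> = L_word (SOME p. p \<in> permutations_of_set {1..sum_list \<alpha>} \<and> descents p = D \<alpha>)"

definition series_mult :: "(monom \<times> monom \<Rightarrow> int) \<Rightarrow> series" where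
  "series_mult z = (\<lambda>m. \<Sum>(a, b)\<in>{(a, b). a + b = m}. z (a, b))"

definition series_one :: series where
  "series_one = (\<lambda>m. if m = 0 then 1 else 0)"

definition constant_term :: "series \<Rightarrow> int" where
  "constant_term f = f 0"

text \<open>
  The evaluation of a quasisymmetric series \<open>f\<close> on an ordered alphabet has, at the monomial
  \<open>z\<^sub>1\<^sup>c\<^sup>1 \<dots> z\<^sub>k\<^sup>c\<^sup>k\<close> with \<open>z\<^sub>1 < \<dots> < z\<^sub>k\<close>, the coefficient of \<open>f\<close> at \<open>x\<^sub>1\<^sup>c\<^sup>1 \<dots> x\<^sub>k\<^sup>c\<^sup>k\<close>.
  For the alphabet \<open>x\<^sub>1 < x\<^sub>2 < \<dots> < y\<^sub>1 < y\<^sub>2 < \<dots>\<close> and the monomial \<open>x\<^sup>a y\<^sup>b\<close> the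
  exponents are the nonzero exponents of \<open>a\<close> in order, followed by those of \<open>b\<close>.
\<close>

definition exponents :: "monom \<Rightarrow> nat list" where
  "exponents m = map (Poly_Mapping.lookup m) (sorted_list_of_set (Poly_Mapping.keys m))"

definition monomial_of :: "nat list \<Rightarrow> monom" where
  "monomial_of c = (\<Sum>i<length c. Poly_Mapping.single i (c ! i))"

definition series_comult :: "series \<Rightarrow> (monom \<times> monom \<Rightarrow> int)" where
  "series_comult f = (\<lambda>(a, b). f (monomial_of (exponents a @ exponents b)))"

end

(*
  An M-permutation is determined by the word listing the block of each letter, and these words
  matter only up to order isomorphism; they are the words without equal adjacent letters.  Such
  words form a monoid under concatenation followed by merging equal adjacent letters.  The
  coefficient of a word in a product is the sum over its factorizations in this monoid, which
  gives associativity.  The coefficient of a pair (a, b) in a coproduct is the sum over the words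
  in the disjoint union of two alphabets that restrict to a and b; restriction to an alphabet is
  a monoid homomorphism, so the coproduct is multiplicative.

  MNSym consists of the elements whose coefficients depend only on the size and descent set, so
  it is closed under products.  Let H_b be the increasing word 1 2 ... b and H_c the product of the
  H_b over the entries b of c.  The coefficient of H_c at a word of type alpha is the coefficient of
  the monomial with exponents c in Ltilde_alpha: both satisfy the recursion that removes the first
  entry of c, respectively the smallest variable.  This matrix is unitriangular, so the H_c are a
  basis of MNSym, the Ltilde_alpha are a basis of the quasisymmetric series, and in the pairing
  for which Rtilde and Ltilde are dual, H_c is evaluation at the monomial with exponents c.
  Products of H_c are concatenations and the coproduct of H_b is the sum of H_i (x) H_(b-i); these
  are the transposes of the coproduct and product of series.
*)
theory Submission
  imports Defs
begin

text \<open>Two factors of a word may share the letter at the cut, so MMR is filtered by size but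
  not graded. This shapes several steps. Unitriangularity needs an order by size before descent
  sets, because \<open>H c\<close> also involves words shorter than the sum of \<open>c\<close>. The
  antipode is built by recursion on the number of blocks, which deconcatenation does respect, as a
  convolution inverse of the identity. Over two disjoint alphabets, infinitely many words can have
  the same pair of merged restrictions (01, 0101, 010101, ...), so each coproduct coefficient is
  summed over a finite set of words that contains the support of the element at hand.

  The two alphabets are the letters below a threshold \<open>N\<close> and the others: cutting the
  list of blocks is cutting the alphabet.

  On the series side, arbitrary combinations of the \<open>Ltilde\<close> are exactly the
  quasisymmetric series, of unbounded degree: a triangular system with finitely many earlier
  unknowns in each equation can be solved. The axioms are then checked on coefficients, with one
  exception: the antipode of series is defined as a transpose, so its identity comes from the
  pairing.\<close>

abbreviation coeff :: "('a \<Rightarrow>\<^sub>0 'b::zero) \<Rightarrow> 'a \<Rightarrow> 'b" where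
  "coeff \<equiv> Poly_Mapping.lookup"

section \<open>Linear algebra in free abelian groups\<close>

interpretation frag: module frag_cmul
  by unfold_locales (simp_all add: frag_cmul_distrib frag_cmul_distrib2)

lemma lookup_frag_extend:
  assumes "finite A" "Poly_Mapping.keys x \<subseteq> A"
  shows "coeff (frag_extend f x) b
    = (\<Sum>a\<in>A. coeff x a * coeff (f a) b)"
  unfolding frag_extend_def lookup_sum lookup_frag_cmul using assms
  by (intro sum.mono_neutral_left) (auto simp: in_keys_iff)

lemma frag_extend_sum':
  "frag_extend f (\<Sum>i\<in>I. g i) = (\<Sum>i\<in>I. frag_extend f (g i))"
  by (induction I rule: infinite_finite_induct) (simp_all add: frag_extend_add)

lemma frag_extend_frag_of [simp]: "frag_extend frag_of x = x"
  using frag_expansion by metis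

lemma free_on_iff: "x \<in> free_on X \<longleftrightarrow> (\<forall>a. coeff x a \<noteq> 0 \<longrightarrow> a \<in> X)"
  by (auto simp: free_on_def in_keys_iff)

lemma subspace_free_on: "frag.subspace (free_on X)"
proof (rule frag.subspaceI)
  fix x y :: "'a \<Rightarrow>\<^sub>0 int"
  assume "x \<in> free_on X" "y \<in> free_on X"
  then show "x + y \<in> free_on X"
    using keys_add[of x y] unfolding free_on_def by blast
qed (auto simp: free_on_iff)

lemma free_on_frag_of [simp]: "frag_of a \<in> free_on X \<longleftrightarrow> a \<in> X"
  by (simp add: free_on_def)

lemma free_on_sum: "(\<And>i. i \<in> I \<Longrightarrow> f i \<in> free_on X) \<Longrightarrow> (\<Sum>i\<in>I. f i) \<in> free_on X"
  by (rule frag.subspace_sum[OF subspace_free_on])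

lemma free_on_frag_extend:
  assumes "x \<in> free_on X" "\<And>a. a \<in> X \<Longrightarrow> f a \<in> free_on Y"
  shows "frag_extend f x \<in> free_on Y"
  using assms keys_frag_extend[of f x] unfolding free_on_def by fastforce

lemma free_on_induct [consumes 1, case_names zero one diff]:
  assumes "x \<in> free_on X" "P 0" "\<And>a. a \<in> X \<Longrightarrow> P (frag_of a)"
    "\<And>x y. P x \<Longrightarrow> P y \<Longrightarrow> P (x - y)"
  shows "P x"
  using assms frag_induction[of x X P] unfolding free_on_def by blast

lemma lookup_tens [simp]:
  "coeff (tens x y) (a, b) = coeff x a * coeff y b"
proof -
  have *: "coeff (frag_extend (\<lambda>b. frag_of (a', b)) y) (a, b)
      = (if a' = a then coeff y b else 0)" for a'
    by (simp add: lookup_frag_extend[OF finite_keys order_refl] if_distrib in_keys_iff cong: if_cong)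
  show ?thesis
    unfolding tens_def lookup_frag_extend[OF finite_keys[of x] order_refl]
    unfolding * by (simp add: if_distrib in_keys_iff cong: if_cong)
qed

lemma pair_mapping_eqI:
  "(\<And>a b. coeff x (a, b) = coeff y (a, b)) \<Longrightarrow> x = y"
  by (rule poly_mapping_eqI) auto

lemma tens_simps:
  "tens (x + x') y = tens x y + tens x' y"
  "tens (x - x') y = tens x y - tens x' y"
  "tens x (y + y') = tens x y + tens x y'"
  "tens x (y - y') = tens x y - tens x y'"
  "tens (- x) y = - tens x y"
  "tens x (- y) = - tens x y"
  "tens (frag_cmul c x) y = frag_cmul c (tens x y)"
  "tens x (frag_cmul c y) = frag_cmul c (tens x y)"
  "tens 0 y = 0" "tens x 0 = 0"
  by (rule pair_mapping_eqI; simp add: lookup_add lookup_minus lookup_uminus algebra_simps)+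

lemma tens_frag_of [simp]: "tens (frag_of a) (frag_of b) = frag_of (a, b)"
  by (rule pair_mapping_eqI) auto

lemma tens_sum_left: "tens (\<Sum>i\<in>I. f i) y = (\<Sum>i\<in>I. tens (f i) y)"
  by (induction I rule: infinite_finite_induct) (simp_all add: tens_simps)

lemma tens_sum_right: "tens x (\<Sum>i\<in>I. f i) = (\<Sum>i\<in>I. tens x (f i))"
  by (induction I rule: infinite_finite_induct) (simp_all add: tens_simps)

lemma tens_free_on: "x \<in> free_on X \<Longrightarrow> y \<in> free_on Y \<Longrightarrow> tens x y \<in> free_on (X \<times> Y)"
  by (auto simp: free_on_iff)

lemma tensor_map_frag_of [simp]:
  "tensor_map f g (frag_of (a, b)) = tens (f (frag_of a)) (g (frag_of b))"
  by (simp add: tensor_map_def)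

lemma tensor_map_simps:
  "tensor_map f g (x + y) = tensor_map f g x + tensor_map f g y"
  "tensor_map f g (x - y) = tensor_map f g x - tensor_map f g y"
  "tensor_map f g (- x) = - tensor_map f g x"
  "tensor_map f g (frag_cmul c x) = frag_cmul c (tensor_map f g x)"
  "tensor_map f g 0 = 0"
  by (simp_all add: tensor_map_def frag_extend_add frag_extend_diff frag_extend_cmul frag_extend_minus)

lemma tensor_map_sum: "tensor_map f g (\<Sum>i\<in>I. h i) = (\<Sum>i\<in>I. tensor_map f g (h i))"
  by (simp add: tensor_map_def frag_extend_sum')

text \<open>\<open>tensor_map\<close> reads its maps only at basis vectors, so it acts factorwise on
  pure tensors when the maps are linear; the form \<open>frag_extend f\<close> encodes
  linearity.\<close>

lemma tensor_map_tens:
  "tensor_map (frag_extend f) (frag_extend g) (tens x y) = tens (frag_extend f x) (frag_extend g y)"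
proof (rule frag_induction[where P = "\<lambda>x. tensor_map (frag_extend f) (frag_extend g) (tens x y)
    = tens (frag_extend f x) (frag_extend g y)" and S = UNIV])
  fix a
  show "tensor_map (frag_extend f) (frag_extend g) (tens (frag_of a) y)
    = tens (frag_extend f (frag_of a)) (frag_extend g y)"
    by (rule frag_induction[where P = "\<lambda>y. tensor_map (frag_extend f) (frag_extend g)
        (tens (frag_of a) y) = tens (frag_extend f (frag_of a)) (frag_extend g y)" and S = UNIV])
      (auto simp: tens_simps tensor_map_simps frag_extend_diff)
qed (auto simp: tens_simps tensor_map_simps frag_extend_diff)

lemma id_eq_frag_extend: "id = frag_extend frag_of"
  by auto

lemma tensor_map_id_tens: "tensor_map (frag_extend f) id (tens x y) = tens (frag_extend f x) y"
  "tensor_map id (frag_extend f) (tens x y) = tens x (frag_extend f y)"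
  unfolding id_eq_frag_extend tensor_map_tens by simp_all

section \<open>Words without equal adjacent letters\<close>

text \<open>With its mirror image this gives the associativity of the merging product
  \<open>remdups_adj (a @ b)\<close>: merging inside a factor beforehand leaves no trace.\<close>

lemma remdups_adj_append_remdups_adj_right [simp]:
  "remdups_adj (a @ remdups_adj b) = remdups_adj (a @ b)"
proof (induction a)
  case (Cons x a)
  then show ?case by (simp add: remdups_adj_Cons)
qed (metis append_Nil distinct_adj_altdef distinct_adj_remdups_adj)

lemma remdups_adj_append_remdups_adj_left [simp]:
  "remdups_adj (remdups_adj a @ b) = remdups_adj (a @ b)"
  using remdups_adj_append_remdups_adj_right[of "rev b" "rev a"]
  by (metis remdups_adj_rev rev_append rev_rev_ident)

text \<open>Makes restriction to a subalphabet, followed by merging, a homomorphism of the merging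
  monoid.\<close>

lemma remdups_adj_filter_remdups_adj [simp]:
  "remdups_adj (filter P (remdups_adj x)) = remdups_adj (filter P x)"
proof (induction x rule: remdups_adj.induct)
  case (3 x y xs)
  have *: "remdups_adj (x # a) = remdups_adj (x # b)" if "remdups_adj a = remdups_adj b" for a b :: "'a list"
    using remdups_adj_append_remdups_adj_right[of "[x]" a]
      remdups_adj_append_remdups_adj_right[of "[x]" b] that by simp
  show ?case
  proof (cases "x = y")
    case True
    then show ?thesis using 3 by (auto split: if_splits)
  next
    case False
    then have "remdups_adj (filter P (remdups_adj (y # xs))) = remdups_adj (filter P (y # xs))"
      using 3 by blast
    then show ?thesis using False *[of "filter P (remdups_adj (y # xs))" "filter P (y # xs)"]
      by simp
  qed
qed auto

lemma distinct_adj_take: "distinct_adj p \<Longrightarrow> distinct_adj (take i p)"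
  by (metis append_take_drop_id distinct_adj_appendD1)

lemma distinct_adj_drop: "distinct_adj p \<Longrightarrow> distinct_adj (drop i p)"
  by (metis append_take_drop_id distinct_adj_append_iff)

text \<open>Two merged factors can clash only at the seam, and there at most one letter is lost,
  since the second letter of \<open>b\<close> differs from its first.\<close>

lemma remdups_adj_append_cases:
  assumes "distinct_adj a" "distinct_adj b"
  shows "remdups_adj (a @ b) = (if a \<noteq> [] \<and> b \<noteq> [] \<and> last a = hd b then a @ tl b else a @ b)"
proof (cases "a = [] \<or> b = []")
  case True
  with assms show ?thesis by (auto simp: distinct_adj_altdef)
next
  case False
  show ?thesis
  proof (cases "last a = hd b")
    case True
    obtain a' x where a: "a = a' @ [x]" using False by (metis rev_exhaust)
    obtain b' where b: "b = x # b'" using False True a by (cases b) auto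
    have "remdups_adj (a @ b) = remdups_adj (a' @ [x] @ [x] @ b')" by (simp add: a b)
    also have "\<dots> = remdups_adj (a' @ x # b')"
      using remdups_adj_append_remdups_adj_right[of a' "x # x # b'"]
        remdups_adj_append_remdups_adj_right[of a' "x # b'"] by simp
    also have "\<dots> = a' @ x # b'"
      using assms unfolding a b distinct_adj_altdef[symmetric]
      by (auto simp: distinct_adj_append_iff distinct_adj_Cons)
    finally show ?thesis using a b by simp
  next
    case ne: False
    then have "distinct_adj (a @ b)" using assms False by (auto simp: distinct_adj_append_iff)
    then show ?thesis using False ne by (simp add: distinct_adj_altdef)
  qed
qed

section \<open>Factorizations in the merging monoid\<close>

definition splits :: "'a list \<Rightarrow> ('a list \<times> 'a list) set" where
  "splits p = {(a, b). distinct_adj a \<and> distinct_adj b \<and> remdups_adj (a @ b) = p}"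

text \<open>A factorization either cuts between two letters or lets both factors contain the letter
  at the cut. These two families become the two sums, over sizes \<open>m + n\<close> and
  \<open>m + n - 1\<close>, in the definition of the product.\<close>

lemma splits_eq:
  assumes "distinct_adj p"
  shows "splits p = (\<lambda>i. (take i p, drop i p)) ` {..length p}
    \<union> (\<lambda>i. (take (Suc i) p, drop i p)) ` {..<length p}"
proof (intro equalityI subsetI)
  fix z assume "z \<in> splits p"
  then obtain a b where z: "z = (a, b)" and ab: "distinct_adj a" "distinct_adj b"
    "remdups_adj (a @ b) = p"
    by (auto simp: splits_def)
  show "z \<in> (\<lambda>i. (take i p, drop i p)) ` {..length p}
    \<union> (\<lambda>i. (take (Suc i) p, drop i p)) ` {..<length p}"
  proof (cases "a \<noteq> [] \<and> b \<noteq> [] \<and> last a = hd b")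
    case True
    then have p: "p = a @ tl b" using ab by (simp add: remdups_adj_append_cases)
    obtain a' x where a: "a = a' @ [x]" using True by (metis rev_exhaust)
    obtain b' where b: "b = x # b'" using True a by (cases b) auto
    have "z = (\<lambda>i. (take (Suc i) p, drop i p)) (length a')" using z p a b by simp
    moreover have "length a' < length p" using p a by simp
    ultimately show ?thesis by blast
  next
    case False
    then have p: "p = a @ b" using ab by (auto simp: remdups_adj_append_cases split: if_splits)
    have "z = (\<lambda>i. (take i p, drop i p)) (length a)" using z p by simp
    moreover have "length a \<le> length p" using p by simp
    ultimately show ?thesis by blast
  qed
next
  fix z assume "z \<in> (\<lambda>i. (take i p, drop i p)) ` {..length p}
    \<union> (\<lambda>i. (take (Suc i) p, drop i p)) ` {..<length p}"
  then consider i where "z = (take i p, drop i p)" | i where "i < length p"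
    "z = (take (Suc i) p, drop i p)" by blast
  then show "z \<in> splits p"
  proof cases
    case 1
    then show ?thesis using assms
      by (simp add: splits_def distinct_adj_take distinct_adj_drop)
        (simp add: distinct_adj_altdef)
  next
    case 2
    have "last (take (Suc i) p) = hd (drop i p)"
      using 2 by (simp add: take_Suc_conv_app_nth hd_drop_conv_nth)
    then have "remdups_adj (take (Suc i) p @ drop i p) = take (Suc i) p @ tl (drop i p)"
      using assms 2 by (subst remdups_adj_append_cases)
        (auto simp: distinct_adj_take distinct_adj_drop)
    also have "\<dots> = p" by (metis append_take_drop_id tl_drop drop_Suc)
    finally show ?thesis using 2 assms
      by (simp add: splits_def distinct_adj_take distinct_adj_drop)
  qed
qed

lemma sum_splits:
  assumes "distinct_adj p"
  shows "(\<Sum>(a, b)\<in>splits p. f a b) = (\<Sum>i\<le>length p. f (take i p) (drop i p))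
    + (\<Sum>i<length p. f (take (Suc i) p) (drop i p))"
proof -
  have 1: "inj_on (\<lambda>i. (take i p, drop i p)) {..length p}"
    by (rule inj_onI) (metis Pair_inject atMost_iff length_take min.absorb2)
  have 2: "inj_on (\<lambda>i. (take (Suc i) p, drop i p)) {..<length p}"
    by (rule inj_onI) (metis Pair_inject lessThan_iff length_take min.absorb2 Suc_le_eq nat.inject)
  \<comment> \<open>The total length of the two factors is \<open>length p\<close> in one family and
    \<open>length p + 1\<close> in the other.\<close>
  have "(take i p, drop i p) \<noteq> (take (Suc j) p, drop j p)"
    if "i \<le> length p" "j < length p" for i j
  proof
    assume "(take i p, drop i p) = (take (Suc j) p, drop j p)"
    then have "length (take i p) + length (drop i p) = length (take (Suc j) p) + length (drop j p)"
      by simp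
    with that show False by simp
  qed
  then show ?thesis
    unfolding splits_eq[OF assms]
    by (subst sum.union_disjoint)
      (auto simp: sum.reindex 1 2)
qed

lemma finite_splits: "distinct_adj p \<Longrightarrow> finite (splits p)"
  by (simp add: splits_eq)

section \<open>Set compositions as words\<close>

text \<open>
  A list of pairs (position, letter), with increasing positions, encodes the set composition whose
  blocks are the sets of positions of the letters, in the order of the letters.
\<close>

definition blocks :: "(nat \<times> nat) list \<Rightarrow> nat set list" where
  "blocks zs = map (\<lambda>l. {x. (x, l) \<in> set zs}) (sorted_list_of_set (snd ` set zs))"

definition timed :: "(nat \<times> nat) list \<Rightarrow> bool" where
  "timed zs \<longleftrightarrow> sorted_wrt (<) (map fst zs) \<and> 0 \<notin> fst ` set zs"

text \<open>The letter of \<open>p\<close> at position \<open>i\<close> names the block that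
  contains \<open>i\<close>, so this inverts \<open>inv_word\<close> up to order isomorphism of the
  letters.\<close>

definition word_comp :: "nat list \<Rightarrow> nat set list" where
  "word_comp p = blocks (enumerate 1 p)"

lemma length_blocks: "length (blocks zs) = card (snd ` set zs)"
  by (simp add: blocks_def)

lemma set_blocks: "set (blocks zs) = (\<lambda>l. {x. (x, l) \<in> set zs}) ` snd ` set zs"
  by (simp add: blocks_def)

lemma Union_blocks: "\<Union>(set (blocks zs)) = fst ` set zs"
  by (force simp: set_blocks)

lemma timed_distinct: "timed zs \<Longrightarrow> distinct (map fst zs)"
  by (simp add: timed_def strict_sorted_iff)

lemma timed_unique: "timed zs \<Longrightarrow> (x, l) \<in> set zs \<Longrightarrow> (x, l') \<in> set zs \<Longrightarrow> l = l'"
  using timed_distinct eq_key_imp_eq_value by metis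

lemma timed_filter: "timed zs \<Longrightarrow> timed (filter P zs)"
  unfolding timed_def by (induction zs) auto

lemma timed_enumerate: "timed (enumerate (Suc n) p)"
  by (auto simp: timed_def in_set_enumerate_eq simp del: upt_Suc)

lemma filter_sorted_list_of_set:
  "finite A \<Longrightarrow> filter P (sorted_list_of_set A) = sorted_list_of_set {x\<in>A. P x}"
  by (intro sorted_distinct_set_unique) (auto intro: sorted_wrt_filter)

text \<open>Removing empty blocks is automatic in the encoding: a letter whose positions are all
  filtered out no longer occurs.\<close>

lemma restr_blocks: "restr (blocks zs) T = blocks (filter (\<lambda>z. fst z \<in> T) zs)"
proof -
  have "restr (blocks zs) T = map (\<lambda>l. {x. (x, l) \<in> set zs} \<inter> T)
      (filter (\<lambda>l. {x. (x, l) \<in> set zs} \<inter> T \<noteq> {}) (sorted_list_of_set (snd ` set zs)))"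
    by (simp add: restr_def blocks_def filter_map comp_def)
  also have "\<dots> = map (\<lambda>l. {x. (x, l) \<in> set zs} \<inter> T)
      (sorted_list_of_set (snd ` set (filter (\<lambda>z. fst z \<in> T) zs)))"
    by (subst filter_sorted_list_of_set) (simp, rule arg_cong[where f = "\<lambda>A. map _ (sorted_list_of_set A)"], force)
  finally show ?thesis by (auto simp: blocks_def intro: Collect_cong)
qed

lemma sorted_list_of_set_threshold:
  fixes A :: "nat set"
  assumes "finite A"
  shows "sorted_list_of_set A
    = sorted_list_of_set {x\<in>A. x < N} @ sorted_list_of_set {x\<in>A. \<not> x < N}"
  using assms by (intro sorted_distinct_set_unique) (auto simp: sorted_append)

text \<open>Deconcatenation becomes restriction to an initial segment of the alphabet and to its
  complement; the cut index is the number of letters below the threshold \<open>N\<close>.\<close>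

lemma take_blocks:
  "take (card {l \<in> snd ` set zs. l < N}) (blocks zs) = blocks (filter (\<lambda>z. snd z < N) zs)"
  "drop (card {l \<in> snd ` set zs. l < N}) (blocks zs) = blocks (filter (\<lambda>z. \<not> snd z < N) zs)"
proof -
  have *: "{l \<in> snd ` set zs. P l} = snd ` set (filter (\<lambda>z. P (snd z)) zs)" for P
    by auto
  have "blocks zs = map (\<lambda>l. {x. (x, l) \<in> set zs}) (sorted_list_of_set {l \<in> snd ` set zs. l < N})
    @ map (\<lambda>l. {x. (x, l) \<in> set zs}) (sorted_list_of_set {l \<in> snd ` set zs. \<not> l < N})"
    unfolding blocks_def by (subst sorted_list_of_set_threshold[of _ N]) auto
  also have "map (\<lambda>l. {x. (x, l) \<in> set zs}) (sorted_list_of_set {l \<in> snd ` set zs. l < N})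
    = blocks (filter (\<lambda>z. snd z < N) zs)"
    unfolding blocks_def *[of "\<lambda>l. l < N", symmetric] by (intro map_cong) auto
  also have "map (\<lambda>l. {x. (x, l) \<in> set zs}) (sorted_list_of_set {l \<in> snd ` set zs. \<not> l < N})
    = blocks (filter (\<lambda>z. \<not> snd z < N) zs)"
    unfolding blocks_def *[of "\<lambda>l. \<not> l < N", symmetric] by (intro map_cong) auto
  finally have **: "blocks zs = blocks (filter (\<lambda>z. snd z < N) zs) @ blocks (filter (\<lambda>z. \<not> snd z < N) zs)" .
  have "length (blocks (filter (\<lambda>z. snd z < N) zs)) = card {l \<in> snd ` set zs. l < N}"
    unfolding length_blocks * ..
  then show "take (card {l \<in> snd ` set zs. l < N}) (blocks zs) = blocks (filter (\<lambda>z. snd z < N) zs)"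
    "drop (card {l \<in> snd ` set zs. l < N}) (blocks zs) = blocks (filter (\<lambda>z. \<not> snd z < N) zs)"
    unfolding ** by simp_all
qed

text \<open>Ensures that \<open>take_blocks\<close> covers every cut index.\<close>

lemma ex_threshold:
  fixes A :: "nat set"
  assumes "finite A" "j \<le> card A"
  shows "\<exists>N. card {x\<in>A. x < N} = j"
  using assms(2)
proof (induction j)
  case 0
  show ?case by (rule exI[of _ 0]) simp
next
  case (Suc j)
  then obtain N where N: "card {x\<in>A. x < N} = j" by auto
  let ?B = "{x\<in>A. \<not> x < N}"
  have "A = {x\<in>A. x < N} \<union> ?B" by auto
  then have "card A = card ({x\<in>A. x < N} \<union> ?B)" by simp
  also have "\<dots> = j + card ?B"
    using N assms(1) by (subst card_Un_disjoint) auto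
  finally have "card A = j + card ?B" .
  then have "?B \<noteq> {}" using Suc.prems by (metis Suc_n_not_le_n add_0_right card.empty)
  \<comment> \<open>Moving the threshold just past the least element not yet counted adds exactly
    one element.\<close>
  define m where "m = Min ?B"
  have m: "m \<in> ?B" unfolding m_def using \<open>?B \<noteq> {}\<close> assms(1) by (intro Min_in) auto
  have "{x\<in>A. x < Suc m} = insert m {x\<in>A. x < N}"
  proof (intro equalityI subsetI)
    fix x assume x: "x \<in> {x\<in>A. x < Suc m}"
    show "x \<in> insert m {x\<in>A. x < N}"
    proof (cases "x < N")
      case False
      then have "m \<le> x" unfolding m_def using x assms(1) by (intro Min_le) auto
      then show ?thesis using x by auto
    qed (use x in auto)
  qed (use m in auto)
  then have "card {x\<in>A. x < Suc m} = Suc j" using m N assms(1) by auto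
  then show ?case ..
qed

lemma timed_nth_interval:
  assumes "timed zs" "fst ` set zs = {1..n}"
  shows "zs = enumerate 1 (map snd zs)" "length zs = n"
proof -
  have "map fst zs = sorted_list_of_set (set (map fst zs))"
    using assms(1) unfolding timed_def
    by (metis sorted_list_of_set.idem_if_sorted_distinct strict_sorted_iff)
  also have "set (map fst zs) = {1..n}" using assms(2) by simp
  also have "sorted_list_of_set {1..n} = [1..<Suc n]"
    by (metis atLeastLessThanSuc_atLeastAtMost sorted_list_of_set_range)
  finally have *: "map fst zs = [1..<Suc n]" .
  then show len: "length zs = n" by (metis length_map length_upt diff_Suc_1)
  have "zs = zip (map fst zs) (map snd zs)" by (simp add: zip_map_fst_snd)
  then show "zs = enumerate 1 (map snd zs)" unfolding * enumerate_eq_zip using len by simp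
qed

lemma set_composition_blocks:
  assumes "timed zs"
  shows "set_composition (fst ` set zs) (blocks zs)"
proof -
  have "sorted_wrt disjnt (blocks zs)"
    unfolding blocks_def sorted_wrt_map
  proof (rule sorted_wrt_mono_rel[OF _ strict_sorted_list_of_set])
    fix l l' :: nat assume "l < l'"
    then have "\<not> ((x, l) \<in> set zs \<and> (x, l') \<in> set zs)" for x
      using timed_unique[OF assms, of x l l'] by auto
    then show "disjnt {x. (x, l) \<in> set zs} {x. (x, l') \<in> set zs}"
      unfolding disjnt_iff mem_Collect_eq by blast
  qed
  moreover have "P \<noteq> {}" if "P \<in> set (blocks zs)" for P
    using that by (auto simp: set_blocks)
  ultimately show ?thesis
    using assms unfolding set_composition_def timed_def Union_blocks by simp
qed

text \<open>Each element is labelled by the index of its block.\<close>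

lemma set_composition_ex_blocks:
  assumes "set_composition T w"
  obtains zs where "timed zs" "blocks zs = w" "fst ` set zs = T"
proof -
  define idx where "idx x = (THE j. j < length w \<and> x \<in> w ! j)" for x
  have dis: "disjnt (w ! i) (w ! j)" if "i < j" "j < length w" for i j
    using assms that by (auto simp: set_composition_def sorted_wrt_iff_nth_less)
  have idx: "idx x = j" if "j < length w" "x \<in> w ! j" for x j
    unfolding idx_def
  proof (rule the_equality)
    fix i assume "i < length w \<and> x \<in> w ! i"
    then show "i = j" using dis[of i j] dis[of j i] that by (metis disjnt_iff linorder_neqE_nat)
  qed (use that in auto)
  have T: "finite T" "0 \<notin> T" using assms by (auto simp: set_composition_def)
  have "T = \<Union>(set w)" using assms by (simp add: set_composition_def)
  then have T3: "x \<in> T \<longleftrightarrow> (\<exists>j<length w. x \<in> w ! j)" for x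
    by (metis Union_iff in_set_conv_nth)
  define zs where "zs = map (\<lambda>x. (x, idx x)) (sorted_list_of_set T)"
  have set: "set zs = (\<lambda>x. (x, idx x)) ` T" using T by (simp add: zs_def)
  have 1: "timed zs" using T by (auto simp: timed_def zs_def comp_def)
  have 2: "fst ` set zs = T" by (auto simp: set image_iff)
  have "snd ` set zs = {..<length w}"
  proof (intro equalityI subsetI)
    fix l assume "l \<in> snd ` set zs"
    then show "l \<in> {..<length w}" using T3 idx by (auto simp: set)
  next
    fix l assume l: "l \<in> {..<length w}"
    then have "w ! l \<noteq> {}" using assms by (auto simp: set_composition_def)
    then obtain x where "x \<in> w ! l" by auto
    with l show "l \<in> snd ` set zs" using T3 idx by (force simp: set image_iff)
  qed
  then have "blocks zs = map (\<lambda>l. {x. (x, l) \<in> set zs}) [0..<length w]"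
    by (simp add: blocks_def lessThan_atLeast0)
  also have "\<dots> = w"
  proof (rule nth_equalityI)
    fix j assume "j < length (map (\<lambda>l. {x. (x, l) \<in> set zs}) [0..<length w])"
    then show "map (\<lambda>l. {x. (x, l) \<in> set zs}) [0..<length w] ! j = w ! j"
      using T3 idx by (auto simp: set)
  qed simp
  finally show ?thesis using that 1 2 by blast
qed

lemma in_set_enumerate1: "(x, l) \<in> set (enumerate 1 p) \<longleftrightarrow> (\<exists>k<length p. x = Suc k \<and> p ! k = l)"
  by (auto simp: in_set_enumerate_eq Suc_le_eq gr0_conv_Suc)

lemma fst_set_enumerate1: "fst ` set (enumerate 1 p) = {1..length p}"
  by (metis atLeastLessThanSuc_atLeastAtMost list.set_map map_fst_enumerate plus_1_eq_Suc set_upt)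

lemma snd_set_enumerate1: "snd ` set (enumerate 1 p) = set p"
  by (metis list.set_map map_snd_enumerate)

lemma timed_enumerate1: "timed (enumerate 1 p)"
  using timed_enumerate[of 0] by simp

lemma Union_word_comp: "\<Union>(set (word_comp p)) = {1..length p}"
  unfolding word_comp_def Union_blocks fst_set_enumerate1 ..

lemma size_of_word_comp: "size_of (word_comp p) = length p"
  by (simp add: size_of_def Union_word_comp)

lemma consecutive_blocks_enumerate:
  "distinct_adj p \<longleftrightarrow> (\<forall>P\<in>set (word_comp p). \<forall>i. \<not> (i \<in> P \<and> Suc i \<in> P))"
proof -
  have mem: "(Suc k, l) \<in> set (enumerate 1 p) \<longleftrightarrow> k < length p \<and> p ! k = l" for k l
    by (simp add: in_set_enumerate_eq)
  show ?thesis
  proof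
    assume d: "distinct_adj p"
    show "\<forall>P\<in>set (word_comp p). \<forall>i. \<not> (i \<in> P \<and> Suc i \<in> P)"
    proof (intro ballI allI notI)
      fix P i assume "P \<in> set (word_comp p)" "i \<in> P \<and> Suc i \<in> P"
      then obtain l where l: "(i, l) \<in> set (enumerate 1 p)" "(Suc i, l) \<in> set (enumerate 1 p)"
        by (auto simp: word_comp_def set_blocks)
      then obtain k where i: "i = Suc k" by (cases i) (auto simp: in_set_enumerate_eq)
      show False using l d distinct_adj_nth[of p k] unfolding i mem by auto
    qed
  next
    assume r: "\<forall>P\<in>set (word_comp p). \<forall>i. \<not> (i \<in> P \<and> Suc i \<in> P)"
    show "distinct_adj p"
      unfolding distinct_adj_conv_nth
    proof (intro allI impI notI)
      fix k assume k: "Suc k < length p" "p ! k = p ! Suc k"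
      have "{x. (x, p ! k) \<in> set (enumerate 1 p)} \<in> set (word_comp p)"
        unfolding word_comp_def set_blocks snd_set_enumerate1
        by (rule image_eqI[OF refl]) (rule nth_mem[OF Suc_lessD[OF k(1)]])
      then have "\<not> ((Suc k, p ! k) \<in> set (enumerate 1 p) \<and> (Suc (Suc k), p ! k) \<in> set (enumerate 1 p))"
        using bspec[OF r, of "{x. (x, p ! k) \<in> set (enumerate 1 p)}"]
        by (metis (no_types, lifting) mem_Collect_eq)
      then show False unfolding mem using k by simp
    qed
  qed
qed

lemma word_comp_M_perms_iff: "word_comp p \<in> M_perms n \<longleftrightarrow> distinct_adj p \<and> length p = n"
proof -
  have sc: "set_composition {1..length p} (word_comp p)"
    using set_composition_blocks[OF timed_enumerate1[of p]]
    unfolding word_comp_def fst_set_enumerate1 .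
  have len: "length p = n" if "set_composition {1..n} (word_comp p)"
  proof -
    have "{1..length p} = {1..n}"
      using that unfolding set_composition_def Union_word_comp by (elim conjE)
    then have "card {1..length p} = card {1..n}" by (rule arg_cong)
    then show ?thesis by simp
  qed
  have "word_comp p \<in> M_perms n \<longleftrightarrow> set_composition {1..n} (word_comp p) \<and> distinct_adj p"
    unfolding M_perms_def mem_Collect_eq consecutive_blocks_enumerate ..
  then show ?thesis using sc len by blast
qed

lemma word_comp_M_perms_all_iff [simp]: "word_comp p \<in> M_perms_all \<longleftrightarrow> distinct_adj p"
  by (auto simp: M_perms_all_def word_comp_M_perms_iff)

text \<open>Surjectivity of the encoding: coefficients of elements of MMR need only be compared at
  words without equal adjacent letters.\<close>

lemma M_perms_ex_word_comp:
  assumes "w \<in> M_perms n"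
  obtains p where "distinct_adj p" "length p = n" "w = word_comp p"
proof -
  have "set_composition {1..n} w"
    using assms unfolding M_perms_def by (elim CollectE conjE)
  then obtain zs where zs: "timed zs" "blocks zs = w" "fst ` set zs = {1..n}"
    by (rule set_composition_ex_blocks)
  then have "w = word_comp (map snd zs)"
    using timed_nth_interval[OF zs(1,3)] by (simp add: word_comp_def)
  with assms that[of "map snd zs"] show ?thesis by (simp only: word_comp_M_perms_iff)
qed

lemma M_perms_all_ex_word_comp:
  assumes "w \<in> M_perms_all"
  obtains p where "distinct_adj p" "w = word_comp p"
proof -
  from assms obtain n where "w \<in> M_perms n" by (auto simp: M_perms_all_def)
  then show ?thesis by (rule M_perms_ex_word_comp) (rule that)
qed

lemma M_perms_all_set_composition: "w \<in> M_perms_all \<Longrightarrow> \<exists>T. set_composition T w"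
  unfolding M_perms_all_def M_perms_def by blast

section \<open>Standardization\<close>

lemma remdups_adj_repeat: "remdups_adj (a @ l # l # b) = remdups_adj (a @ l # b)"
  using remdups_adj_append_remdups_adj_right[of a "l # l # b"]
    remdups_adj_append_remdups_adj_right[of a "l # b"] by simp

text \<open>R1 removes one of two neighbouring entries with equal letters, so the merged word of
  letters is an invariant. The sum of the positions is a termination measure that serves R1 and R2
  alike.\<close>

lemma blocks_R1:
  assumes zs: "timed zs" and i: "(i, l) \<in> set zs" "(Suc i, l) \<in> set zs"
  obtains zs' where "timed zs'" "map (\<lambda>Q. Q - {Suc i}) (blocks zs) = blocks zs'"
    "remdups_adj (map snd zs') = remdups_adj (map snd zs)"
    "sum_list (map fst zs') < sum_list (map fst zs)"
proof -
  define zs' where "zs' = filter (\<lambda>z. fst z \<noteq> Suc i) zs"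
  obtain z1 z2 where z: "zs = z1 @ (Suc i, l) # z2" using i(2) by (meson split_list)
  have sorted: "sorted_wrt (<) (map fst zs)" using zs by (simp add: timed_def)
  have "(i, l) \<in> set z1" using i(1) sorted by (auto simp: z sorted_wrt_append)
  then obtain u1 u2 where u: "z1 = u1 @ (i, l) # u2" by (meson split_list)
  \<comment> \<open>No position lies strictly between \<open>i\<close> and \<open>Suc i\<close>, so
    the two entries are adjacent in the list.\<close>
  have "u2 = []" using sorted unfolding z u by (cases u2) (auto simp: sorted_wrt_append)
  have "filter (\<lambda>z. fst z \<noteq> Suc i) z1 = z1" "filter (\<lambda>z. fst z \<noteq> Suc i) z2 = z2"
    using sorted unfolding z by (auto simp: sorted_wrt_append intro!: filter_True)
  then have "zs' = z1 @ z2" unfolding z zs'_def by simp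
  have 1: "timed zs'" unfolding zs'_def by (rule timed_filter[OF zs])
  have "snd ` set zs' = snd ` set zs"
    using \<open>zs' = z1 @ z2\<close> by (auto simp: z u)
  then have 2: "map (\<lambda>Q. Q - {Suc i}) (blocks zs) = blocks zs'"
    by (auto simp: blocks_def zs'_def)
  have 3: "remdups_adj (map snd zs') = remdups_adj (map snd zs)"
    using \<open>u2 = []\<close> unfolding \<open>zs' = z1 @ z2\<close> z u by (simp add: remdups_adj_repeat)
  have 4: "sum_list (map fst zs') < sum_list (map fst zs)"
    unfolding \<open>zs' = z1 @ z2\<close> z by simp
  show ?thesis using that 1 2 3 4 .
qed

lemma sum_list_strict_mono_elem:
  fixes f g :: "'a \<Rightarrow> nat"
  assumes "\<And>x. x \<in> set xs \<Longrightarrow> f x \<le> g x" "y \<in> set xs" "f y < g y"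
  shows "sum_list (map f xs) < sum_list (map g xs)"
  using assms
proof (induction xs)
  case (Cons a xs)
  have "sum_list (map f xs) \<le> sum_list (map g xs)"
    using Cons.prems by (intro sum_list_mono) auto
  then show ?case using Cons by (auto simp: add_le_less_mono add_less_le_mono)
qed simp

text \<open>Since \<open>i\<close> is absent, closing the gap is strictly increasing on positions
  and leaves the letters alone. The decrease of the measure is conditional: above all positions R2
  changes nothing.\<close>

lemma blocks_R2:
  assumes zs: "timed zs" and i: "1 \<le> i" "i \<notin> fst ` set zs"
  obtains zs' where "timed zs'"
    "map (\<lambda>Q. (\<lambda>x. if i < x then x - 1 else x) ` Q) (blocks zs) = blocks zs'"
    "map snd zs' = map snd zs"
    "x \<in> fst ` set zs \<Longrightarrow> i < x \<Longrightarrow> sum_list (map fst zs') < sum_list (map fst zs)"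
proof -
  define sh where "sh x = (if i < x then x - 1 else x)" for x
  define zs' where "zs' = map (apfst sh) zs"
  have sh: "sh x < sh y" if "x < y" "x \<noteq> i" "y \<noteq> i" for x y
    using that by (auto simp: sh_def)
  have fst': "map fst zs' = map sh (map fst zs)" by (simp add: zs'_def)
  have "sorted_wrt (<) (map fst zs)" using zs by (simp add: timed_def)
  then have "sorted_wrt (<) (map fst zs')"
    unfolding fst' sorted_wrt_map[of _ sh]
    by (rule sorted_wrt_mono_rel[rotated]) (use sh i in auto)
  moreover have "0 \<notin> fst ` set zs'"
    using zs i by (auto simp: zs'_def timed_def sh_def image_iff)
  ultimately have 1: "timed zs'" by (simp add: timed_def)
  have 2: "map snd zs' = map snd zs" by (simp add: zs'_def)
  then have "snd ` set zs' = snd ` set zs" by (metis list.set_map)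
  moreover have "sh ` {x. (x, l) \<in> set zs} = {x. (x, l) \<in> set zs'}" for l
    by (force simp: zs'_def)
  ultimately have 3: "map (\<lambda>Q. sh ` Q) (blocks zs) = blocks zs'"
    by (simp add: blocks_def)
  have 4: "sum_list (map fst zs') < sum_list (map fst zs)" if x: "x \<in> fst ` set zs" "i < x"
    unfolding fst' using x
    by (intro sum_list_strict_mono_elem[where g = "\<lambda>x. x" and y = x, simplified]) (auto simp: sh_def)
  show ?thesis using that 1 2 3 4 unfolding sh_def by blast
qed

lemma st_step_blocks:
  assumes zs: "timed zs" and step: "st_step (blocks zs) v"
  obtains zs' where "timed zs'" "v = blocks zs'"
    "remdups_adj (map snd zs') = remdups_adj (map snd zs)"
  using step
proof cases
  case (R1 P i)
  then obtain l where "(i, l) \<in> set zs" "(Suc i, l) \<in> set zs" by (auto simp: set_blocks)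
  from blocks_R1[OF zs this] obtain zs' where "timed zs'"
    "map (\<lambda>Q. Q - {Suc i}) (blocks zs) = blocks zs'"
    "remdups_adj (map snd zs') = remdups_adj (map snd zs)" .
  then show ?thesis using that[of zs'] R1(1) by simp
next
  case (R2 i)
  then have i: "i \<notin> fst ` set zs" unfolding Union_blocks by simp
  obtain zs' where zs': "timed zs'"
    "map (\<lambda>Q. (\<lambda>x. if i < x then x - 1 else x) ` Q) (blocks zs) = blocks zs'"
    "map snd zs' = map snd zs"
    by (rule blocks_R2[OF zs R2(2) i])
  then show ?thesis using that[OF zs'(1) trans[OF R2(1) zs'(2)]] by simp
qed

lemma st_steps_blocks:
  assumes "st_step\<^sup>*\<^sup>* w v" "timed zs" "w = blocks zs"
  shows "\<exists>zs'. timed zs' \<and> v = blocks zs' \<and> remdups_adj (map snd zs') = remdups_adj (map snd zs)"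
  using assms
proof (induction rule: rtranclp_induct)
  case base
  then show ?case by blast
next
  case (step y z)
  then show ?case by (metis st_step_blocks)
qed

text \<open>Existence of the normal form, by induction on the sum of the positions. R2 is applied
  only below a position that occurs, because otherwise the measure would not drop.\<close>

lemma st_steps_word_comp:
  assumes "timed zs"
  shows "st_step\<^sup>*\<^sup>* (blocks zs) (word_comp (remdups_adj (map snd zs)))"
  using assms
proof (induction "sum_list (map fst zs)" arbitrary: zs rule: less_induct)
  case less
  show ?case
  proof (cases "\<exists>i\<ge>1. i \<notin> fst ` set zs \<and> (\<exists>x\<in>fst ` set zs. i < x)")
    case True
    then obtain i x where i: "1 \<le> i" "i \<notin> fst ` set zs" "x \<in> fst ` set zs" "i < x" by blast
    obtain zs' where zs': "timed zs'"
      "map (\<lambda>Q. (\<lambda>x. if i < x then x - 1 else x) ` Q) (blocks zs) = blocks zs'"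
      "map snd zs' = map snd zs" "sum_list (map fst zs') < sum_list (map fst zs)"
      by (rule blocks_R2[OF less.prems i(1,2), of x]) (use that i in blast)
    have "st_step (blocks zs) (blocks zs')"
      using st_step.R2[of i "blocks zs"] i(1,2) unfolding Union_blocks zs'(2) by blast
    then show ?thesis
      using less.hyps[OF zs'(4,1)] zs'(3) by (metis converse_rtranclp_into_rtranclp)
  next
    case False
    \<comment> \<open>Without gaps below an occurring position, the positions are an initial
      interval; inserting 0 gives \<open>Max\<close> a value for the empty list.\<close>
    have "fst ` set zs = {1..Max (insert 0 (fst ` set zs))}"
    proof (intro equalityI subsetI)
      fix x assume "x \<in> fst ` set zs"
      then show "x \<in> {1..Max (insert 0 (fst ` set zs))}"
        using less.prems by (cases x) (auto simp: timed_def Max_ge)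
    next
      fix x assume x: "x \<in> {1..Max (insert 0 (fst ` set zs))}"
      have "Max (insert 0 (fst ` set zs)) \<in> insert 0 (fst ` set zs)" by (rule Max_in) auto
      moreover have "Max (insert 0 (fst ` set zs)) \<noteq> 0" using x by auto
      ultimately have "Max (insert 0 (fst ` set zs)) \<in> fst ` set zs" by blast
      then show "x \<in> fst ` set zs"
        using False x by (metis atLeastAtMost_iff le_neq_implies_less)
    qed
    from timed_nth_interval(1)[OF less.prems this]
    have zs: "zs = enumerate 1 (map snd zs)" .
    show ?thesis
    proof (cases "distinct_adj (map snd zs)")
      case True
      then show ?thesis using zs by (simp add: distinct_adj_altdef word_comp_def)
    next
      case False
      define p where "p = map snd zs"
      have zs: "zs = enumerate 1 p" using zs by (simp add: p_def)
      obtain k where k: "Suc k < length p" "p ! k = p ! Suc k"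
        using False by (auto simp: distinct_adj_conv_nth p_def)
      define l where "l = p ! k"
      have l: "(Suc k, l) \<in> set zs" "(Suc (Suc k), l) \<in> set zs"
        using k by (simp_all add: zs in_set_enumerate1[simplified] l_def)
      obtain zs' where zs': "timed zs'" "map (\<lambda>Q. Q - {Suc (Suc k)}) (blocks zs) = blocks zs'"
        "remdups_adj (map snd zs') = remdups_adj (map snd zs)"
        "sum_list (map fst zs') < sum_list (map fst zs)"
        using blocks_R1[OF less.prems l] by metis
      have "{x. (x, l) \<in> set zs} \<in> set (blocks zs)"
        using l by (force simp: set_blocks)
      then have "st_step (blocks zs) (blocks zs')"
        using st_step.R1[of "{x. (x, l) \<in> set zs}" "blocks zs" "Suc k"] l zs'(2) by simp
      then show ?thesis
        using less.hyps[OF zs'(4,1)] zs'(3) by (metis converse_rtranclp_into_rtranclp)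
    qed
  qed
qed

text \<open>The merged word of letters is preserved by both rules, and a standardized composition is
  determined by it; hence the normal form is unique and the definite description in
  \<open>st\<close> is meaningful.\<close>

lemma st_blocks:
  assumes "timed zs"
  shows "st (blocks zs) = word_comp (remdups_adj (map snd zs))"
  unfolding st_def
proof (rule the_equality)
  show "st_step\<^sup>*\<^sup>* (blocks zs) (word_comp (remdups_adj (map snd zs)))
    \<and> word_comp (remdups_adj (map snd zs)) \<in> M_perms_all"
    using st_steps_word_comp[OF assms] by simp
next
  fix v assume v: "st_step\<^sup>*\<^sup>* (blocks zs) v \<and> v \<in> M_perms_all"
  then obtain zs' where zs': "timed zs'" "v = blocks zs'"
    "remdups_adj (map snd zs') = remdups_adj (map snd zs)"
    using st_steps_blocks assms by blast
  obtain n where n: "v \<in> M_perms n" using v by (auto simp: M_perms_all_def)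
  then have "\<Union>(set v) = {1..n}"
    unfolding M_perms_def set_composition_def by (elim CollectE conjE)
  then have "fst ` set zs' = {1..n}" unfolding zs'(2) Union_blocks .
  from timed_nth_interval(1)[OF zs'(1) this] have "v = word_comp (map snd zs')"
    using zs'(2) by (simp add: word_comp_def)
  moreover from this n have "distinct_adj (map snd zs')" by (simp add: word_comp_M_perms_iff)
  ultimately show "v = word_comp (remdups_adj (map snd zs))"
    using zs'(3) by (simp add: distinct_adj_altdef)
qed

lemma st_word_comp: "st (word_comp p) = word_comp (remdups_adj p)"
  unfolding word_comp_def[of p] by (simp add: st_blocks timed_enumerate[of 0, simplified])

lemma take_word_comp:
  "st (take (card {l \<in> set p. l < N}) (word_comp p)) = word_comp (remdups_adj (filter (\<lambda>l. l < N) p))"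
  "st (drop (card {l \<in> set p. l < N}) (word_comp p)) = word_comp (remdups_adj (filter (\<lambda>l. \<not> l < N) p))"
proof -
  have *: "map snd (filter (\<lambda>z. P (snd z)) (enumerate 1 p)) = filter P p" for P
    using filter_map[of P snd "enumerate 1 p"] by (simp add: comp_def)
  show "st (take (card {l \<in> set p. l < N}) (word_comp p)) = word_comp (remdups_adj (filter (\<lambda>l. l < N) p))"
    "st (drop (card {l \<in> set p. l < N}) (word_comp p)) = word_comp (remdups_adj (filter (\<lambda>l. \<not> l < N) p))"
    using take_blocks[of "enumerate 1 p" N] unfolding snd_set_enumerate1 word_comp_def[of p]
    by (simp_all only: st_blocks timed_filter timed_enumerate One_nat_def
        *[of "\<lambda>l. l < N", unfolded One_nat_def] *[of "\<lambda>l. \<not> l < N", unfolded One_nat_def])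
qed

lemma length_word_comp: "length (word_comp p) = card (set p)"
  unfolding word_comp_def length_blocks snd_set_enumerate1 ..

lemma set_composition_take_drop:
  assumes "set_composition T w"
  shows "\<exists>T'. set_composition T' (take j w)" "\<exists>T'. set_composition T' (drop j w)"
proof -
  have "set_composition (\<Union>(set u)) u" if "u = take j w \<or> u = drop j w" for u
  proof -
    have "sorted_wrt disjnt (take j w @ drop j w)" using assms by (simp add: set_composition_def)
    then have "sorted_wrt disjnt u" using that unfolding sorted_wrt_append by blast
    moreover have "set u \<subseteq> set w" using that set_take_subset set_drop_subset by fast
    ultimately show ?thesis
      using assms finite_subset[of "\<Union>(set u)" T] unfolding set_composition_def by blast
  qed
  then show "\<exists>T'. set_composition T' (take j w)" "\<exists>T'. set_composition T' (drop j w)" by blast+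
qed

text \<open>Standardization merges entries but keeps the set of letters, so thresholds cut a
  composition and its standardization at the same block. Coassociativity and the antipode rest on
  this.\<close>

lemma st_take_drop:
  assumes "set_composition T w"
  shows "st w \<in> M_perms_all" "length (st w) = length w"
    "st (take j (st w)) = st (take j w)" "st (drop j (st w)) = st (drop j w)"
proof -
  from assms obtain zs where zs: "timed zs" "blocks zs = w"
    by (rule set_composition_ex_blocks)
  define p where "p = map snd zs"
  have st: "st w = word_comp (remdups_adj p)" using st_blocks zs p_def by blast
  then show "st w \<in> M_perms_all" by simp
  have sp: "snd ` set zs = set p" by (simp add: p_def)
  show len: "length (st w) = length w"
    using length_blocks[of zs] unfolding st length_word_comp zs(2) by (simp add: sp)
  have "st (take j (st w)) = st (take j w) \<and> st (drop j (st w)) = st (drop j w)"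
  proof (cases "j \<le> length w")
    case True
    then obtain N where N: "card {l \<in> set p. l < N} = j"
      using ex_threshold[of "set p" j] length_blocks[of zs] unfolding zs(2) sp by auto
    have *: "map snd (filter (\<lambda>z. P (snd z)) zs) = filter P p" for P
      using filter_map[of P snd zs] by (simp add: comp_def p_def)
    show ?thesis
      using take_word_comp[of "remdups_adj p" N] take_blocks[of zs N] zs
      unfolding sp remdups_adj_set N st by (simp add: st_blocks timed_filter *[of "\<lambda>l. l < N"] *[of "\<lambda>l. \<not> l < N"])
  next
    case False
    have "remdups_adj (remdups_adj p) = remdups_adj p"
      by (simp flip: distinct_adj_altdef)
    then show ?thesis using False len st by (simp add: st_word_comp)
  qed
  then show "st (take j (st w)) = st (take j w)" "st (drop j (st w)) = st (drop j w)" by auto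
qed

section \<open>Order isomorphism of words\<close>

lemma word_comp_alt:
  "word_comp p = map (\<lambda>l. {Suc k |k. k < length p \<and> p ! k = l}) (sorted_list_of_set (set p))"
proof -
  have "{x. (x, l) \<in> set (enumerate 1 p)} = {Suc k |k. k < length p \<and> p ! k = l}" for l
    using in_set_enumerate1[of _ l p] by blast
  then show ?thesis
    unfolding word_comp_def blocks_def snd_set_enumerate1 by simp
qed

lemma sorted_list_of_set_image_strict_mono:
  fixes f :: "nat \<Rightarrow> nat"
  assumes "finite A" "strict_mono_on A f"
  shows "sorted_list_of_set (f ` A) = map f (sorted_list_of_set A)"
proof (rule sorted_distinct_set_unique)
  have "sorted_wrt (\<lambda>x y. f x < f y) (sorted_list_of_set A)"
    by (rule sorted_wrt_mono_rel[OF _ strict_sorted_list_of_set])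
      (use assms in \<open>auto dest: strict_mono_onD\<close>)
  then have "sorted_wrt (<) (map f (sorted_list_of_set A))" by (simp add: sorted_wrt_map)
  then show "sorted (map f (sorted_list_of_set A))" "distinct (map f (sorted_list_of_set A))"
    by (simp_all add: strict_sorted_iff)
qed (use assms in auto)

lemma word_comp_map:
  assumes "strict_mono_on (set p) f"
  shows "word_comp (map f p) = word_comp p"
proof -
  have "inj_on f (set p)" using assms by (rule strict_mono_on_imp_inj_on)
  then have "{Suc k |k. k < length p \<and> f (p ! k) = f l} = {Suc k |k. k < length p \<and> p ! k = l}"
    if "l \<in> set p" for l
    using that by (auto dest: inj_onD)
  then show ?thesis
    unfolding word_comp_alt using assms
    by (simp add: sorted_list_of_set_image_strict_mono cong: conj_cong)
qed

text \<open>Expresses the order pattern of \<open>p\<close> through \<open>word_comp p\<close>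
  alone, so that equal compositions force order isomorphic words.\<close>

lemma word_comp_less_iff:
  assumes "i < length p" "j < length p"
  shows "p ! i < p ! j \<longleftrightarrow> (\<exists>a b. a < b \<and> b < length (word_comp p)
    \<and> Suc i \<in> word_comp p ! a \<and> Suc j \<in> word_comp p ! b)"
proof -
  define xs where "xs = sorted_list_of_set (set p)"
  have len: "length (word_comp p) = length xs" by (simp add: word_comp_alt xs_def)
  have nth: "Suc k \<in> word_comp p ! a \<longleftrightarrow> k < length p \<and> p ! k = xs ! a" if "a < length xs" for k a
    using that by (auto simp: word_comp_alt xs_def)
  have xs: "sorted_wrt (<) xs" "set xs = set p" by (simp_all add: xs_def)
  obtain a b where ab: "a < length xs" "p ! i = xs ! a" "b < length xs" "p ! j = xs ! b"
    using assms xs(2) by (metis in_set_conv_nth nth_mem)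
  show ?thesis
  proof
    assume "p ! i < p ! j"
    then have "\<not> b \<le> a" using ab xs(1) by (metis leD sorted_nth_mono strict_sorted_imp_sorted)
    then show "\<exists>a b. a < b \<and> b < length (word_comp p)
      \<and> Suc i \<in> word_comp p ! a \<and> Suc j \<in> word_comp p ! b"
      using ab assms nth len by (intro exI[of _ a] exI[of _ b]) simp
  next
    assume "\<exists>a b. a < b \<and> b < length (word_comp p)
      \<and> Suc i \<in> word_comp p ! a \<and> Suc j \<in> word_comp p ! b"
    then obtain a b where "a < b" "b < length xs" "p ! i = xs ! a" "p ! j = xs ! b"
      using nth len by auto
    then show "p ! i < p ! j" using xs(1) by (simp add: sorted_wrt_iff_nth_less)
  qed
qed

lemma word_comp_eq_length: "word_comp p = word_comp q \<Longrightarrow> length p = length q"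
  by (metis size_of_word_comp)

lemma word_comp_eqD:
  assumes "word_comp p = word_comp q"
  obtains f where "strict_mono_on (set p) f" "q = map f p"
proof -
  have len: "length p = length q" using assms by (rule word_comp_eq_length)
  have less: "p ! i < p ! j \<longleftrightarrow> q ! i < q ! j" if "i < length p" "j < length p" for i j
    using word_comp_less_iff[of i p j] word_comp_less_iff[of i q j] that assms len by simp
  define f where "f l = q ! (SOME i. i < length p \<and> p ! i = l)" for l
  have f: "f (p ! i) = q ! i" if "i < length p" for i
  proof -
    define k where "k = (SOME k. k < length p \<and> p ! k = p ! i)"
    have k: "k < length p \<and> p ! k = p ! i"
      unfolding k_def by (rule someI[of _ i]) (use that in simp)
    \<comment> \<open>Positions with equal letters in \<open>p\<close> compare in neither direction,
      hence also carry equal letters in \<open>q\<close>; so the chosen occurrence does not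
      matter.\<close>
    then have "q ! k = q ! i" using less[of i k] less[of k i] that by auto
    then show ?thesis by (simp add: f_def k_def)
  qed
  have "strict_mono_on (set p) f"
    by (rule strict_mono_onI) (metis f in_set_conv_nth less)
  moreover have "q = map f p" by (rule nth_equalityI) (simp_all add: len f)
  ultimately show ?thesis by (rule that)
qed

text \<open>A strictly increasing map of a finite set of numbers onto itself is the
  identity.\<close>

lemma word_comp_inject:
  assumes "word_comp p = word_comp q" "set p = set q"
  shows "p = q"
proof -
  obtain f where f: "strict_mono_on (set p) f" "q = map f p" using assms(1) by (rule word_comp_eqD)
  have "f ` set p = set p" using assms(2) unfolding f(2) by simp
  then have "map f (sorted_list_of_set (set p)) = sorted_list_of_set (set p)"
    using sorted_list_of_set_image_strict_mono[OF finite_set f(1)] by metis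
  then have "f l = l" if "l \<in> set p" for l
    using that by (metis finite_set map_eq_conv map_ident set_sorted_list_of_set)
  then show ?thesis by (simp add: f(2) map_idI)
qed

text \<open>Yields the representative over a prescribed alphabet: a letter with \<open>r\<close>
  smaller letters in \<open>p\<close> goes to the element of \<open>A\<close> with index
  \<open>r\<close>.\<close>

lemma word_comp_relabel:
  assumes "finite A" "card A = card (set p)"
  obtains q where "word_comp q = word_comp p" "set q = A"
proof -
  define xs where "xs = sorted_list_of_set A"
  define f where "f l = xs ! card {x \<in> set p. x < l}" for l
  have xs: "sorted_wrt (<) xs" "set xs = A" "length xs = card (set p)"
    using assms by (simp_all add: xs_def)
  have lt: "card {x \<in> set p. x < l} < length xs" if "l \<in> set p" for l
    unfolding xs(3) using that by (intro psubset_card_mono) auto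
  have mono: "strict_mono_on (set p) f"
  proof (rule strict_mono_onI)
    fix l l' assume l: "l \<in> set p" "l' \<in> set p" "l < l'"
    then have "card {x \<in> set p. x < l} < card {x \<in> set p. x < l'}"
      by (intro psubset_card_mono) auto
    then show "f l < f l'"
      using xs(1) lt[OF l(2)] unfolding f_def sorted_wrt_iff_nth_less by blast
  qed
  have "f l \<in> A" if "l \<in> set p" for l
    using nth_mem[OF lt[OF that]] unfolding f_def xs(2) .
  then have "f ` set p \<subseteq> A" by blast
  moreover have "card (f ` set p) = card A"
    using strict_mono_on_imp_inj_on[OF mono] by (simp add: card_image assms(2))
  ultimately have "f ` set p = A" using assms(1) by (simp add: card_subset_eq)
  then show ?thesis using that[OF word_comp_map[OF mono]] by simp
qed

lemma finite_M_perms: "finite (M_perms n)"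
proof (rule finite_subset)
  show "M_perms n \<subseteq> word_comp ` {p. set p \<subseteq> {..<n} \<and> length p = n}"
  proof
    fix w assume "w \<in> M_perms n"
    then obtain p where p: "length p = n" "w = word_comp p" by (rule M_perms_ex_word_comp)
    obtain q where q: "word_comp q = word_comp p" "set q = {..<card (set p)}"
      using word_comp_relabel[of "{..<card (set p)}" p] by auto
    have "length q = n" using word_comp_eq_length[OF q(1)] p by simp
    then show "w \<in> word_comp ` {p. set p \<subseteq> {..<n} \<and> length p = n}"
      using q p card_length[of p] by (intro image_eqI[of _ _ q]) auto
  qed
qed (simp add: finite_lists_length_eq)

section \<open>The product of \<MM>MR in terms of words\<close>

lemma restr_word_comp_take: "restr (word_comp p) {1..m} = word_comp (take m p)"
proof -
  have "enumerate 1 p = enumerate 1 (take m p @ drop m p)" by simp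
  also have "\<dots> = enumerate 1 (take m p) @ enumerate (1 + length (take m p)) (drop m p)"
    by (rule enumerate_append_eq)
  finally have "enumerate 1 p = \<dots>" .
  moreover have "filter (\<lambda>z. fst z \<in> {1..m}) (enumerate 1 (take m p)) = enumerate 1 (take m p)"
    by (rule filter_True) (auto simp: in_set_enumerate_eq)
  moreover have "filter (\<lambda>z. fst z \<in> {1..m}) (enumerate (1 + length (take m p)) (drop m p)) = []"
    by (auto simp: filter_empty_conv in_set_enumerate_eq)
  ultimately have "filter (\<lambda>z. fst z \<in> {1..m}) (enumerate 1 p) = enumerate 1 (take m p)"
    by (simp only: filter_append append_Nil2)
  then show ?thesis unfolding word_comp_def restr_blocks by simp
qed

lemma restr_word_comp_drop:
  assumes "m \<le> length p"
  shows "st (restr (word_comp p) {m+1..length p}) = word_comp (remdups_adj (drop m p))"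
proof -
  have "enumerate 1 p = enumerate 1 (take m p @ drop m p)" by simp
  also have "\<dots> = enumerate 1 (take m p) @ enumerate (1 + length (take m p)) (drop m p)"
    by (rule enumerate_append_eq)
  finally have "enumerate 1 p = \<dots>" .
  moreover have "filter (\<lambda>z. fst z \<in> {m+1..length p}) (enumerate 1 (take m p)) = []"
    by (auto simp: filter_empty_conv in_set_enumerate_eq)
  moreover have "filter (\<lambda>z. fst z \<in> {m+1..length p}) (enumerate (1 + length (take m p)) (drop m p))
    = enumerate (1 + length (take m p)) (drop m p)"
    by (rule filter_True) (use assms in \<open>auto simp: in_set_enumerate_eq\<close>)
  ultimately have "filter (\<lambda>z. fst z \<in> {m+1..length p}) (enumerate 1 p)
    = enumerate (1 + length (take m p)) (drop m p)"
    by (simp only: filter_append append_Nil)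
  then have "filter (\<lambda>z. fst z \<in> {m+1..length p}) (enumerate 1 p) = enumerate (Suc m) (drop m p)"
    using assms by simp
  then show ?thesis unfolding word_comp_def[of p] restr_blocks by (simp add: st_blocks timed_enumerate)
qed

lemma lookup_sum_frag_of:
  "finite S \<Longrightarrow> coeff (\<Sum>v\<in>S. frag_of v) v = of_bool (v \<in> S)"
  by (simp add: lookup_sum if_distrib cong: if_cong)

text \<open>The sum over \<open>M_perms (m + n)\<close> accounts for the cuts between letters, and
  the sum over \<open>M_perms (m + n - 1)\<close> for the cuts that share a letter.\<close>

lemma lookup_M_prod:
  assumes p: "distinct_adj p"
  shows "coeff (M_prod (word_comp a) (word_comp b)) (word_comp p) =
    (\<Sum>(c, d)\<in>splits p. of_bool (word_comp c = word_comp a) * of_bool (word_comp d = word_comp b))"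
proof -
  define m k n where "m = length a" and "k = length b" and "n = length p"
  have L: "coeff (M_prod (word_comp a) (word_comp b)) (word_comp p) =
    of_bool (n = m + k \<and> word_comp (take m p) = word_comp a \<and> word_comp (drop m p) = word_comp b) +
    of_bool (n + 1 = m + k \<and> 1 \<le> m \<and> word_comp (take m p) = word_comp a \<and> word_comp (drop (m - 1) p) = word_comp b)"
  proof -
    have "word_comp p \<in> {v \<in> M_perms (m + k). restr v {1..m} = word_comp a \<and> st (restr v {m+1..m+k}) = word_comp b}
      \<longleftrightarrow> n = m + k \<and> word_comp (take m p) = word_comp a \<and> word_comp (drop m p) = word_comp b"
    proof (cases "n = m + k")
      case True
      then show ?thesis
        using p restr_word_comp_drop[of m p] distinct_adj_drop[OF p, of m]
        unfolding mem_Collect_eq word_comp_M_perms_iff restr_word_comp_take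
        by (simp add: n_def distinct_adj_altdef)
    qed (simp add: word_comp_M_perms_iff n_def)
    moreover have "word_comp p \<in> {v \<in> M_perms (m + k - 1). 1 \<le> m + k \<and> restr v {1..m} = word_comp a \<and>
        st (restr v {m..m+k-1}) = word_comp b}
      \<longleftrightarrow> n + 1 = m + k \<and> 1 \<le> m \<and> word_comp (take m p) = word_comp a \<and> word_comp (drop (m - 1) p) = word_comp b"
    proof (cases "n + 1 = m + k")
      case True
      then have n: "m + k - 1 = n" "1 \<le> m + k" by auto
      show ?thesis
      proof (cases m)
        \<comment> \<open>For \<open>m = 0\<close> the interval starts at 0, which is never a
          position, so the restriction is the whole word; its length \<open>n\<close> is one less
          than \<open>k\<close>, and neither side holds.\<close>
        case 0
        have "restr (word_comp p) {0..n} = word_comp p"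
        proof -
          have "restr (word_comp p) {0..n} = blocks (filter (\<lambda>z. fst z \<in> {0..n}) (enumerate 1 p))"
            unfolding word_comp_def restr_blocks ..
          also have "filter (\<lambda>z. fst z \<in> {0..n}) (enumerate 1 p) = enumerate 1 p"
            by (auto simp: in_set_enumerate_eq n_def intro!: filter_True)
          finally show ?thesis by (simp add: word_comp_def)
        qed
        then have "st (restr (word_comp p) {m..n}) = word_comp p"
          using p 0 by (simp add: st_word_comp distinct_adj_altdef)
        moreover have "word_comp p \<noteq> word_comp b"
          using word_comp_eq_length[of p b] True 0 by (auto simp: n_def k_def)
        ultimately show ?thesis using 0 unfolding n by simp
      next
        case (Suc m')
        then have "st (restr (word_comp p) {m..n}) = word_comp (drop (m - 1) p)"
          using True restr_word_comp_drop[of m' p] distinct_adj_drop[OF p, of m']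
          by (cases k) (auto simp: n_def distinct_adj_altdef)
        then show ?thesis
          using p True Suc n unfolding n mem_Collect_eq word_comp_M_perms_iff restr_word_comp_take
          by (simp add: n_def)
      qed
    next
      case False
      then show ?thesis by (auto simp: word_comp_M_perms_iff n_def)
    qed
    ultimately show ?thesis
      unfolding M_prod_def Let_def size_of_word_comp m_def[symmetric] k_def[symmetric]
      by (simp add: lookup_add lookup_sum_frag_of finite_M_perms)
  qed
  \<comment> \<open>The length of a factor determines its cut, so each of the two sums has at most
    one nonzero term.\<close>
  have R1: "(\<Sum>i\<le>n. of_bool (word_comp (take i p) = word_comp a) * of_bool (word_comp (drop i p) = word_comp b)) =
    (of_bool (n = m + k \<and> word_comp (take m p) = word_comp a \<and> word_comp (drop m p) = word_comp b) :: int)"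
  proof -
    have "of_bool (word_comp (take i p) = word_comp a) * of_bool (word_comp (drop i p) = word_comp b) =
      (if m = i then of_bool (n = m + k \<and> word_comp (take m p) = word_comp a
        \<and> word_comp (drop m p) = word_comp b) else 0 :: int)" if "i \<le> n" for i
      using that word_comp_eq_length[of "take i p" a] word_comp_eq_length[of "drop i p" b]
      by (auto simp: m_def k_def n_def)
    then show ?thesis by auto
  qed
  have R2: "(\<Sum>i<n. of_bool (word_comp (take (Suc i) p) = word_comp a) * of_bool (word_comp (drop i p) = word_comp b)) =
    (of_bool (n + 1 = m + k \<and> 1 \<le> m \<and> word_comp (take m p) = word_comp a \<and> word_comp (drop (m - 1) p) = word_comp b) :: int)"
  proof -
    have "of_bool (word_comp (take (Suc i) p) = word_comp a) * of_bool (word_comp (drop i p) = word_comp b) =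
      (if m - 1 = i then of_bool (n + 1 = m + k \<and> 1 \<le> m \<and> word_comp (take m p) = word_comp a
        \<and> word_comp (drop (m - 1) p) = word_comp b) else 0 :: int)" if "i < n" for i
      using that word_comp_eq_length[of "take (Suc i) p" a] word_comp_eq_length[of "drop i p" b]
      by (cases m) (auto simp: m_def[symmetric] k_def[symmetric] n_def[symmetric])
    then have "(\<Sum>i<n. of_bool (word_comp (take (Suc i) p) = word_comp a) * of_bool (word_comp (drop i p) = word_comp b)) =
      (\<Sum>i<n. if m - 1 = i then of_bool (n + 1 = m + k \<and> 1 \<le> m \<and> word_comp (take m p) = word_comp a
        \<and> word_comp (drop (m - 1) p) = word_comp b) else 0 :: int)"
      by (intro sum.cong) auto
    moreover have "m - 1 < n" if "n + 1 = m + k" "1 \<le> m" "word_comp (take m p) = word_comp a"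
      using that word_comp_eq_length[of "take m p" a] by (auto simp: m_def n_def)
    ultimately show ?thesis by auto
  qed
  show ?thesis
    unfolding L sum_splits[OF p] n_def[symmetric] R1 R2 ..
qed

lemma free_on_M_prod: "M_prod w u \<in> free_on M_perms_all"
  unfolding M_prod_def Let_def
  by (intro frag.subspace_add[OF subspace_free_on] free_on_sum) (auto simp: M_perms_all_def)

lemma free_on_MMR_mult: "MMR_mult z \<in> free_on M_perms_all"
  unfolding MMR_mult_def frag_extend_def
  by (intro free_on_sum frag.subspace_scale[OF subspace_free_on])
    (auto simp: free_on_M_prod split: prod.splits)

lemma lookup_MMR_mult:
  assumes z: "z \<in> free_on (M_perms_all \<times> M_perms_all)" and p: "distinct_adj p"
  shows "coeff (MMR_mult z) (word_comp p)
    = (\<Sum>(a, b)\<in>splits p. coeff z (word_comp a, word_comp b))"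
  using z
proof (induction rule: free_on_induct)
  case (one wu)
  then obtain a b where "wu = (word_comp a, word_comp b)"
    by (metis M_perms_all_ex_word_comp mem_Sigma_iff surj_pair)
  then show ?case
    by (simp add: MMR_mult_def lookup_M_prod[OF p] of_bool_def if_distrib cong: if_cong)
      (auto intro!: sum.cong)
qed (auto simp: MMR_mult_def frag_extend_diff lookup_minus sum_subtractf case_prod_unfold)

lemma MMR_mult_simps:
  "MMR_mult (x + y) = MMR_mult x + MMR_mult y"
  "MMR_mult (x - y) = MMR_mult x - MMR_mult y"
  "MMR_mult (- x) = - MMR_mult x"
  "MMR_mult (frag_cmul c x) = frag_cmul c (MMR_mult x)"
  "MMR_mult 0 = 0"
  by (simp_all add: MMR_mult_def frag_extend_add frag_extend_diff frag_extend_cmul frag_extend_minus)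

lemma MMR_mult_sum: "MMR_mult (\<Sum>i\<in>I. f i) = (\<Sum>i\<in>I. MMR_mult (f i))"
  by (simp add: MMR_mult_def frag_extend_sum')

lemma lookup_MMR_mult_tens:
  assumes "x \<in> free_on M_perms_all" "y \<in> free_on M_perms_all" "distinct_adj p"
  shows "coeff (MMR_mult (tens x y)) (word_comp p)
    = (\<Sum>(a, b)\<in>splits p. coeff x (word_comp a) * coeff y (word_comp b))"
  using assms by (simp add: lookup_MMR_mult tens_free_on)

lemma MMR_eqI:
  assumes "x \<in> free_on M_perms_all" "y \<in> free_on M_perms_all"
    "\<And>p. distinct_adj p \<Longrightarrow> coeff x (word_comp p) = coeff y (word_comp p)"
  shows "x = y"
proof (rule poly_mapping_eqI)
  fix w
  show "coeff x w = coeff y w"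
  proof (cases "w \<in> M_perms_all")
    case True
    then show ?thesis using assms(3) by (metis M_perms_all_ex_word_comp)
  next
    case False
    then show ?thesis using assms(1,2) unfolding free_on_iff by metis
  qed
qed

lemma splits_distinct_adj:
  assumes "ab \<in> splits p"
  shows "distinct_adj (fst ab)" "distinct_adj (snd ab)"
  using assms by (auto simp: splits_def)

lemma MMR_mult_assoc:
  assumes x: "x \<in> free_on M_perms_all" and y: "y \<in> free_on M_perms_all"
    and z: "z \<in> free_on M_perms_all"
  shows "MMR_mult (tens (MMR_mult (tens x y)) z) = MMR_mult (tens x (MMR_mult (tens y z)))"
proof (rule MMR_eqI)
  fix p :: "nat list" assume p: "distinct_adj p"
  let ?X = "\<lambda>a. coeff x (word_comp a)"
  let ?Y = "\<lambda>a. coeff y (word_comp a)"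
  let ?Z = "\<lambda>a. coeff z (word_comp a)"
  have "coeff (MMR_mult (tens (MMR_mult (tens x y)) z)) (word_comp p)
    = (\<Sum>(q, c)\<in>splits p. (\<Sum>(a, b)\<in>splits q. ?X a * ?Y b) * ?Z c)"
    unfolding lookup_MMR_mult_tens[OF free_on_MMR_mult z p]
    by (intro sum.cong refl) (auto simp: splits_def lookup_MMR_mult_tens x y)
  also have "\<dots> = (\<Sum>qc\<in>splits p. \<Sum>ab\<in>splits (fst qc). ?X (fst ab) * ?Y (snd ab) * ?Z (snd qc))"
    by (simp add: case_prod_unfold sum_distrib_right)
  also have "\<dots> = (\<Sum>(qc, ab)\<in>Sigma (splits p) (\<lambda>qc. splits (fst qc)).
      ?X (fst ab) * ?Y (snd ab) * ?Z (snd qc))"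
    by (rule sum.Sigma) (auto intro!: finite_splits simp: p dest: splits_distinct_adj)
  \<comment> \<open>Both index sets describe the triples \<open>(a, b, c)\<close> with merged
    product \<open>p\<close>; the intermediate product is recomputed from the triple.\<close>
  also have "\<dots> = (\<Sum>(aq, bc)\<in>Sigma (splits p) (\<lambda>aq. splits (snd aq)).
      ?X (fst aq) * (?Y (fst bc) * ?Z (snd bc)))"
    by (rule sum.reindex_bij_witness[where
        i = "\<lambda>((a, q), (b, c)). ((remdups_adj (a @ b), c), (a, b))" and
        j = "\<lambda>((q, c), (a, b)). ((a, remdups_adj (b @ c)), (b, c))"])
      (auto simp: splits_def mult.assoc)
  also have "\<dots> = (\<Sum>aq\<in>splits p. \<Sum>bc\<in>splits (snd aq). ?X (fst aq) * (?Y (fst bc) * ?Z (snd bc)))"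
    by (rule sum.Sigma[symmetric]) (auto intro!: finite_splits simp: p dest: splits_distinct_adj)
  also have "\<dots> = (\<Sum>(a, q)\<in>splits p. ?X a * (\<Sum>(b, c)\<in>splits q. ?Y b * ?Z c))"
    by (simp add: case_prod_unfold sum_distrib_left)
  also have "\<dots> = coeff (MMR_mult (tens x (MMR_mult (tens y z)))) (word_comp p)"
    unfolding lookup_MMR_mult_tens[OF x free_on_MMR_mult p]
    by (intro sum.cong refl) (auto simp: splits_def lookup_MMR_mult_tens y z)
  finally show "coeff (MMR_mult (tens (MMR_mult (tens x y)) z)) (word_comp p)
    = coeff (MMR_mult (tens x (MMR_mult (tens y z)))) (word_comp p)" .
qed (rule free_on_MMR_mult)+

lemma word_comp_Nil [simp]: "word_comp [] = []"
  by (simp add: word_comp_alt)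

lemma word_comp_eq_Nil [simp]: "word_comp p = [] \<longleftrightarrow> p = []"
  by (metis length_0_conv size_of_word_comp word_comp_Nil)

lemma Nil_in_M_perms_all [simp]: "[] \<in> M_perms_all"
  using word_comp_M_perms_all_iff[of "[]"] by simp

lemma MMR_unit_free_on [simp]: "MMR_unit \<in> free_on M_perms_all"
  by (simp add: MMR_unit_def)

lemma MMR_mult_unit:
  assumes x: "x \<in> free_on M_perms_all"
  shows "MMR_mult (tens MMR_unit x) = x" "MMR_mult (tens x MMR_unit) = x"
proof -
  have 1: "(a, b) = ([], p)" if "(a, b) \<in> splits p" "a = []" for a b p :: "nat list"
    using that by (auto simp: splits_def distinct_adj_altdef)
  have 2: "(a, b) = (p, [])" if "(a, b) \<in> splits p" "b = []" for a b p :: "nat list"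
    using that by (auto simp: splits_def distinct_adj_altdef)
  have 3: "([], p) \<in> splits p" "(p, []) \<in> splits p" if "distinct_adj p" for p :: "nat list"
    using that by (auto simp: splits_def distinct_adj_altdef)
  show "MMR_mult (tens MMR_unit x) = x"
  proof (rule MMR_eqI[OF free_on_MMR_mult x])
    fix p :: "nat list" assume p: "distinct_adj p"
    have "coeff (MMR_mult (tens MMR_unit x)) (word_comp p) =
      (\<Sum>z\<in>splits p. if z = ([], p) then coeff x (word_comp p) else 0)"
      unfolding lookup_MMR_mult_tens[OF MMR_unit_free_on x p]
      by (intro sum.cong refl) (use 1[of _ _ p] in \<open>auto simp: MMR_unit_def split: if_splits\<close>)
    also have "\<dots> = coeff x (word_comp p)"
      using p 3 by (simp add: finite_splits)
    finally show "coeff (MMR_mult (tens MMR_unit x)) (word_comp p) =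
      coeff x (word_comp p)" .
  qed
  show "MMR_mult (tens x MMR_unit) = x"
  proof (rule MMR_eqI[OF free_on_MMR_mult x])
    fix p :: "nat list" assume p: "distinct_adj p"
    have "coeff (MMR_mult (tens x MMR_unit)) (word_comp p) =
      (\<Sum>z\<in>splits p. if z = (p, []) then coeff x (word_comp p) else 0)"
      unfolding lookup_MMR_mult_tens[OF x MMR_unit_free_on p]
      by (intro sum.cong refl) (use 2[of _ _ p] in \<open>auto simp: MMR_unit_def split: if_splits\<close>)
    also have "\<dots> = coeff x (word_comp p)"
      using p 3 by (simp add: finite_splits)
    finally show "coeff (MMR_mult (tens x MMR_unit)) (word_comp p) =
      coeff x (word_comp p)" .
  qed
qed

section \<open>The coproduct of \<MM>MR in terms of words\<close>

lemma MMR_comult_frag_of: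
  "MMR_comult (frag_of w) = (\<Sum>i\<le>length w. frag_of (st (take i w), st (drop i w)))"
proof -
  have "{(u, v). u @ v = w} = (\<lambda>i. (take i w, drop i w)) ` {..length w}"
  proof (intro equalityI subsetI)
    fix z assume "z \<in> {(u, v). u @ v = w}"
    then show "z \<in> (\<lambda>i. (take i w, drop i w)) ` {..length w}"
      by (auto intro!: image_eqI[of _ _ "length (fst z)"])
  qed auto
  moreover have "inj_on (\<lambda>i. (take i w, drop i w)) {..length w}"
    by (rule inj_onI) (metis Pair_inject atMost_iff length_take min.absorb2)
  ultimately show ?thesis
    unfolding MMR_comult_def frag_extend_of by (simp add: sum.reindex)
qed

lemma MMR_comult_simps:
  "MMR_comult (x + y) = MMR_comult x + MMR_comult y"
  "MMR_comult (x - y) = MMR_comult x - MMR_comult y"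
  "MMR_comult (- x) = - MMR_comult x"
  "MMR_comult (frag_cmul c x) = frag_cmul c (MMR_comult x)"
  "MMR_comult 0 = 0"
  by (simp_all add: MMR_comult_def frag_extend_add frag_extend_diff frag_extend_cmul frag_extend_minus)

lemma st_M_perms_all:
  assumes "w \<in> M_perms_all"
  shows "st w = w" "st (take i w) \<in> M_perms_all" "st (drop i w) \<in> M_perms_all"
    "length (st (take i w)) = length (take i w)" "length (st (drop i w)) = length (drop i w)"
proof -
  obtain p where p: "distinct_adj p" "w = word_comp p" using assms by (rule M_perms_all_ex_word_comp)
  then show "st w = w" by (simp add: st_word_comp distinct_adj_altdef)
  obtain T where T: "set_composition T w" using M_perms_all_set_composition[OF assms] by blast
  obtain T1 T2 where "set_composition T1 (take i w)" "set_composition T2 (drop i w)"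
    using set_composition_take_drop[OF T] by blast
  then show "st (take i w) \<in> M_perms_all" "st (drop i w) \<in> M_perms_all"
    "length (st (take i w)) = length (take i w)" "length (st (drop i w)) = length (drop i w)"
    using st_take_drop(1,2) by blast+
qed

lemma free_on_MMR_comult:
  assumes "x \<in> free_on M_perms_all"
  shows "MMR_comult x \<in> free_on (M_perms_all \<times> M_perms_all)"
  using assms
proof (induction rule: free_on_induct)
  case (one w)
  then show ?case
    unfolding MMR_comult_frag_of by (intro free_on_sum) (simp add: st_M_perms_all)
next
  case (diff x y)
  then show ?case
    by (simp add: MMR_comult_simps frag.subspace_diff[OF subspace_free_on])
qed (auto simp: MMR_comult_simps free_on_def)

section \<open>Coproduct coefficients as sums over words in two alphabets\<close>

definition unshuffle :: "nat \<Rightarrow> nat list \<Rightarrow> nat list \<times> nat list" where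
  "unshuffle N r = (remdups_adj (filter (\<lambda>l. l < N) r), remdups_adj (filter (\<lambda>l. \<not> l < N) r))"

lemma set_unshuffle: "unshuffle N r = (a, b) \<Longrightarrow> set r = set a \<union> set b"
  by (auto simp: unshuffle_def)

text \<open>The projection to two disjoint alphabets is a monoid homomorphism; this is the source of
  the compatibility of product and coproduct.\<close>

lemma unshuffle_append:
  "unshuffle N (remdups_adj (r @ s)) =
    (remdups_adj (fst (unshuffle N r) @ fst (unshuffle N s)),
     remdups_adj (snd (unshuffle N r) @ snd (unshuffle N s)))"
  by (simp add: unshuffle_def)

text \<open>A cut of \<open>w\<close> with parts \<open>a\<close> and \<open>b\<close> amounts to a
  representative \<open>r\<close> of \<open>w\<close> with these restrictions, and \<open>r\<close>
  is unique because its letters are those of \<open>a\<close> and \<open>b\<close>. The fibre of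
  \<open>unshuffle\<close> may be infinite, so the sum runs over a finite part \<open>U\<close> that
  contains the representatives of \<open>w\<close>; callers are free to choose one \<open>U\<close>
  for many \<open>w\<close>.\<close>

lemma lookup_MMR_comult_frag_of:
  assumes w: "w \<in> M_perms_all" and ab: "distinct_adj a" "distinct_adj b"
    and N: "\<forall>l\<in>set a. l < N" "\<forall>l\<in>set b. \<not> l < N"
    and U: "finite U" "U \<subseteq> {r. distinct_adj r \<and> unshuffle N r = (a, b)}"
      "{r. distinct_adj r \<and> unshuffle N r = (a, b) \<and> word_comp r = w} \<subseteq> U"
  shows "coeff (MMR_comult (frag_of w)) (word_comp a, word_comp b)
    = (\<Sum>r\<in>U. of_bool (word_comp r = w))"
proof -
  have L: "coeff (MMR_comult (frag_of w)) (word_comp a, word_comp b) =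
    (\<Sum>i\<le>length w. of_bool (st (take i w) = word_comp a \<and> st (drop i w) = word_comp b))"
    unfolding MMR_comult_frag_of lookup_sum by (intro sum.cong) auto
  \<comment> \<open>Standardization keeps the number of blocks, so only one cut index can
    contribute.\<close>
  have len: "i = card (set a)" if "i \<le> length w" "st (take i w) = word_comp a" for i
    using that st_M_perms_all(4)[OF w, of i] by (simp add: length_word_comp)
  have split: "st (take (card (set a)) (word_comp r)) = word_comp (fst (unshuffle N r))"
    "st (drop (card (set a)) (word_comp r)) = word_comp (snd (unshuffle N r))"
    "card (set a) \<le> length (word_comp r)"
    if "set r = set a \<union> set b" for r
  proof -
    have "{l \<in> set r. l < N} = set a" using that N by auto
    then show "st (take (card (set a)) (word_comp r)) = word_comp (fst (unshuffle N r))"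
      "st (drop (card (set a)) (word_comp r)) = word_comp (snd (unshuffle N r))"
      using take_word_comp[of r N] by (simp_all add: unshuffle_def)
    show "card (set a) \<le> length (word_comp r)"
      unfolding length_word_comp that by (intro card_mono) auto
  qed
  show ?thesis
  proof (cases "\<exists>r\<in>U. word_comp r = w")
    case True
    then obtain r where r: "r \<in> U" "word_comp r = w" by blast
    then have ur: "unshuffle N r = (a, b)" using U by blast
    note sr = set_unshuffle[OF ur]
    have uniq: "s = r" if "s \<in> U" "word_comp s = w" for s
      using that r U sr set_unshuffle[of N s a b] by (intro word_comp_inject) auto
    have "of_bool (word_comp s = w) = (if s = r then 1 else 0 :: int)" if "s \<in> U" for s
      using uniq[OF that] r(2) by (cases "s = r") auto
    then have "(\<Sum>r\<in>U. of_bool (word_comp r = w)) = (\<Sum>s\<in>U. if s = r then 1 else 0 :: int)"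
      by (rule sum.cong[OF refl])
    also have "\<dots> = 1" using U(1) r by simp
    finally have R: "(\<Sum>r\<in>U. of_bool (word_comp r = w)) = (1 :: int)" .
    have "of_bool (st (take i w) = word_comp a \<and> st (drop i w) = word_comp b) =
      (if i = card (set a) then 1 else 0 :: int)" if "i \<le> length w" for i
    proof (cases "i = card (set a)")
      case True
      then show ?thesis using split(1,2)[OF sr] unfolding r(2) ur by simp
    next
      case False
      then have "st (take i w) \<noteq> word_comp a" using len[OF that] by blast
      then show ?thesis using False by simp
    qed
    then have "(\<Sum>i\<le>length w. of_bool (st (take i w) = word_comp a \<and> st (drop i w) = word_comp b)) =
      (\<Sum>i\<le>length w. if i = card (set a) then 1 else 0 :: int)"
      by (intro sum.cong refl) simp
    also have "\<dots> = 1" using split(3)[OF sr] unfolding r(2) by simp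
    finally show ?thesis unfolding L R .
  next
    case False
    have "\<not> (st (take i w) = word_comp a \<and> st (drop i w) = word_comp b)" if i: "i \<le> length w" for i
    proof
      assume *: "st (take i w) = word_comp a \<and> st (drop i w) = word_comp b"
      have ia: "i = card (set a)" using len i * by blast
      have "length w = card (set a) + card (set b)"
        using * st_M_perms_all(5)[OF w, of i] ia i by (simp add: length_word_comp)
      also have "\<dots> = card (set a \<union> set b)" using N by (intro card_Un_disjoint[symmetric]) auto
      finally have card: "card (set a \<union> set b) = length w" by simp
      obtain p where p: "distinct_adj p" "w = word_comp p" using w by (rule M_perms_all_ex_word_comp)
      \<comment> \<open>\<open>w\<close> has as many blocks as \<open>a\<close> and \<open>b\<close>
        have letters, hence a representative over exactly these letters; its restrictions turn out
        to be \<open>a\<close> and \<open>b\<close>, which puts it into \<open>U\<close>.\<close>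
      obtain r where r: "word_comp r = w" "set r = set a \<union> set b"
        using word_comp_relabel[of "set a \<union> set b" p] card p(2) by (auto simp: length_word_comp)
      have s: "set (fst (unshuffle N r)) = set a" "set (snd (unshuffle N r)) = set b"
        using r(2) N by (auto simp: unshuffle_def)
      have "fst (unshuffle N r) = a" "snd (unshuffle N r) = b"
        using split(1,2)[OF r(2)] * s unfolding r(1) ia[symmetric] by (metis word_comp_inject)+
      moreover have "distinct_adj r" using w r(1) by (metis word_comp_M_perms_all_iff)
      ultimately have "r \<in> U" using U(3) r(1) by (auto simp: prod_eq_iff)
      then show False using False r(1) by blast
    qed
    then have "(\<Sum>i\<le>length w. of_bool (st (take i w) = word_comp a \<and> st (drop i w) = word_comp b)) = (0 :: int)"
      by (intro sum.neutral ballI) (simp only: atMost_iff of_bool_eq simp_thms)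
    moreover have "(\<Sum>r\<in>U. of_bool (word_comp r = w)) = (0 :: int)"
      using False by (intro sum.neutral ballI) auto
    ultimately show ?thesis unfolding L by simp
  qed
qed

lemma lookup_MMR_comult:
  assumes x: "x \<in> free_on M_perms_all" and ab: "distinct_adj a" "distinct_adj b"
    and N: "\<forall>l\<in>set a. l < N" "\<forall>l\<in>set b. \<not> l < N"
    and U: "finite U" "U \<subseteq> {r. distinct_adj r \<and> unshuffle N r = (a, b)}"
      "{r. distinct_adj r \<and> unshuffle N r = (a, b) \<and> coeff x (word_comp r) \<noteq> 0} \<subseteq> U"
  shows "coeff (MMR_comult x) (word_comp a, word_comp b)
    = (\<Sum>r\<in>U. coeff x (word_comp r))"
proof -
  have "coeff (MMR_comult x) (word_comp a, word_comp b) = (\<Sum>w\<in>Poly_Mapping.keys x.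
    coeff x w * coeff (MMR_comult (frag_of w)) (word_comp a, word_comp b))"
    unfolding MMR_comult_def frag_extend_of by (rule lookup_frag_extend) auto
  also have "\<dots> = (\<Sum>w\<in>Poly_Mapping.keys x.
    coeff x w * (\<Sum>r\<in>U. of_bool (word_comp r = w)))"
  proof (intro sum.cong refl arg_cong2[where f = "(*)"])
    fix w assume w: "w \<in> Poly_Mapping.keys x"
    then have "w \<in> M_perms_all" using x by (auto simp: free_on_def)
    then show "coeff (MMR_comult (frag_of w)) (word_comp a, word_comp b)
      = (\<Sum>r\<in>U. of_bool (word_comp r = w))"
      using U w by (intro lookup_MMR_comult_frag_of[OF _ ab N]) (auto simp: in_keys_iff)
  qed
  also have "\<dots> = (\<Sum>r\<in>U. \<Sum>w\<in>Poly_Mapping.keys x. coeff x w * of_bool (word_comp r = w))"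
    unfolding sum_distrib_left by (rule sum.swap)
  also have "\<dots> = (\<Sum>r\<in>U. coeff x (word_comp r))"
    by (intro sum.cong refl) (simp add: of_bool_def if_distrib in_keys_iff cong: if_cong)
  finally show ?thesis .
qed

lemma MMR_eqI2:
  assumes "x \<in> free_on (M_perms_all \<times> M_perms_all)" "y \<in> free_on (M_perms_all \<times> M_perms_all)"
    "\<And>a b. distinct_adj a \<Longrightarrow> distinct_adj b \<Longrightarrow>
      coeff x (word_comp a, word_comp b) = coeff y (word_comp a, word_comp b)"
  shows "x = y"
proof (rule pair_mapping_eqI)
  fix u v
  show "coeff x (u, v) = coeff y (u, v)"
  proof (cases "u \<in> M_perms_all \<and> v \<in> M_perms_all")
    case True
    then show ?thesis using assms(3) by (metis M_perms_all_ex_word_comp)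
  next
    case False
    then show ?thesis using assms(1,2) unfolding free_on_iff by (metis SigmaD1 SigmaD2)
  qed
qed

lemma lookup_frag_extend_bij:
  assumes "\<And>a. g (f a) = a" "\<And>b. f (g b) = b"
  shows "coeff (frag_extend (\<lambda>a. frag_of (f a)) x) b = coeff x (g b)"
proof -
  have "f a = b \<longleftrightarrow> a = g b" for a using assms by metis
  then show ?thesis
    unfolding lookup_frag_extend[OF finite_keys order_refl]
    by (simp add: eq_commute[of b] if_distrib in_keys_iff cong: if_cong)
qed

lemma lookup_swap_middle:
  "coeff (frag_extend (\<lambda>((a, b), (c, d)). frag_of ((a, c), (b, d))) x) ((a, c), (b, d))
    = coeff x ((a, b), (c, d))"
proof -
  have *: "(\<lambda>((a, b), (c, d)). frag_of ((a, c), (b, d)))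
    = (\<lambda>z. frag_of ((\<lambda>((a, b), (c, d)). ((a, c), (b, d))) z))" by auto
  show ?thesis
    unfolding * by (subst lookup_frag_extend_bij[where g = "\<lambda>((a, b), (c, d)). ((a, c), (b, d))"]) auto
qed

lemma free_on_tensor_map:
  assumes "x \<in> free_on (X \<times> Y)" "\<And>a. a \<in> X \<Longrightarrow> f (frag_of a) \<in> free_on X'"
    "\<And>b. b \<in> Y \<Longrightarrow> g (frag_of b) \<in> free_on Y'"
  shows "tensor_map f g x \<in> free_on (X' \<times> Y')"
  unfolding tensor_map_def using assms by (auto intro!: free_on_frag_extend tens_free_on)

lemma lookup_tensor_map_MMR_mult:
  assumes "Z \<in> free_on ((M_perms_all \<times> M_perms_all) \<times> (M_perms_all \<times> M_perms_all))"
    and "distinct_adj a" "distinct_adj b"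
  shows "coeff (tensor_map MMR_mult MMR_mult Z) (word_comp a, word_comp b) =
    (\<Sum>(a1, a2)\<in>splits a. \<Sum>(b1, b2)\<in>splits b.
      coeff Z ((word_comp a1, word_comp a2), (word_comp b1, word_comp b2)))"
  using assms(1)
proof (induction rule: free_on_induct)
  case (one wu)
  then obtain w u where wu: "wu = (w, u)" "w \<in> M_perms_all \<times> M_perms_all" "u \<in> M_perms_all \<times> M_perms_all"
    by (cases wu) auto
  show ?case
    unfolding wu(1) tensor_map_frag_of lookup_tens
    using assms(2,3) wu(2,3)
    by (simp add: lookup_MMR_mult sum_product case_prod_unfold)
      (auto intro!: sum.cong simp: prod_eq_iff)
qed (auto simp: tensor_map_simps lookup_minus sum_subtractf case_prod_unfold)

text \<open>Both sides sum over pairs \<open>(r, s)\<close> of words whose merged product restricts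
  to \<open>(a, b)\<close>. Grouping by that product gives the coproduct of the product; grouping by
  the four restrictions of \<open>r\<close> and \<open>s\<close> gives the product of the
  coproducts.\<close>

lemma MMR_comult_mult:
  assumes x: "x \<in> free_on M_perms_all" and y: "y \<in> free_on M_perms_all"
  shows "MMR_comult (MMR_mult (tens x y)) = tensor_map MMR_mult MMR_mult
    (frag_extend (\<lambda>((a, b), (c, d)). frag_of ((a, c), (b, d))) (tens (MMR_comult x) (MMR_comult y)))"
proof (rule MMR_eqI2)
  show "MMR_comult (MMR_mult (tens x y)) \<in> free_on (M_perms_all \<times> M_perms_all)"
    by (rule free_on_MMR_comult[OF free_on_MMR_mult])
  define Z where "Z = frag_extend (\<lambda>((a, b), (c, d)). frag_of ((a, c), (b, d)))
    (tens (MMR_comult x) (MMR_comult y))"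
  have Z: "Z \<in> free_on ((M_perms_all \<times> M_perms_all) \<times> (M_perms_all \<times> M_perms_all))"
    unfolding Z_def
    by (rule free_on_frag_extend[OF tens_free_on[OF free_on_MMR_comult[OF x] free_on_MMR_comult[OF y]]])
      auto
  then show "tensor_map MMR_mult MMR_mult Z \<in> free_on (M_perms_all \<times> M_perms_all)"
    by (rule free_on_tensor_map) (rule free_on_MMR_mult)+
  fix a b0 :: "nat list" assume ab0: "distinct_adj a" "distinct_adj b0"
  \<comment> \<open>Shifting \<open>b0\<close> past all letters of \<open>a\<close> keeps its
    composition and separates the two alphabets; inserting 0 covers the case of empty
    \<open>a\<close>.\<close>
  define N where "N = Suc (Max (insert 0 (set a)))"
  define b where "b = map (\<lambda>l. l + N) b0"
  have b0: "word_comp b = word_comp b0"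
    unfolding b_def by (rule word_comp_map) (auto simp: strict_mono_on_def)
  have ab: "distinct_adj a" "distinct_adj b"
    using ab0 unfolding b_def by (auto intro: distinct_adj_mapI)
  have N: "\<forall>l\<in>set a. l < N" "\<forall>l\<in>set b. \<not> l < N"
    by (auto simp: N_def b_def less_Suc_eq_le)
  define F where "F a b = {r. distinct_adj r \<and> unshuffle N r = (a, b)}" for a b
  \<comment> \<open>\<open>K\<close> bounds the lengths of all words at which \<open>x\<close> or
    \<open>y\<close> is nonzero. With letters from \<open>a\<close> and \<open>b\<close> only, this
    makes every index set finite; a product of two such words has length at most
    \<open>2 * K\<close>.\<close>
  define K where "K = Max (insert 0 (size_of ` (Poly_Mapping.keys x \<union> Poly_Mapping.keys y)))"
  define X Y where "X r = coeff x (word_comp r)"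
    and "Y r = coeff y (word_comp r)" for r
  have K: "length r \<le> K" if "X r \<noteq> 0 \<or> Y r \<noteq> 0" for r
  proof -
    have "word_comp r \<in> Poly_Mapping.keys x \<union> Poly_Mapping.keys y"
      using that by (auto simp: X_def Y_def in_keys_iff)
    then have "size_of (word_comp r) \<le> K" unfolding K_def by (intro Max_ge) auto
    then show ?thesis by (simp add: size_of_word_comp)
  qed
  define U where "U k = {r. distinct_adj r \<and> set r \<subseteq> set a \<union> set b \<and> length r \<le> k}" for k
  have finU: "finite (U k)" for k
    by (rule finite_subset[OF _ finite_lists_length_le[of "set a \<union> set b" k]]) (auto simp: U_def)
  define W where "W = {(r, s). r \<in> U K \<and> s \<in> U K \<and> unshuffle N (remdups_adj (r @ s)) = (a, b)}"
  have finW: "finite W"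
    by (rule finite_subset[OF _ finite_cartesian_product[OF finU[of K] finU[of K]]]) (auto simp: W_def)
  have "coeff (MMR_comult (MMR_mult (tens x y))) (word_comp a, word_comp b)
    = (\<Sum>r\<in>U (2 * K) \<inter> F a b. coeff (MMR_mult (tens x y)) (word_comp r))"
  proof (rule lookup_MMR_comult[OF free_on_MMR_mult ab N])
    show "{r. distinct_adj r \<and> unshuffle N r = (a, b) \<and>
      coeff (MMR_mult (tens x y)) (word_comp r) \<noteq> 0} \<subseteq> U (2 * K) \<inter> F a b"
    proof
      fix r assume "r \<in> {r. distinct_adj r \<and> unshuffle N r = (a, b) \<and>
        coeff (MMR_mult (tens x y)) (word_comp r) \<noteq> 0}"
      then have r: "distinct_adj r" "unshuffle N r = (a, b)"
        "coeff (MMR_mult (tens x y)) (word_comp r) \<noteq> 0" by auto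
      then have "(\<Sum>(c, d)\<in>splits r. X c * Y d) \<noteq> 0"
        using lookup_MMR_mult_tens[OF x y r(1)] by (simp add: X_def Y_def)
      then obtain z where "z \<in> splits r" "(case z of (c, d) \<Rightarrow> X c * Y d) \<noteq> 0"
        by (rule sum.not_neutral_contains_not_neutral)
      then obtain c d where cd: "(c, d) \<in> splits r" "X c * Y d \<noteq> 0"
        by (cases z) auto
      then have "length c \<le> K" "length d \<le> K" using K by auto
      moreover have "length r \<le> length c + length d"
        using cd(1) remdups_adj_length[of "c @ d"] by (auto simp: splits_def)
      ultimately show "r \<in> U (2 * K) \<inter> F a b"
        using r set_unshuffle[OF r(2)] by (auto simp: U_def F_def)
    qed
  qed (auto simp: finU F_def)
  \<comment> \<open>Factorizations outside \<open>W\<close> have a factor longer than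
    \<open>K\<close> and contribute 0.\<close>
  also have "\<dots> = (\<Sum>r\<in>U (2 * K) \<inter> F a b. \<Sum>z\<in>{z\<in>W. remdups_adj (fst z @ snd z) = r}. X (fst z) * Y (snd z))"
  proof (intro sum.cong refl)
    fix r assume "r \<in> U (2 * K) \<inter> F a b"
    then have r: "distinct_adj r" "unshuffle N r = (a, b)" by (auto simp: U_def F_def)
    have "coeff (MMR_mult (tens x y)) (word_comp r) = (\<Sum>z\<in>splits r. X (fst z) * Y (snd z))"
      unfolding lookup_MMR_mult_tens[OF x y r(1)] by (simp add: X_def Y_def case_prod_unfold)
    also have "\<dots> = (\<Sum>z\<in>{z\<in>W. remdups_adj (fst z @ snd z) = r}. X (fst z) * Y (snd z))"
    proof (rule sum.mono_neutral_right[OF finite_splits[OF r(1)]])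
      show "{z \<in> W. remdups_adj (fst z @ snd z) = r} \<subseteq> splits r"
        by (auto simp: W_def splits_def U_def)
      show "\<forall>z\<in>splits r - {z \<in> W. remdups_adj (fst z @ snd z) = r}. X (fst z) * Y (snd z) = 0"
      proof
        fix z assume z: "z \<in> splits r - {z \<in> W. remdups_adj (fst z @ snd z) = r}"
        obtain c d where cd: "z = (c, d)" by fastforce
        have s: "distinct_adj c" "distinct_adj d" "remdups_adj (c @ d) = r"
          using z by (auto simp: cd splits_def)
        have "set c \<union> set d = set r" using s(3) by auto
        then have "\<not> (length c \<le> K \<and> length d \<le> K)"
          using z s r(2) set_unshuffle[OF r(2)] by (auto simp: cd W_def U_def)
        then show "X (fst z) * Y (snd z) = 0" using K by (auto simp: cd)
      qed
    qed
    finally show "coeff (MMR_mult (tens x y)) (word_comp r) =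
      (\<Sum>z\<in>{z\<in>W. remdups_adj (fst z @ snd z) = r}. X (fst z) * Y (snd z))" .
  qed
  also have "\<dots> = (\<Sum>z\<in>W. X (fst z) * Y (snd z))"
  proof (rule sum.group[OF finW])
    show "(\<lambda>z. remdups_adj (fst z @ snd z)) ` W \<subseteq> U (2 * K) \<inter> F a b"
    proof (rule image_subsetI)
      fix z assume z: "z \<in> W"
      have "length (remdups_adj (fst z @ snd z)) \<le> length (fst z @ snd z)" by (rule remdups_adj_length)
      with z show "remdups_adj (fst z @ snd z) \<in> U (2 * K) \<inter> F a b"
        by (auto simp: W_def U_def F_def)
    qed
  qed (simp add: finU)
  \<comment> \<open>The same pairs, now grouped by their restrictions to the two alphabets; by
    \<open>unshuffle_append\<close> these form factorizations of \<open>a\<close> and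
    \<open>b\<close>.\<close>
  also have "\<dots> = (\<Sum>c\<in>splits a \<times> splits b. \<Sum>z\<in>{z\<in>W.
      ((fst (unshuffle N (fst z)), fst (unshuffle N (snd z))),
       (snd (unshuffle N (fst z)), snd (unshuffle N (snd z)))) = c}. X (fst z) * Y (snd z))"
  proof (rule sum.group[symmetric, OF finW])
    show "finite (splits a \<times> splits b)" using ab by (simp add: finite_splits)
    show "(\<lambda>z. ((fst (unshuffle N (fst z)), fst (unshuffle N (snd z))),
       (snd (unshuffle N (fst z)), snd (unshuffle N (snd z))))) ` W \<subseteq> splits a \<times> splits b"
      by (auto simp: W_def splits_def unshuffle_append) (auto simp: unshuffle_def)
  qed
  also have "\<dots> = (\<Sum>c\<in>splits a \<times> splits b. (\<Sum>r\<in>U K \<inter> F (fst (fst c)) (fst (snd c)). X r) *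
      (\<Sum>r\<in>U K \<inter> F (snd (fst c)) (snd (snd c)). Y r))"
  proof (rule sum.cong[OF refl])
    fix c assume c: "c \<in> splits a \<times> splits b"
    obtain a1 a2 b1 b2 where c4: "c = ((a1, a2), (b1, b2))" by (metis surj_pair)
    have "{z\<in>W. ((fst (unshuffle N (fst z)), fst (unshuffle N (snd z))),
       (snd (unshuffle N (fst z)), snd (unshuffle N (snd z)))) = c} = (U K \<inter> F a1 b1) \<times> (U K \<inter> F a2 b2)"
    proof -
      have s: "remdups_adj (a1 @ a2) = a" "remdups_adj (b1 @ b2) = b"
        using c by (simp_all add: c4 splits_def)
      have d: "distinct_adj r" if "r \<in> U K" for r using that by (simp add: U_def)
      have "((r1, r2) \<in> W \<and> ((fst (unshuffle N r1), fst (unshuffle N r2)),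
          (snd (unshuffle N r1), snd (unshuffle N r2))) = c) \<longleftrightarrow>
        r1 \<in> U K \<inter> F a1 b1 \<and> r2 \<in> U K \<inter> F a2 b2" for r1 r2
      proof -
        obtain x1 y1 x2 y2 where z: "unshuffle N r1 = (x1, y1)" "unshuffle N r2 = (x2, y2)"
          by (metis surj_pair)
        show ?thesis
          unfolding W_def F_def c4
          using d[of r1] d[of r2] s by (auto simp: z unshuffle_append)
      qed
      then show ?thesis by (intro set_eqI) (simp only: split_paired_all mem_Collect_eq mem_Times_iff fst_conv snd_conv)
    qed
    then show "(\<Sum>z\<in>{z\<in>W. ((fst (unshuffle N (fst z)), fst (unshuffle N (snd z))),
       (snd (unshuffle N (fst z)), snd (unshuffle N (snd z)))) = c}. X (fst z) * Y (snd z)) =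
      (\<Sum>r\<in>U K \<inter> F (fst (fst c)) (fst (snd c)). X r) *
      (\<Sum>r\<in>U K \<inter> F (snd (fst c)) (snd (snd c)). Y r)"
      by (simp add: c4 sum_product sum.cartesian_product case_prod_unfold)
  qed
  also have "\<dots> = (\<Sum>c\<in>splits a \<times> splits b.
    coeff (MMR_comult x) (word_comp (fst (fst c)), word_comp (fst (snd c))) *
    coeff (MMR_comult y) (word_comp (snd (fst c)), word_comp (snd (snd c))))"
  proof (intro sum.cong refl)
    fix c assume c: "c \<in> splits a \<times> splits b"
    obtain a1 a2 b1 b2 where c4: "c = ((a1, a2), (b1, b2))" by (metis surj_pair)
    have s: "distinct_adj a1" "distinct_adj a2" "distinct_adj b1" "distinct_adj b2"
      "remdups_adj (a1 @ a2) = a" "remdups_adj (b1 @ b2) = b"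
      using c by (auto simp: c4 splits_def)
    have sets: "set a1 \<union> set a2 = set a" "set b1 \<union> set b2 = set b"
      using s(5,6) by auto
    have 1: "coeff (MMR_comult x) (word_comp a1, word_comp b1) = (\<Sum>r\<in>U K \<inter> F a1 b1. X r)"
      unfolding X_def
    proof (rule lookup_MMR_comult[OF x s(1,3)])
      show "{r. distinct_adj r \<and> unshuffle N r = (a1, b1) \<and> coeff x (word_comp r) \<noteq> 0}
        \<subseteq> U K \<inter> F a1 b1"
        using K sets set_unshuffle[of N _ a1 b1] by (fastforce simp: U_def F_def X_def)
    qed (use N sets in \<open>auto simp: finU F_def\<close>)
    have 2: "coeff (MMR_comult y) (word_comp a2, word_comp b2) = (\<Sum>r\<in>U K \<inter> F a2 b2. Y r)"
      unfolding Y_def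
    proof (rule lookup_MMR_comult[OF y s(2,4)])
      show "{r. distinct_adj r \<and> unshuffle N r = (a2, b2) \<and> coeff y (word_comp r) \<noteq> 0}
        \<subseteq> U K \<inter> F a2 b2"
        using K sets set_unshuffle[of N _ a2 b2] by (fastforce simp: U_def F_def Y_def)
    qed (use N sets in \<open>auto simp: finU F_def\<close>)
    show "(\<Sum>r\<in>U K \<inter> F (fst (fst c)) (fst (snd c)). X r) *
      (\<Sum>r\<in>U K \<inter> F (snd (fst c)) (snd (snd c)). Y r) =
      coeff (MMR_comult x) (word_comp (fst (fst c)), word_comp (fst (snd c))) *
    coeff (MMR_comult y) (word_comp (snd (fst c)), word_comp (snd (snd c)))"
      by (simp add: c4 1 2)
  qed
  also have "\<dots> = coeff (tensor_map MMR_mult MMR_mult Z) (word_comp a, word_comp b)"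
  proof -
    have "coeff Z ((u1, u2), (v1, v2)) =
      coeff (MMR_comult x) (u1, v1) * coeff (MMR_comult y) (u2, v2)"
      for u1 u2 v1 v2
      unfolding Z_def lookup_swap_middle by simp
    then show ?thesis
      unfolding lookup_tensor_map_MMR_mult[OF Z ab]
      by (simp add: sum.cartesian_product case_prod_unfold)
  qed
  finally show "coeff (MMR_comult (MMR_mult (tens x y))) (word_comp a, word_comp b0)
    = coeff (tensor_map MMR_mult MMR_mult Z) (word_comp a, word_comp b0)"
    unfolding b0 .
qed

section \<open>\<MM>MR is a Hopf algebra\<close>

text \<open>Two successive cuts of a list, at \<open>j\<close> and at \<open>i = j + k\<close>,
  enumerated from either end; used for coassociativity and for the associativity of
  convolution.\<close>

lemma sum_triangle_reindex:
  fixes f :: "nat \<Rightarrow> nat \<Rightarrow> 'a::comm_monoid_add"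
  shows "(\<Sum>i\<le>n. \<Sum>j\<le>i. f i j) = (\<Sum>j\<le>n. \<Sum>k\<le>n - j. f (j + k) j)"
  unfolding sum.Sigma[OF finite_atMost ballI[OF finite_atMost]]
  by (rule sum.reindex_bij_witness[where i = "\<lambda>(j, k). (j + k, j)" and j = "\<lambda>(i, j). (j, i - j)"]) auto

lemma MMR_comult_coassoc:
  assumes "x \<in> free_on M_perms_all"
  shows "frag_extend (\<lambda>((a, b), c). frag_of (a, (b, c))) (tensor_map MMR_comult id (MMR_comult x))
    = tensor_map id MMR_comult (MMR_comult x)"
  using assms
proof (induction rule: free_on_induct)
  case (one w)
  note w = st_M_perms_all[OF one]
  obtain T where T: "set_composition T w" using M_perms_all_set_composition[OF one] by blast
  have 1: "length (st (take i w)) = i" "length (st (drop i w)) = length w - i" if "i \<le> length w" for i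
    using w(4,5)[of i] that by simp_all
  \<comment> \<open>Standardizing before the second cut does not affect the standardized
    parts.\<close>
  have 2: "st (take j (st (take i w))) = st (take j (take i w))"
    "st (drop j (st (take i w))) = st (drop j (take i w))"
    "st (take j (st (drop i w))) = st (take j (drop i w))"
    "st (drop j (st (drop i w))) = st (drop j (drop i w))" for i j
    using set_composition_take_drop[OF T] st_take_drop(3,4) by metis+
  have "frag_extend (\<lambda>((a, b), c). frag_of (a, (b, c))) (tensor_map MMR_comult id (MMR_comult (frag_of w)))
    = (\<Sum>i\<le>length w. \<Sum>j\<le>i. frag_of (st (take j (take i w)), (st (drop j (take i w)), st (drop i w))))"
    by (simp add: MMR_comult_frag_of tensor_map_sum frag_extend_sum' tens_sum_left 1 2 del: take_take)
  also have "\<dots> = (\<Sum>j\<le>length w. \<Sum>k\<le>length w - j.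
      frag_of (st (take j (take (j + k) w)), (st (drop j (take (j + k) w)), st (drop (j + k) w))))"
    by (rule sum_triangle_reindex)
  also have "\<dots> = tensor_map id MMR_comult (MMR_comult (frag_of w))"
    by (simp add: MMR_comult_frag_of tensor_map_sum tens_sum_right 1 2 min_def drop_take add.commute)
  finally show ?case .
qed (auto simp: MMR_comult_simps tensor_map_simps frag_extend_diff)

lemma MMR_counit_simps [simp]:
  "MMR_counit (x + y) = MMR_counit x + MMR_counit y"
  "MMR_counit (x - y) = MMR_counit x - MMR_counit y"
  "MMR_counit 0 = 0"
  "MMR_counit (frag_of w) = of_bool (w = [])"
  by (simp_all add: MMR_counit_def lookup_add lookup_minus)

text \<open>Standardization keeps the number of blocks, so a part has nonzero counit only at the
  trivial cut on its side.\<close>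

lemma MMR_counit_comult:
  assumes "x \<in> free_on M_perms_all"
  shows "frag_extend (\<lambda>(a, b). frag_cmul (MMR_counit (frag_of a)) (frag_of b)) (MMR_comult x) = x"
    "frag_extend (\<lambda>(a, b). frag_cmul (MMR_counit (frag_of b)) (frag_of a)) (MMR_comult x) = x"
proof -
  have "frag_extend (\<lambda>(a, b). frag_cmul (MMR_counit (frag_of a)) (frag_of b)) (MMR_comult x) = x
    \<and> frag_extend (\<lambda>(a, b). frag_cmul (MMR_counit (frag_of b)) (frag_of a)) (MMR_comult x) = x"
    using assms
  proof (induction rule: free_on_induct)
    case (one w)
    note w = st_M_perms_all[OF one]
    have "st (take i w) = [] \<longleftrightarrow> i = 0" "st (drop i w) = [] \<longleftrightarrow> i = length w" if "i \<le> length w" for i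
      using w(4,5)[of i] that by (metis length_0_conv length_take min.absorb2, metis diff_is_0_eq length_0_conv length_drop le_antisym order_refl)
    then have "(\<Sum>i\<le>length w. frag_cmul (of_bool (st (take i w) = [])) (frag_of (st (drop i w))))
        = (\<Sum>i\<le>length w. if i = 0 then frag_of w else 0)"
      "(\<Sum>i\<le>length w. frag_cmul (of_bool (st (drop i w) = [])) (frag_of (st (take i w))))
        = (\<Sum>i\<le>length w. if i = length w then frag_of w else 0)"
      using w(1) by (intro sum.cong refl; simp)+
    then show ?case
      by (simp add: MMR_comult_frag_of frag_extend_sum')
  qed (auto simp: MMR_comult_simps frag_extend_diff)
  then show "frag_extend (\<lambda>(a, b). frag_cmul (MMR_counit (frag_of a)) (frag_of b)) (MMR_comult x) = x"
    "frag_extend (\<lambda>(a, b). frag_cmul (MMR_counit (frag_of b)) (frag_of a)) (MMR_comult x) = x" by auto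
qed

lemma splits_Nil [simp]: "splits [] = {([], [])}"
  by (auto simp: splits_def)

lemma MMR_counit_mult:
  assumes "x \<in> free_on M_perms_all" "y \<in> free_on M_perms_all"
  shows "MMR_counit (MMR_mult (tens x y)) = MMR_counit x * MMR_counit y"
  using lookup_MMR_mult_tens[OF assms, of "[]"] by (simp add: MMR_counit_def)

lemma st_Nil [simp]: "st [] = []"
  using st_M_perms_all(1)[of "[]"] by simp

lemma MMR_comult_unit: "MMR_comult MMR_unit = tens MMR_unit MMR_unit"
  by (simp add: MMR_unit_def MMR_comult_frag_of)

section \<open>The antipode as a convolution inverse\<close>

text \<open>
  Outside set compositions \<open>st\<close> is an unspecified \<open>THE\<close>; the value \<open>0\<close> there keeps all
  convolution factors inside the algebra.
\<close>

definition st_frag :: "nat set list \<Rightarrow> nat set list \<Rightarrow>\<^sub>0 int" where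
  "st_frag w = (if \<exists>T. set_composition T w then frag_of (st w) else 0)"

lemma free_on_st_frag: "st_frag w \<in> free_on M_perms_all"
  using st_take_drop(1) by (auto simp: st_frag_def free_on_iff)

text \<open>Convolution on raw lists of blocks. Parts of an M-permutation are in general not
  standardized; deferring \<open>st\<close> to the factors lets the recursion run over sublists and
  makes associativity a matter of cutting twice.\<close>

definition conv :: "(nat set list \<Rightarrow> nat set list \<Rightarrow>\<^sub>0 int) \<Rightarrow> (nat set list \<Rightarrow> nat set list \<Rightarrow>\<^sub>0 int)
    \<Rightarrow> nat set list \<Rightarrow> nat set list \<Rightarrow>\<^sub>0 int" where
  "conv f g w = (\<Sum>i\<le>length w. MMR_mult (tens (f (take i w)) (g (drop i w))))"

definition conv_unit :: "nat set list \<Rightarrow> nat set list \<Rightarrow>\<^sub>0 int" where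
  "conv_unit w = (if w = [] then MMR_unit else 0)"

lemma conv_assoc:
  assumes "\<And>w. f w \<in> free_on M_perms_all" "\<And>w. g w \<in> free_on M_perms_all" "\<And>w. h w \<in> free_on M_perms_all"
  shows "conv (conv f g) h w = conv f (conv g h) w"
proof -
  have "conv (conv f g) h w = (\<Sum>i\<le>length w. \<Sum>j\<le>i.
      MMR_mult (tens (MMR_mult (tens (f (take j (take i w))) (g (drop j (take i w))))) (h (drop i w))))"
    by (simp add: conv_def tens_sum_left MMR_mult_sum del: take_take)
  also have "\<dots> = (\<Sum>j\<le>length w. \<Sum>k\<le>length w - j. MMR_mult (tens
      (MMR_mult (tens (f (take j (take (j + k) w))) (g (drop j (take (j + k) w))))) (h (drop (j + k) w))))"
    by (rule sum_triangle_reindex)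
  also have "\<dots> = conv f (conv g h) w"
    by (simp add: conv_def tens_sum_right MMR_mult_sum MMR_mult_assoc assms min_def drop_take add.commute)
  finally show ?thesis .
qed

lemma conv_unit:
  assumes "\<And>w. f w \<in> free_on M_perms_all"
  shows "conv conv_unit f w = f w" "conv f conv_unit w = f w"
proof -
  have "MMR_mult (tens (conv_unit (take i w)) (f (drop i w))) = (if i = 0 then f w else 0)"
    if "i \<le> length w" for i
    using that MMR_mult_unit[OF assms[of w]]
    by (cases "i = 0") (auto simp: conv_unit_def tens_simps MMR_mult_simps)
  then show "conv conv_unit f w = f w" by (simp add: conv_def)
  have "MMR_mult (tens (f (take i w)) (conv_unit (drop i w))) = (if i = length w then f w else 0)"
    if "i \<le> length w" for i
    using that MMR_mult_unit[OF assms[of w]]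
    by (cases "i = length w") (auto simp: conv_unit_def tens_simps MMR_mult_simps)
  then show "conv f conv_unit w = f w" by (simp add: conv_def)
qed

text \<open>The congruence rule restricts the recursive calls to indices in the range of the sum,
  where the list is shorter.\<close>

context
  notes sum.cong [fundef_cong]
begin

text \<open>Solves \<open>conv anti_left st_frag = conv_unit\<close> for the term at
  \<open>i = length w\<close>, whose other factor is the unit.\<close>

function anti_left :: "nat set list \<Rightarrow> nat set list \<Rightarrow>\<^sub>0 int" where
  "anti_left w = (if w = [] then MMR_unit
    else - (\<Sum>i<length w. MMR_mult (tens (anti_left (take i w)) (st_frag (drop i w)))))"
  by auto
termination by (relation "measure length") auto

function anti_right :: "nat set list \<Rightarrow> nat set list \<Rightarrow>\<^sub>0 int" where
  "anti_right w = (if w = [] then MMR_unit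
    else - (\<Sum>i\<in>{1..length w}. MMR_mult (tens (st_frag (take i w)) (anti_right (drop i w)))))"
  by auto
termination by (relation "measure length") auto

end

declare anti_left.simps [simp del] anti_right.simps [simp del]

lemma free_on_anti: "anti_left w \<in> free_on M_perms_all" "anti_right w \<in> free_on M_perms_all"
  by (subst anti_left.simps anti_right.simps;
    auto intro!: frag.subspace_neg[OF subspace_free_on] free_on_sum free_on_MMR_mult)+

lemma st_frag_Nil [simp]: "st_frag [] = MMR_unit"
proof -
  have "set_composition {} []" by (simp add: set_composition_def)
  then have "\<exists>T. set_composition T []" by blast
  then show ?thesis by (simp add: st_frag_def MMR_unit_def)
qed

lemma conv_anti_left: "conv anti_left st_frag w = conv_unit w"
proof (cases "w = []")
  case True
  then show ?thesis
    by (simp add: conv_def conv_unit_def anti_left.simps[of "[]"] MMR_mult_unit)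
next
  case False
  have "conv anti_left st_frag w = (\<Sum>i<length w. MMR_mult (tens (anti_left (take i w)) (st_frag (drop i w))))
      + MMR_mult (tens (anti_left w) MMR_unit)"
    unfolding conv_def lessThan_Suc_atMost[symmetric] sum.lessThan_Suc by simp
  also have "\<dots> = 0"
    using False by (simp add: MMR_mult_unit free_on_anti) (simp add: anti_left.simps[of w])
  finally show ?thesis using False by (simp add: conv_unit_def)
qed

lemma conv_anti_right: "conv st_frag anti_right w = conv_unit w"
proof (cases "w = []")
  case True
  then show ?thesis
    by (simp add: conv_def conv_unit_def anti_right.simps[of "[]"] MMR_mult_unit)
next
  case False
  have "{..length w} = insert 0 {1..length w}" by auto
  then have "conv st_frag anti_right w = MMR_mult (tens MMR_unit (anti_right w))
    + (\<Sum>i\<in>{1..length w}. MMR_mult (tens (st_frag (take i w)) (anti_right (drop i w))))"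
    unfolding conv_def by simp
  also have "\<dots> = 0"
    using False by (simp add: MMR_mult_unit free_on_anti) (simp add: anti_right.simps[of w])
  finally show ?thesis using False by (simp add: conv_unit_def)
qed

text \<open>A left inverse and a right inverse of the same element agree, by associativity of
  convolution.\<close>

lemma anti_left_eq_right: "anti_left w = anti_right w"
proof -
  have e: "conv st_frag anti_right = conv_unit" "conv anti_left st_frag = conv_unit"
    by (intro ext conv_anti_left conv_anti_right)+
  have "anti_left w = conv anti_left (conv st_frag anti_right) w"
    unfolding e by (simp add: conv_unit free_on_anti)
  also have "\<dots> = conv (conv anti_left st_frag) anti_right w"
    by (simp add: conv_assoc free_on_anti free_on_st_frag)
  also have "\<dots> = anti_right w"
    unfolding e by (simp add: conv_unit free_on_anti)
  finally show ?thesis .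
qed

text \<open>Lets the recursion on raw lists descend to M-permutations. Parts of \<open>w\<close> and
  of \<open>st w\<close> have the same standardization, and by induction \<open>anti_left\<close>
  does not distinguish a shorter part from its standardization.\<close>

lemma anti_left_st:
  assumes "set_composition T w"
  shows "anti_left (st w) = anti_left w"
  using assms
proof (induction "length w" arbitrary: T w rule: less_induct)
  case less
  note st = st_take_drop[OF less.prems]
  obtain T' where T': "set_composition T' (st w)" using M_perms_all_set_composition[OF st(1)] by blast
  have "MMR_mult (tens (anti_left (take i (st w))) (st_frag (drop i (st w)))) =
    MMR_mult (tens (anti_left (take i w)) (st_frag (drop i w)))" if i: "i < length w" for i
  proof -
    obtain T1 where T1: "set_composition T1 (take i w)" using set_composition_take_drop(1)[OF less.prems] by blast
    obtain T2 where T2: "set_composition T2 (take i (st w))" using set_composition_take_drop(1)[OF T'] by blast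
    have "anti_left (take i (st w)) = anti_left (take i w)"
      using less.hyps[OF _ T1] less.hyps[OF _ T2] i st(2) st(3)[of i] by simp
    moreover have "st_frag (drop i (st w)) = st_frag (drop i w)"
      using set_composition_take_drop(2)[OF T', of i] set_composition_take_drop(2)[OF less.prems, of i]
        st(4)[of i] by (simp add: st_frag_def)
    ultimately show ?thesis by simp
  qed
  then have "(\<Sum>i<length w. MMR_mult (tens (anti_left (take i (st w))) (st_frag (drop i (st w))))) =
    (\<Sum>i<length w. MMR_mult (tens (anti_left (take i w)) (st_frag (drop i w))))"
    by (intro sum.cong refl) simp
  moreover have "st w = [] \<longleftrightarrow> w = []" using st(2) by (metis length_0_conv)
  ultimately show ?case
    using st(2) by (simp add: anti_left.simps[of "st w"] anti_left.simps[of w])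
qed

definition MMR_antipode :: "(nat set list \<Rightarrow>\<^sub>0 int) \<Rightarrow> (nat set list \<Rightarrow>\<^sub>0 int)" where
  "MMR_antipode = frag_extend anti_left"

lemma MMR_antipode_simps:
  "MMR_antipode (x + y) = MMR_antipode x + MMR_antipode y"
  "MMR_antipode (x - y) = MMR_antipode x - MMR_antipode y"
  "MMR_antipode (- x) = - MMR_antipode x"
  "MMR_antipode (frag_cmul c x) = frag_cmul c (MMR_antipode x)"
  "MMR_antipode 0 = 0"
  "MMR_antipode (frag_of w) = anti_left w"
  by (simp_all add: MMR_antipode_def frag_extend_add frag_extend_diff frag_extend_cmul frag_extend_minus)

lemma MMR_antipode:
  assumes "x \<in> free_on M_perms_all"
  shows "MMR_mult (tensor_map MMR_antipode id (MMR_comult x)) = frag_cmul (MMR_counit x) MMR_unit"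
    "MMR_mult (tensor_map id MMR_antipode (MMR_comult x)) = frag_cmul (MMR_counit x) MMR_unit"
proof -
  have "MMR_mult (tensor_map MMR_antipode id (MMR_comult x)) = frag_cmul (MMR_counit x) MMR_unit \<and>
    MMR_mult (tensor_map id MMR_antipode (MMR_comult x)) = frag_cmul (MMR_counit x) MMR_unit"
    using assms
  proof (induction rule: free_on_induct)
    case (one w)
    obtain T where T: "set_composition T w" using M_perms_all_set_composition[OF one] by blast
    have sub: "anti_left (st (take i w)) = anti_left (take i w)" "frag_of (st (drop i w)) = st_frag (drop i w)"
      "anti_left (st (drop i w)) = anti_left (drop i w)" "frag_of (st (take i w)) = st_frag (take i w)" for i
      using set_composition_take_drop[OF T, of i] anti_left_st by (auto simp: st_frag_def)
    have sub': "MMR_antipode (st_frag (take i w)) = anti_left (take i w)"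
      "MMR_antipode (st_frag (drop i w)) = anti_left (drop i w)" for i
      unfolding sub(2,4)[symmetric] MMR_antipode_simps(6) sub(1,3) by (rule refl)+
    have "MMR_mult (tensor_map MMR_antipode id (MMR_comult (frag_of w))) = conv anti_left st_frag w"
      by (simp add: MMR_comult_frag_of tensor_map_sum MMR_mult_sum conv_def sub(2,4) sub')
    moreover have "MMR_mult (tensor_map id MMR_antipode (MMR_comult (frag_of w))) = conv st_frag anti_right w"
      by (simp add: MMR_comult_frag_of tensor_map_sum MMR_mult_sum conv_def sub(2,4) sub'
          flip: anti_left_eq_right)
    ultimately show ?case
      by (cases "w = []") (simp_all only: conv_anti_left conv_anti_right conv_unit_def
        MMR_counit_simps of_bool_eq if_True if_False simp_thms frag_cmul_one frag_cmul_zero)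
  qed (auto simp: MMR_comult_simps tensor_map_simps MMR_mult_simps frag_cmul_diff_distrib)
  then show "MMR_mult (tensor_map MMR_antipode id (MMR_comult x)) = frag_cmul (MMR_counit x) MMR_unit"
    "MMR_mult (tensor_map id MMR_antipode (MMR_comult x)) = frag_cmul (MMR_counit x) MMR_unit" by auto
qed

theorem hopf_algebra_MMR:
  "hopf_algebra M_perms_all MMR_mult MMR_unit MMR_comult MMR_counit MMR_antipode"
  unfolding hopf_algebra_def
  by (intro conjI ballI MMR_mult_assoc MMR_mult_unit MMR_comult_coassoc MMR_counit_comult
      MMR_comult_mult MMR_comult_unit MMR_counit_mult MMR_antipode MMR_unit_free_on)
    (auto simp: additive_map_def free_on_MMR_mult free_on_MMR_comult MMR_mult_simps MMR_comult_simps
      MMR_antipode_def frag_extend_add MMR_unit_def intro: free_on_anti free_on_frag_extend)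

section \<open>Compositions and descent sets\<close>

lemma D_Nil [simp]: "D [] = {}"
  by (auto simp: D_def)

lemma D_Cons: "D (a # \<alpha>) = (if \<alpha> = [] then {} else insert a ((+) a ` D \<alpha>))"
proof (intro set_eqI iffI)
  fix x assume "x \<in> D (a # \<alpha>)"
  then obtain j where j: "x = sum_list (take j (a # \<alpha>))" "1 \<le> j" "j < Suc (length \<alpha>)"
    by (auto simp: D_def)
  obtain i where i: "j = Suc i" using j(2) by (cases j) auto
  show "x \<in> (if \<alpha> = [] then {} else insert a ((+) a ` D \<alpha>))"
  proof (cases i)
    case 0
    then show ?thesis using j i by auto
  next
    case (Suc k)
    then have "sum_list (take i \<alpha>) \<in> D \<alpha>" using j i by (auto simp: D_def)
    then show ?thesis using j i Suc by auto
  qed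
next
  fix x assume x: "x \<in> (if \<alpha> = [] then {} else insert a ((+) a ` D \<alpha>))"
  then have ne: "\<alpha> \<noteq> []" by (auto split: if_splits)
  with x consider "x = a" | j where "x = a + sum_list (take j \<alpha>)" "1 \<le> j" "j < length \<alpha>"
    by (auto simp: D_def)
  then show "x \<in> D (a # \<alpha>)"
  proof cases
    case 1
    then have "x = sum_list (take 1 (a # \<alpha>))" by simp
    then show ?thesis using ne unfolding D_def by (intro CollectI exI[of _ 1]) auto
  next
    case (2 j)
    then have "x = sum_list (take (Suc j) (a # \<alpha>))" by simp
    then show ?thesis using 2 unfolding D_def by (intro CollectI exI[of _ "Suc j"]) auto
  qed
qed

lemma compositions_Nil [simp]: "[] \<in> compositions"
  and compositions_Cons [simp]: "a # \<alpha> \<in> compositions \<longleftrightarrow> 0 < a \<and> \<alpha> \<in> compositions"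
  by (auto simp: compositions_def)

lemma compositions_sum_pos: "\<alpha> \<in> compositions \<Longrightarrow> \<alpha> \<noteq> [] \<Longrightarrow> 0 < sum_list \<alpha>"
  by (cases \<alpha>) auto

lemma D_subset: "\<alpha> \<in> compositions \<Longrightarrow> D \<alpha> \<subseteq> {1..<sum_list \<alpha>}"
proof (induction \<alpha>)
  case (Cons a \<alpha>)
  then show ?case using compositions_sum_pos[of \<alpha>] by (auto simp: D_Cons)
qed simp

lemma finite_D: "\<alpha> \<in> compositions \<Longrightarrow> finite (D \<alpha>)"
  using D_subset finite_subset by blast

lemma D_Cons_shift:
  assumes "a # \<alpha> \<in> compositions"
  shows "D \<alpha> = {j. 1 \<le> j \<and> a + j \<in> D (a # \<alpha>)}"
  using assms D_subset[of \<alpha>] by (auto simp: D_Cons)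

text \<open>The first part of a composition is the least element of \<open>D\<close>, or the whole
  sum if \<open>D\<close> is empty.\<close>

lemma D_inject:
  assumes "\<alpha> \<in> compositions" "\<beta> \<in> compositions" "sum_list \<alpha> = sum_list \<beta>" "D \<alpha> = D \<beta>"
  shows "\<alpha> = \<beta>"
  using assms
proof (induction \<alpha> arbitrary: \<beta>)
  case Nil
  then show ?case using compositions_sum_pos[of \<beta>] by (metis sum_list.Nil less_irrefl)
next
  case (Cons a \<alpha>)
  obtain b \<beta>' where \<beta>: "\<beta> = b # \<beta>'" using Cons.prems by (cases \<beta>) auto
  have empty: "\<alpha> = [] \<longleftrightarrow> \<beta>' = []"
    using Cons.prems(4) unfolding \<beta> by (auto simp: D_Cons split: if_splits)
  have a: "a = b"
  proof (cases "\<alpha> = []")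
    case True
    then show ?thesis using Cons.prems(3) empty by (simp add: \<beta>)
  next
    case False
    have "b \<in> D (a # \<alpha>)" "a \<in> D (b # \<beta>')"
      using Cons.prems(4) False empty unfolding \<beta> by (auto simp: D_Cons)
    then have "a \<le> b" "b \<le> a" using False empty by (auto simp: D_Cons)
    then show ?thesis by simp
  qed
  have "D \<alpha> = D \<beta>'"
    using Cons.prems D_Cons_shift[of a \<alpha>] D_Cons_shift[of b \<beta>'] unfolding \<beta> a by simp
  then show ?case using Cons.IH[of \<beta>'] Cons.prems a unfolding \<beta> by simp
qed

lemma D_surj:
  assumes "E \<subseteq> {1..<n}"
  obtains \<alpha> where "\<alpha> \<in> compositions" "sum_list \<alpha> = n" "D \<alpha> = E"
proof -
  have "\<exists>\<alpha>\<in>compositions. sum_list \<alpha> = n \<and> D \<alpha> = E"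
    using assms
  proof (induction n arbitrary: E rule: less_induct)
    case (less n)
    consider "n = 0" | "n > 0" "E = {}" | "E \<noteq> {}" by auto
    then show ?case
    proof cases
      case 1
      then show ?thesis using less.prems by (intro bexI[of _ "[]"]) auto
    next
      case 2
      then show ?thesis by (intro bexI[of _ "[n]"]) (auto simp: D_Cons)
    next
      case 3
      \<comment> \<open>The least element of \<open>E\<close> becomes the first part; the elements
        beyond it, shifted down by \<open>m\<close>, describe the remaining parts.\<close>
      define m where "m = Min E"
      have fin: "finite E" using less.prems finite_subset by blast
      have m: "m \<in> E" "\<And>x. x \<in> E \<Longrightarrow> m \<le> x" using fin 3 by (auto simp: m_def)
      have mn: "1 \<le> m" "m < n" using m(1) less.prems by auto
      define E' where "E' = {j. 1 \<le> j \<and> m + j \<in> E}"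
      have "E' \<subseteq> {1..<n - m}" using less.prems by (auto simp: E'_def)
      then obtain \<alpha> where \<alpha>: "\<alpha> \<in> compositions" "sum_list \<alpha> = n - m" "D \<alpha> = E'"
        using less.IH[of "n - m" E'] mn by auto
      have "\<alpha> \<noteq> []" using \<alpha>(2) mn by auto
      moreover have "insert m ((+) m ` E') = E"
      proof (intro set_eqI iffI)
        fix x assume "x \<in> E"
        then show "x \<in> insert m ((+) m ` E')"
          using m(2)[of x] by (cases "x = m") (auto simp: E'_def intro!: image_eqI[of _ _ "x - m"])
      qed (use m in \<open>auto simp: E'_def\<close>)
      ultimately show ?thesis
        using \<alpha> mn by (intro bexI[of _ "m # \<alpha>"]) (auto simp: D_Cons)
    qed
  qed
  then show ?thesis using that by blast
qed

section \<open>Descent sets of words\<close>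

lemma descents_subset: "descents p \<subseteq> {1..<length p}"
  by (auto simp: descents_def)

lemma descents_take: "descents (take i p) = {j \<in> descents p. j < i}"
  by (auto simp: descents_def)

lemma descents_drop: "descents (drop i p) = {j. 1 \<le> j \<and> i + j \<in> descents p}"
proof (cases "i \<le> length p")
  case True
  then show ?thesis by (auto simp: descents_def Suc_le_eq gr0_conv_Suc)
qed (auto simp: descents_def)

lemma descents_snoc:
  "descents (p @ [x]) = descents p \<union> (if p \<noteq> [] \<and> x < last p then {length p} else {})"
proof (intro set_eqI)
  fix i
  have "(p @ [x]) ! (i - 1) > (p @ [x]) ! i \<longleftrightarrow> p ! (i - 1) > p ! i" if "1 \<le> i" "i < length p"
    using that by (auto simp: nth_append)
  moreover have "(p @ [x]) ! (i - 1) > (p @ [x]) ! i \<longleftrightarrow> x < last p" if "1 \<le> i" "i = length p"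
    using that by (cases p rule: rev_cases) (auto simp: nth_append)
  ultimately show "i \<in> descents (p @ [x]) \<longleftrightarrow>
    i \<in> descents p \<union> (if p \<noteq> [] \<and> x < last p then {length p} else {})"
    by (cases "i = length p") (auto simp: descents_def Suc_le_eq)
qed

lemma descents_map_Suc: "descents (map Suc p) = descents p"
  by (auto simp: descents_def)

lemma descents_empty_iff:
  assumes "distinct_adj p"
  shows "descents p = {} \<longleftrightarrow> sorted_wrt (<) p"
proof -
  have "descents p = {} \<longleftrightarrow> (\<forall>i. Suc i < length p \<longrightarrow> \<not> p ! i > p ! Suc i)"
    by (auto simp: descents_def) (metis One_nat_def Suc_le_D Suc_le_mono diff_Suc_1)
  also have "\<dots> \<longleftrightarrow> (\<forall>i. Suc i < length p \<longrightarrow> p ! i < p ! Suc i)"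
    using assms unfolding distinct_adj_conv_nth by (metis linorder_neqE_nat less_asym)
  finally show ?thesis by (simp add: sorted_wrt_iff_nth_Suc_transp)
qed

text \<open>Extending a permutation of \<open>[n]\<close> by one letter decides position
  \<open>n\<close> freely: a new maximum at the end gives an ascent, while raising all letters and
  appending 1 gives a descent.\<close>

lemma ex_permutation_descents:
  assumes "E \<subseteq> {1..<n}"
  shows "\<exists>p. p \<in> permutations_of_set {1..n} \<and> descents p = E"
  using assms
proof (induction n arbitrary: E)
  case 0
  then show ?case by (auto simp: descents_def)
next
  case (Suc n)
  have "E - {n} \<subseteq> {1..<n}" using Suc.prems by auto
  then obtain p where p: "p \<in> permutations_of_set {1..n}" "descents p = E - {n}"
    using Suc.IH by blast
  have p': "set p = {1..n}" "distinct p" "length p = n"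
    using p(1) by (auto simp: permutations_of_set_def dest: distinct_card)
  show ?case
  proof (cases "n \<in> E")
    case True
    then have "p \<noteq> []" using Suc.prems p'(3) by auto
    then have "last p \<in> {1..n}" using p'(1) last_in_set by metis
    then have "descents (map Suc p @ [1]) = E"
      using True p(2) p'(3) \<open>p \<noteq> []\<close> unfolding descents_snoc descents_map_Suc by (auto simp: last_map)
    moreover have "map Suc p @ [1] \<in> permutations_of_set {1..Suc n}"
    proof -
      have "insert 1 (Suc ` {1..n}) = {1..Suc n}"
        by (auto simp: image_Suc_atLeastAtMost)
      then show ?thesis using p' by (auto simp: permutations_of_set_def distinct_map)
    qed
    ultimately show ?thesis by blast
  next
    case False
    have "\<not> Suc n < last p" if "p \<noteq> []"
      using last_in_set[OF that] p'(1) by auto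
    then have "descents (p @ [Suc n]) = E"
      using False p(2) unfolding descents_snoc by auto
    moreover have "p @ [Suc n] \<in> permutations_of_set {1..Suc n}"
      using p' by (auto simp: permutations_of_set_def)
    ultimately show ?thesis by blast
  qed
qed

text \<open>The permutation chosen in the definition of \<open>Ltilde\<close>.\<close>

definition rep_word :: "nat list \<Rightarrow> nat list" where
  "rep_word \<alpha> = (SOME p. p \<in> permutations_of_set {1..sum_list \<alpha>} \<and> descents p = D \<alpha>)"

lemma rep_word:
  assumes "\<alpha> \<in> compositions"
  shows "distinct_adj (rep_word \<alpha>)" "length (rep_word \<alpha>) = sum_list \<alpha>" "descents (rep_word \<alpha>) = D \<alpha>"
proof -
  have "rep_word \<alpha> \<in> permutations_of_set {1..sum_list \<alpha>} \<and> descents (rep_word \<alpha>) = D \<alpha>"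
    unfolding rep_word_def by (rule someI_ex[OF ex_permutation_descents[OF D_subset[OF assms]]])
  then show "distinct_adj (rep_word \<alpha>)" "length (rep_word \<alpha>) = sum_list \<alpha>" "descents (rep_word \<alpha>) = D \<alpha>"
    by (auto simp: permutations_of_set_def distinct_adj_altdef remdups_adj_distinct dest: distinct_card)
qed

lemma word_comp_ex1:
  assumes "i < length p"
  shows "\<exists>!a. a < length (word_comp p) \<and> Suc i \<in> word_comp p ! a"
proof -
  define xs where "xs = sorted_list_of_set (set p)"
  have len: "length (word_comp p) = length xs" by (simp add: word_comp_alt xs_def)
  have nth: "Suc i \<in> word_comp p ! a \<longleftrightarrow> p ! i = xs ! a" if "a < length xs" for a
    using that assms by (auto simp: word_comp_alt xs_def)
  have xs: "distinct xs" "set xs = set p" by (simp_all add: xs_def)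
  have "\<exists>!a. a < length xs \<and> xs ! a = p ! i"
    using xs assms by (intro distinct_Ex1) auto
  then show ?thesis unfolding len using nth by metis
qed

text \<open>\<open>inv_word\<close> replaces each letter by the number of its block and so returns a
  word order isomorphic to \<open>p\<close>.\<close>

lemma descents_inv_word: "descents (inv_word (word_comp p)) = descents p"
proof -
  define w where "w = word_comp p"
  have len: "length (inv_word w) = length p"
    unfolding inv_word_def w_def size_of_word_comp by (simp del: upt_Suc)
  have nth: "\<exists>a. inv_word w ! i = Suc a \<and> a < length w \<and> Suc i \<in> w ! a
      \<and> (\<forall>b. b < length w \<and> Suc i \<in> w ! b \<longrightarrow> b = a)" if i: "i < length p" for i
  proof -
    obtain a where a: "a < length w" "Suc i \<in> w ! a" "\<And>b. b < length w \<and> Suc i \<in> w ! b \<Longrightarrow> b = a"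
      using word_comp_ex1[OF i] unfolding w_def by blast
    have "inv_word w ! i = (THE j. j \<in> {1..length w} \<and> Suc i \<in> w ! (j - 1))"
      using i unfolding inv_word_def w_def size_of_word_comp by (simp del: upt_Suc)
    also have "\<dots> = Suc a"
    proof (rule the_equality)
      fix j assume j: "j \<in> {1..length w} \<and> Suc i \<in> w ! (j - 1)"
      then have "j - 1 = a" by (intro a(3)) auto
      then show "j = Suc a" using j by auto
    qed (use a(1,2) in auto)
    finally show ?thesis using a by blast
  qed
  have less: "inv_word w ! i < inv_word w ! j \<longleftrightarrow> p ! i < p ! j" if ij: "i < length p" "j < length p" for i j
  proof -
    obtain a where a: "inv_word w ! i = Suc a" "a < length w" "Suc i \<in> w ! a"
      "\<And>b. b < length w \<and> Suc i \<in> w ! b \<Longrightarrow> b = a" using nth[OF ij(1)] by blast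
    obtain b where b: "inv_word w ! j = Suc b" "b < length w" "Suc j \<in> w ! b"
      "\<And>c. c < length w \<and> Suc j \<in> w ! c \<Longrightarrow> c = b" using nth[OF ij(2)] by blast
    show ?thesis
      unfolding word_comp_less_iff[OF ij] w_def[symmetric] a(1) b(1)
      using a b by (metis Suc_less_eq order.strict_trans)
  qed
  then show ?thesis
    unfolding descents_def w_def[symmetric] len
    by (intro Collect_cong conj_cong refl) (simp add: less)
qed

section \<open>The subgroup \<MM>NSym\<close>

text \<open>A test word of type \<alpha>: the coefficient of an element of MNSym at
  \<open>rep \<alpha>\<close> is its coordinate along \<open>Rtilde \<alpha>\<close>.\<close>

definition rep :: "nat list \<Rightarrow> nat set list" where
  "rep \<alpha> = word_comp (rep_word \<alpha>)"

lemma lookup_Rtilde: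
  assumes "distinct_adj p"
  shows "coeff (Rtilde \<alpha>) (word_comp p) = of_bool (length p = sum_list \<alpha> \<and> descents p = D \<alpha>)"
  using assms unfolding Rtilde_def
  by (subst lookup_sum_frag_of) (auto simp: finite_M_perms word_comp_M_perms_iff descents_inv_word)

lemma lookup_Rtilde_rep:
  assumes "\<alpha> \<in> compositions" "\<beta> \<in> compositions"
  shows "coeff (Rtilde \<alpha>) (rep \<beta>) = (if \<alpha> = \<beta> then 1 else 0)"
  using assms D_inject[OF assms] by (auto simp: rep_def lookup_Rtilde rep_word)

lemma free_on_Rtilde: "Rtilde \<alpha> \<in> free_on M_perms_all"
  unfolding Rtilde_def by (intro free_on_sum) (auto simp: M_perms_all_def)

definition type_invariant :: "(nat set list \<Rightarrow>\<^sub>0 int) \<Rightarrow> bool" where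
  "type_invariant x \<longleftrightarrow> (\<forall>p q. distinct_adj p \<longrightarrow> distinct_adj q \<longrightarrow> length p = length q \<longrightarrow>
    descents p = descents q \<longrightarrow> coeff x (word_comp p) = coeff x (word_comp q))"

lemma subspace_type_invariant: "frag.subspace {x \<in> free_on M_perms_all. type_invariant x}"
proof (rule frag.subspaceI)
  fix x y assume xy: "x \<in> {x \<in> free_on M_perms_all. type_invariant x}" "y \<in> {x \<in> free_on M_perms_all. type_invariant x}"
  then have "x + y \<in> free_on M_perms_all" using frag.subspace_add[OF subspace_free_on] by blast
  moreover have "type_invariant (x + y)"
    using xy unfolding type_invariant_def mem_Collect_eq lookup_add by metis
  ultimately show "x + y \<in> {x \<in> free_on M_perms_all. type_invariant x}" by simp
next
  fix c x assume x: "x \<in> {x \<in> free_on M_perms_all. type_invariant x}"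
  then have "frag_cmul c x \<in> free_on M_perms_all" using frag.subspace_scale[OF subspace_free_on] by blast
  moreover have "type_invariant (frag_cmul c x)"
    using x unfolding type_invariant_def mem_Collect_eq lookup_frag_cmul by metis
  ultimately show "frag_cmul c x \<in> {x \<in> free_on M_perms_all. type_invariant x}" by simp
qed (simp add: type_invariant_def free_on_def)

lemma inj_on_rep: "inj_on rep compositions"
  using lookup_Rtilde_rep by (intro inj_onI) (metis zero_neq_one)

text \<open>Every word has exactly one type, so invariant coefficients are read off at the test
  words; only finitely many are nonzero because \<open>rep\<close> is injective into the finite
  support of \<open>x\<close>.\<close>

lemma type_invariant_expansion:
  assumes x: "x \<in> free_on M_perms_all" "type_invariant x"
  shows "finite {\<alpha> \<in> compositions. coeff x (rep \<alpha>) \<noteq> 0}"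
    "x = (\<Sum>\<alpha>\<in>{\<alpha> \<in> compositions. coeff x (rep \<alpha>) \<noteq> 0}.
      frag_cmul (coeff x (rep \<alpha>)) (Rtilde \<alpha>))"
proof -
  let ?S = "{\<alpha> \<in> compositions. coeff x (rep \<alpha>) \<noteq> 0}"
  have "rep ` ?S \<subseteq> Poly_Mapping.keys x" by (auto simp: in_keys_iff)
  then have "finite (rep ` ?S)" by (rule finite_subset) simp
  moreover have "inj_on rep ?S" using inj_on_rep by (rule inj_on_subset) auto
  ultimately show fin: "finite ?S" by (rule finite_imageD)
  show "x = (\<Sum>\<alpha>\<in>?S. frag_cmul (coeff x (rep \<alpha>)) (Rtilde \<alpha>))"
  proof (rule MMR_eqI[OF x(1)])
    show "(\<Sum>\<alpha>\<in>?S. frag_cmul (coeff x (rep \<alpha>)) (Rtilde \<alpha>)) \<in> free_on M_perms_all"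
      by (intro free_on_sum frag.subspace_scale[OF subspace_free_on] free_on_Rtilde)
    fix p :: "nat list" assume p: "distinct_adj p"
    obtain \<beta> where \<beta>: "\<beta> \<in> compositions" "sum_list \<beta> = length p" "D \<beta> = descents p"
      by (rule D_surj[OF descents_subset])
    have eq: "coeff x (word_comp p) = coeff x (rep \<beta>)"
      unfolding rep_def using \<beta>(2,3)
      by (intro x(2)[unfolded type_invariant_def, rule_format]) (simp_all add: p rep_word[OF \<beta>(1)])
    have "coeff (Rtilde \<alpha>) (word_comp p) = of_bool (\<alpha> = \<beta>)" if "\<alpha> \<in> ?S" for \<alpha>
    proof -
      have "length p = sum_list \<alpha> \<and> descents p = D \<alpha> \<longleftrightarrow> \<alpha> = \<beta>"
      proof
        assume "length p = sum_list \<alpha> \<and> descents p = D \<alpha>"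
        then show "\<alpha> = \<beta>" using that \<beta> by (intro D_inject) auto
      qed (simp add: \<beta>)
      then show ?thesis by (simp add: lookup_Rtilde[OF p])
    qed
    then have "coeff (\<Sum>\<alpha>\<in>?S. frag_cmul (coeff x (rep \<alpha>)) (Rtilde \<alpha>)) (word_comp p)
      = (\<Sum>\<alpha>\<in>?S. if \<alpha> = \<beta> then coeff x (rep \<beta>) else 0)"
      unfolding lookup_sum lookup_frag_cmul by (intro sum.cong refl) auto
    also have "\<dots> = coeff x (rep \<beta>)" using fin \<beta>(1) by auto
    finally show "coeff x (word_comp p) =
      coeff (\<Sum>\<alpha>\<in>?S. frag_cmul (coeff x (rep \<alpha>)) (Rtilde \<alpha>)) (word_comp p)"
      unfolding eq by simp
  qed
qed

text \<open>Turns membership in a span into a condition on coefficients, which products visibly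
  preserve.\<close>

lemma MNSym_eq: "MNSym = {x \<in> free_on M_perms_all. type_invariant x}"
proof (intro equalityI subsetI)
  fix x assume x: "x \<in> {x \<in> free_on M_perms_all. type_invariant x}"
  then have "x = (\<Sum>\<alpha>\<in>{\<alpha> \<in> compositions. coeff x (rep \<alpha>) \<noteq> 0}.
      frag_cmul (coeff x (rep \<alpha>)) (Rtilde \<alpha>))" using type_invariant_expansion(2) by blast
  also have "\<dots> \<in> MNSym"
    unfolding MNSym_def by (intro frag.span_sum frag.span_scale frag.span_base) auto
  finally show "x \<in> MNSym" .
next
  fix x assume "x \<in> MNSym"
  moreover have "Rtilde ` compositions \<subseteq> {x \<in> free_on M_perms_all. type_invariant x}"
    by (auto simp: free_on_Rtilde type_invariant_def lookup_Rtilde)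
  ultimately show "x \<in> {x \<in> free_on M_perms_all. type_invariant x}"
    unfolding MNSym_def using frag.span_minimal[OF _ subspace_type_invariant] by blast
qed

lemma subspace_MNSym: "frag.subspace MNSym"
  unfolding MNSym_def by (rule frag.subspace_span)

lemma MNSym_free_on: "x \<in> MNSym \<Longrightarrow> x \<in> free_on M_perms_all"
  by (simp add: MNSym_eq)

text \<open>The cuts in \<open>sum_splits\<close> depend only on the length, and the descents of
  prefixes and suffixes are determined by those of the whole word.\<close>

lemma MNSym_mult:
  assumes "x \<in> MNSym" "y \<in> MNSym"
  shows "MMR_mult (tens x y) \<in> MNSym"
proof -
  have x: "x \<in> free_on M_perms_all" "type_invariant x" and y: "y \<in> free_on M_perms_all" "type_invariant y"
    using assms by (auto simp: MNSym_eq)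
  have "type_invariant (MMR_mult (tens x y))"
    unfolding type_invariant_def
  proof (intro allI impI)
    fix p q :: "nat list"
    assume pq: "distinct_adj p" "distinct_adj q" "length p = length q" "descents p = descents q"
    have X: "coeff x (word_comp (take i p)) = coeff x (word_comp (take i q))" for i
      by (intro x(2)[unfolded type_invariant_def, rule_format])
        (simp_all add: pq distinct_adj_take descents_take)
    have Y: "coeff y (word_comp (drop i p)) = coeff y (word_comp (drop i q))" for i
      by (intro y(2)[unfolded type_invariant_def, rule_format])
        (simp_all add: pq distinct_adj_drop descents_drop)
    show "coeff (MMR_mult (tens x y)) (word_comp p) =
      coeff (MMR_mult (tens x y)) (word_comp q)"
      unfolding lookup_MMR_mult_tens[OF x(1) y(1) pq(1)] lookup_MMR_mult_tens[OF x(1) y(1) pq(2)]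
        sum_splits[OF pq(1)] sum_splits[OF pq(2)] pq(3) X Y ..
  qed
  then show ?thesis by (simp add: MNSym_eq free_on_MMR_mult)
qed

section \<open>The multiplicative basis of \<MM>NSym\<close>

text \<open>Up to order isomorphism only one merged word of length \<open>b\<close> has no descents,
  so for positive \<open>b\<close> this is \<open>Rtilde [b]\<close>, the analogue of a complete
  homogeneous generator of NSym.\<close>

definition H1 :: "nat \<Rightarrow> nat set list \<Rightarrow>\<^sub>0 int" where
  "H1 b = frag_of (word_comp [0..<b])"

fun H :: "nat list \<Rightarrow> nat set list \<Rightarrow>\<^sub>0 int" where
  "H [] = MMR_unit"
| "H (b # c) = MMR_mult (tens (H1 b) (H c))"

lemma distinct_adj_upt [simp]: "distinct_adj [i..<j]"
  by (simp add: distinct_adj_altdef remdups_adj_distinct)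

lemma H1_free_on [simp]: "H1 b \<in> free_on M_perms_all"
  by (simp add: H1_def)

lemma H_free_on [simp]: "H c \<in> free_on M_perms_all"
  by (cases c) (auto simp: free_on_MMR_mult)

lemma word_comp_eq_upt_iff:
  "word_comp p = word_comp [0..<b] \<longleftrightarrow> length p = b \<and> sorted_wrt (<) p"
proof
  assume *: "word_comp p = word_comp [0..<b]"
  then obtain f where f: "strict_mono_on (set [0..<b]) f" "p = map f [0..<b]"
    by (metis word_comp_eqD)
  have "sorted_wrt (\<lambda>x y. f x < f y) [0..<b]"
    by (rule sorted_wrt_mono_rel[OF _ sorted_wrt_upt]) (use f(1) in \<open>auto simp: strict_mono_on_def\<close>)
  then have "sorted_wrt (<) p" unfolding f(2) sorted_wrt_map .
  with f(2) show "length p = b \<and> sorted_wrt (<) p" by simp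
next
  assume p: "length p = b \<and> sorted_wrt (<) p"
  then have "strict_mono_on (set [0..<b]) ((!) p)"
    by (intro strict_mono_onI) (simp add: sorted_wrt_iff_nth_less)
  moreover have "p = map ((!) p) [0..<b]" using p map_nth[of p] by auto
  ultimately show "word_comp p = word_comp [0..<b]" using word_comp_map by metis
qed

lemma lookup_H1:
  "coeff (H1 b) (word_comp p) = of_bool (length p = b \<and> sorted_wrt (<) p)"
  by (simp add: H1_def word_comp_eq_upt_iff)

lemma H1_0: "H1 0 = MMR_unit"
  by (simp add: H1_def MMR_unit_def)

lemma H_Cons_0 [simp]: "H (0 # c) = H c"
  by (simp add: H1_0 MMR_mult_unit)

lemma H_filter: "H (filter (\<lambda>b. b \<noteq> 0) c) = H c"
  by (induction c) (auto simp: H1_0 MMR_mult_unit)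

lemma H_append: "H (c @ d) = MMR_mult (tens (H c) (H d))"
  by (induction c) (simp_all add: MMR_mult_unit MMR_mult_assoc)

lemma type_invariant_H1: "type_invariant (H1 b)"
  unfolding type_invariant_def lookup_H1 by (simp flip: descents_empty_iff)

lemma H1_MNSym: "H1 b \<in> MNSym"
  by (simp add: MNSym_eq type_invariant_H1)

lemma MMR_unit_MNSym: "MMR_unit \<in> MNSym"
  using H1_MNSym[of 0] by (simp add: H1_0)

lemma H_MNSym: "H c \<in> MNSym"
  by (induction c) (simp_all add: MMR_unit_MNSym MNSym_mult H1_MNSym)

section \<open>Coproduct and antipode on the multiplicative basis\<close>

primrec list_splits :: "nat list \<Rightarrow> (nat list \<times> nat list) set" where
  "list_splits [] = {([], [])}"
| "list_splits (x # c) = (\<lambda>(i, (a, b)). (i # a, (x - i) # b)) ` ({..x} \<times> list_splits c)"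

lemma finite_list_splits [simp]: "finite (list_splits c)"
  by (induction c) simp_all

lemma sum_list_splits_Cons:
  "(\<Sum>ab\<in>list_splits (x # c). f (fst ab) (snd ab)) =
    (\<Sum>i\<le>x. \<Sum>ab\<in>list_splits c. f (i # fst ab) ((x - i) # snd ab))"
proof -
  have "inj_on (\<lambda>(i, (a, b)). (i # a, (x - i) # b)) ({..x} \<times> list_splits c)"
    by (auto simp: inj_on_def)
  then have "(\<Sum>ab\<in>list_splits (x # c). f (fst ab) (snd ab)) =
    (\<Sum>z\<in>{..x} \<times> list_splits c. f (fst z # fst (snd z)) ((x - fst z) # snd (snd z)))"
    by (simp add: sum.reindex case_prod_unfold)
  then show ?thesis by (simp add: sum.cartesian_product case_prod_unfold)
qed

text \<open>Both summands keep their zero entries and so stay aligned with \<open>c\<close>; the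
  same pairs index the factorizations of a monomial with exponents \<open>c\<close>.\<close>

lemma list_splits_iff:
  "(a, b) \<in> list_splits c \<longleftrightarrow> length a = length c \<and> length b = length c \<and> (\<forall>i<length c. a ! i + b ! i = c ! i)"
proof (induction c arbitrary: a b)
  case (Cons x c)
  show ?case
  proof
    assume "(a, b) \<in> list_splits (x # c)"
    then show "length a = length (x # c) \<and> length b = length (x # c) \<and>
      (\<forall>i<length (x # c). a ! i + b ! i = (x # c) ! i)"
      using Cons.IH by (auto simp: nth_Cons split: nat.splits)
  next
    assume *: "length a = length (x # c) \<and> length b = length (x # c) \<and>
      (\<forall>i<length (x # c). a ! i + b ! i = (x # c) ! i)"
    then obtain a0 a' b0 b' where ab: "a = a0 # a'" "b = b0 # b'"
      by (metis length_Suc_conv list.size(4) add.commute plus_1_eq_Suc)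
    have "a0 + b0 = x" using * unfolding ab by auto
    moreover have "(a', b') \<in> list_splits c"
      using * unfolding Cons.IH ab by auto
    ultimately show "(a, b) \<in> list_splits (x # c)"
      unfolding ab by (auto intro!: image_eqI[of _ _ "(a0, (a', b'))"])
  qed
qed auto

lemma list_splits_sum_list: "(a, b) \<in> list_splits c \<Longrightarrow> sum_list a + sum_list b = sum_list c"
  by (induction c arbitrary: a b) auto

lemma MMR_comult_H1: "MMR_comult (H1 b) = (\<Sum>i\<le>b. tens (H1 i) (H1 (b - i)))"
proof -
  have "frag_of (st (take i (word_comp [0..<b])), st (drop i (word_comp [0..<b]))) = tens (H1 i) (H1 (b - i))"
    if i: "i \<le> b" for i
  proof -
    have "{l \<in> set [0..<b]. l < i} = {0..<i}" using i by auto
    then have c: "card {l \<in> set [0..<b]. l < i} = i" by simp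
    have "[0..<b] = [0..<i] @ [i..<b]" using i by (metis le_add_diff_inverse upt_add_eq_append zero_le)
    moreover have "filter (\<lambda>l. l < i) [0..<i] = [0..<i]" "filter (\<lambda>l. \<not> l < i) [0..<i] = []"
      "filter (\<lambda>l. l < i) [i..<b] = []" "filter (\<lambda>l. \<not> l < i) [i..<b] = [i..<b]"
      by (auto simp: filter_empty_conv intro!: filter_True)
    ultimately have f: "filter (\<lambda>l. l < i) [0..<b] = [0..<i]" "filter (\<lambda>l. \<not> l < i) [0..<b] = [i..<b]"
      by (metis append_Nil2 append_Nil filter_append)+
    have d: "remdups_adj [j..<k] = [j..<k]" for j k
      by (simp add: remdups_adj_distinct)
    have "word_comp [i..<b] = word_comp [0..<b - i]"
      unfolding word_comp_eq_upt_iff by simp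
    then show ?thesis
      using take_word_comp[of "[0..<b]" i] unfolding c f d by (simp add: H1_def)
  qed
  then show ?thesis
    unfolding H1_def[of b] MMR_comult_frag_of by (simp add: length_word_comp)
qed

lemma swap_middle_tens:
  "frag_extend (\<lambda>((a, b), (c, d)). frag_of ((a, c), (b, d))) (tens (tens p q) (tens r s))
    = tens (tens p r) (tens q s)"
  by (rule poly_mapping_eqI) (auto simp: lookup_swap_middle)

lemma MMR_comult_mult_tens:
  assumes "x \<in> free_on M_perms_all" "y \<in> free_on M_perms_all"
    "MMR_comult x = (\<Sum>i\<in>I. tens (p i) (q i))" "MMR_comult y = (\<Sum>j\<in>J. tens (r j) (s j))"
  shows "MMR_comult (MMR_mult (tens x y)) =
    (\<Sum>i\<in>I. \<Sum>j\<in>J. tens (MMR_mult (tens (p i) (r j))) (MMR_mult (tens (q i) (s j))))"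
proof -
  have "tensor_map MMR_mult MMR_mult (tens u v) = tens (MMR_mult u) (MMR_mult v)" for u v
    unfolding MMR_mult_def by (rule tensor_map_tens)
  then show ?thesis
    unfolding MMR_comult_mult[OF assms(1,2)] assms(3,4) tens_sum_left tens_sum_right
      frag_extend_sum' tensor_map_sum swap_middle_tens by (simp add: sum.swap[of _ J])
qed

lemma MMR_comult_H: "MMR_comult (H c) = (\<Sum>ab\<in>list_splits c. tens (H (fst ab)) (H (snd ab)))"
proof (induction c)
  case Nil
  then show ?case by (simp add: MMR_comult_unit)
next
  case (Cons b c)
  have "MMR_comult (H (b # c)) = (\<Sum>i\<le>b. \<Sum>ab\<in>list_splits c.
      tens (H (i # fst ab)) (H ((b - i) # snd ab)))"
    unfolding H.simps by (rule MMR_comult_mult_tens[OF H1_free_on H_free_on MMR_comult_H1 Cons.IH])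
  then show ?case unfolding sum_list_splits_Cons[of "\<lambda>a b. tens (H a) (H b)"] .
qed

text \<open>The antipode identity for \<open>H c\<close> is solved for the antipode of
  \<open>H c\<close> itself; every other term contains the antipode of some \<open>H a\<close> with
  smaller sum, and MNSym is closed under products.\<close>

lemma MMR_antipode_H: "MMR_antipode (H c) \<in> MNSym"
proof (induction "sum_list c" arbitrary: c rule: less_induct)
  case less
  show ?case
  proof (cases "sum_list c = 0")
    case True
    then have "filter (\<lambda>b. b \<noteq> 0) c = []" by (auto simp: filter_empty_conv)
    then have "H c = MMR_unit" using H_filter[of c] by simp
    then show ?thesis
      using MMR_unit_MNSym by (simp add: MMR_unit_def MMR_antipode_simps anti_left.simps[of "[]"])
  next
    case False
    \<comment> \<open>The splitting with zero second summand; its term is the antipode of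
      \<open>H c\<close> times the unit.\<close>
    define z where "z = (c, replicate (length c) (0::nat))"
    have z: "z \<in> list_splits c" by (auto simp: z_def list_splits_iff)
    have "filter (\<lambda>b. b \<noteq> 0) (replicate (length c) (0::nat)) = []" by simp
    then have Hz: "H (snd z) = MMR_unit" using H_filter[of "snd z"] by (simp add: z_def)
    have free: "MMR_antipode (H c) \<in> free_on M_perms_all"
      unfolding MMR_antipode_def by (rule free_on_frag_extend[OF H_free_on free_on_anti(1)])
    have "frag_cmul (MMR_counit (H c)) MMR_unit = MMR_mult (tensor_map MMR_antipode id (MMR_comult (H c)))"
      using MMR_antipode(1)[OF H_free_on] ..
    also have "\<dots> = (\<Sum>ab\<in>list_splits c. MMR_mult (tens (MMR_antipode (H (fst ab))) (H (snd ab))))"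
      unfolding MMR_comult_H tensor_map_sum MMR_mult_sum MMR_antipode_def tensor_map_id_tens ..
    also have "\<dots> = MMR_mult (tens (MMR_antipode (H (fst z))) (H (snd z))) +
      (\<Sum>ab\<in>list_splits c - {z}. MMR_mult (tens (MMR_antipode (H (fst ab))) (H (snd ab))))"
      by (rule sum.remove[OF finite_list_splits z])
    also have "MMR_mult (tens (MMR_antipode (H (fst z))) (H (snd z))) = MMR_antipode (H c)"
      unfolding Hz using free by (simp add: z_def MMR_mult_unit)
    finally have eq: "MMR_antipode (H c) = frag_cmul (MMR_counit (H c)) MMR_unit -
      (\<Sum>ab\<in>list_splits c - {z}. MMR_mult (tens (MMR_antipode (H (fst ab))) (H (snd ab))))"
      by simp
    \<comment> \<open>Apart from \<open>z\<close>, the second summand is nonzero, so the first one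
      has strictly smaller sum.\<close>
    have "MMR_antipode (H (fst ab)) \<in> MNSym" if ab: "ab \<in> list_splits c - {z}" for ab
    proof (rule less.hyps)
      obtain a b where ab': "ab = (a, b)" by fastforce
      have s: "(a, b) \<in> list_splits c" "(a, b) \<noteq> z" using ab by (auto simp: ab')
      then have "length a = length c" "length b = length c" "\<forall>i<length c. a ! i + b ! i = c ! i"
        by (auto simp: list_splits_iff)
      have "sum_list b \<noteq> 0"
      proof
        assume "sum_list b = 0"
        then have b0: "\<forall>x\<in>set b. x = 0" by simp
        then have "b = replicate (length c) 0"
          using \<open>length b = length c\<close> by (metis replicate_eqI)
        moreover have "a = c"
          using \<open>length a = length c\<close> \<open>length b = length c\<close> \<open>\<forall>i<length c. a ! i + b ! i = c ! i\<close> b0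
          by (intro nth_equalityI) (simp, metis add.right_neutral nth_mem)
        ultimately show False using s(2) by (simp add: z_def)
      qed
      then show "sum_list (fst ab) < sum_list c"
        using list_splits_sum_list[OF s(1)] unfolding ab' fst_conv by linarith
    qed
    then show ?thesis
      unfolding eq
      by (intro frag.subspace_diff[OF subspace_MNSym] frag.subspace_scale[OF subspace_MNSym]
          frag.subspace_sum[OF subspace_MNSym] MMR_unit_MNSym MNSym_mult H_MNSym)
  qed
qed

section \<open>Unitriangularity of the multiplicative basis\<close>

lemma splits_prefix_sum:
  assumes p: "distinct_adj p" and b: "0 < b"
  shows "(\<Sum>(c, d)\<in>splits p. of_bool (length c = b \<and> sorted_wrt (<) c) * f d) =
    (if b \<le> length p \<and> sorted_wrt (<) (take b p) then f (drop b p) + f (drop (b - 1) p) else 0 :: int)"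
proof -
  have 1: "(\<Sum>i\<le>length p. of_bool (length (take i p) = b \<and> sorted_wrt (<) (take i p)) * f (drop i p)) =
    (if b \<le> length p \<and> sorted_wrt (<) (take b p) then f (drop b p) else 0)"
  proof -
    have "of_bool (length (take i p) = b \<and> sorted_wrt (<) (take i p)) * f (drop i p) =
      (if i = b then (if sorted_wrt (<) (take b p) then f (drop b p) else 0) else 0)" if "i \<le> length p" for i
      using that by auto
    then show ?thesis by auto
  qed
  \<comment> \<open>With a shared letter, the first factor has length \<open>Suc i\<close>, so the
    cut is at \<open>i = b - 1\<close>; this index exists because \<open>b\<close> is
    positive.\<close>
  have 2: "(\<Sum>i<length p. of_bool (length (take (Suc i) p) = b \<and> sorted_wrt (<) (take (Suc i) p)) * f (drop i p)) =
    (if b \<le> length p \<and> sorted_wrt (<) (take b p) then f (drop (b - 1) p) else 0)"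
  proof -
    have "of_bool (length (take (Suc i) p) = b \<and> sorted_wrt (<) (take (Suc i) p)) * f (drop i p) =
      (if i = b - 1 then (if sorted_wrt (<) (take b p) then f (drop (b - 1) p) else 0) else 0)"
      if "i < length p" for i
      using that b by auto
    then have "(\<Sum>i<length p. of_bool (length (take (Suc i) p) = b \<and> sorted_wrt (<) (take (Suc i) p)) * f (drop i p))
      = (\<Sum>i<length p. if i = b - 1 then (if sorted_wrt (<) (take b p) then f (drop (b - 1) p) else 0) else 0)"
      by (intro sum.cong refl) simp
    then show ?thesis using b by auto
  qed
  show ?thesis unfolding sum_splits[OF p] 1 2 by auto
qed

text \<open>The two summands are the cut after \<open>b\<close> letters and the cut at which the
  last of these letters is shared. \<open>L_word_recursion\<close> has the same shape.\<close>

lemma lookup_H_Cons: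
  assumes "distinct_adj p" "0 < b"
  shows "coeff (H (b # c)) (word_comp p) =
    (if b \<le> length p \<and> sorted_wrt (<) (take b p) then
      coeff (H c) (word_comp (drop b p)) + coeff (H c) (word_comp (drop (b - 1) p))
     else 0)"
  unfolding H.simps lookup_MMR_mult_tens[OF H1_free_on H_free_on assms(1)] lookup_H1
  by (rule splits_prefix_sum[OF assms])

text \<open>A word in \<open>H \<beta>\<close> is covered by increasing runs with lengths given by
  \<beta>, and every shared letter shortens it. At full length nothing is shared, and descents can
  occur only between runs.\<close>

lemma lookup_H_nonzero:
  assumes "distinct_adj p" "\<beta> \<in> compositions" "coeff (H \<beta>) (word_comp p) \<noteq> 0"
  shows "length p \<le> sum_list \<beta> \<and> (length p = sum_list \<beta> \<longrightarrow> descents p \<subseteq> D \<beta>)"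
  using assms
proof (induction \<beta> arbitrary: p)
  case Nil
  then show ?case by (auto simp: MMR_unit_def descents_def split: if_splits)
next
  case (Cons b \<beta>)
  have b: "0 < b" "\<beta> \<in> compositions" using Cons.prems by auto
  have s: "b \<le> length p" "sorted_wrt (<) (take b p)"
    and nz: "coeff (H \<beta>) (word_comp (drop b p)) \<noteq> 0 \<or>
      coeff (H \<beta>) (word_comp (drop (b - 1) p)) \<noteq> 0"
    using Cons.prems(3) unfolding lookup_H_Cons[OF Cons.prems(1) b(1)] by (auto split: if_splits)
  have dj: "distinct_adj (drop b p)" "distinct_adj (drop (b - 1) p)"
    using Cons.prems(1) by (auto intro: distinct_adj_drop)
  show ?case
  proof (cases "coeff (H \<beta>) (word_comp (drop (b - 1) p)) \<noteq> 0")
    \<comment> \<open>A shared letter makes \<open>p\<close> strictly shorter than the sum, so the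
      claim about descents is vacuous.\<close>
    case True
    then have "length (drop (b - 1) p) \<le> sum_list \<beta>" using Cons.IH[OF dj(2) b(2)] by blast
    then show ?thesis using s b by auto
  next
    case False
    then have IH: "length (drop b p) \<le> sum_list \<beta> \<and>
      (length (drop b p) = sum_list \<beta> \<longrightarrow> descents (drop b p) \<subseteq> D \<beta>)"
      using nz Cons.IH[OF dj(1) b(2)] by blast
    have "descents p \<subseteq> D (b # \<beta>)" if len: "length p = sum_list (b # \<beta>)"
    proof
      fix j assume j: "j \<in> descents p"
      have "descents (take b p) = {}"
        using s(2) descents_empty_iff[OF distinct_adj_take[OF Cons.prems(1)]] by blast
      then have "b \<le> j" using j unfolding descents_take by auto
      have "j < length p" using j descents_subset[of p] by auto
      then have ne: "\<beta> \<noteq> []" using len \<open>b \<le> j\<close> by auto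
      show "j \<in> D (b # \<beta>)"
      proof (cases "j = b")
        case True
        then show ?thesis using ne by (simp add: D_Cons)
      next
        case False
        then have "j - b \<in> descents (drop b p)" using j \<open>b \<le> j\<close> by (simp add: descents_drop)
        then have "j - b \<in> D \<beta>" using IH len s(1) by auto
        then show ?thesis using ne \<open>b \<le> j\<close> by (auto simp: D_Cons intro!: image_eqI[of _ _ "j - b"])
      qed
    qed
    then show ?thesis using IH s(1) by auto
  qed
qed

lemma lookup_H_diag:
  assumes "distinct_adj p" "\<beta> \<in> compositions" "length p = sum_list \<beta>" "descents p = D \<beta>"
  shows "coeff (H \<beta>) (word_comp p) = 1"
  using assms
proof (induction \<beta> arbitrary: p)
  case Nil
  then show ?case by (simp add: MMR_unit_def)
next
  case (Cons b \<beta>)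
  have b: "0 < b" "\<beta> \<in> compositions" using Cons.prems by auto
  have dj: "distinct_adj (drop b p)" "distinct_adj (drop (b - 1) p)" "distinct_adj (take b p)"
    using Cons.prems(1) by (auto intro: distinct_adj_drop distinct_adj_take)
  have "descents (take b p) = {}"
    unfolding descents_take Cons.prems(4) D_Cons by auto
  then have s: "sorted_wrt (<) (take b p)" using descents_empty_iff[OF dj(3)] by blast
  \<comment> \<open>The suffix that keeps the shared letter is one letter longer than the sum of
    \<beta> allows.\<close>
  have "coeff (H \<beta>) (word_comp (drop (b - 1) p)) = 0"
  proof (rule ccontr)
    assume "coeff (H \<beta>) (word_comp (drop (b - 1) p)) \<noteq> 0"
    then have "length (drop (b - 1) p) \<le> sum_list \<beta>" using lookup_H_nonzero[OF dj(2) b(2)] by blast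
    then show False using Cons.prems(3) b(1) by simp
  qed
  moreover have "coeff (H \<beta>) (word_comp (drop b p)) = 1"
  proof (rule Cons.IH[OF dj(1) b(2)])
    show "length (drop b p) = sum_list \<beta>" using Cons.prems(3) by simp
    show "descents (drop b p) = D \<beta>"
      unfolding descents_drop Cons.prems(4) D_Cons_shift[OF Cons.prems(2)] ..
  qed
  ultimately show ?case
    unfolding lookup_H_Cons[OF Cons.prems(1) b(1)] using s Cons.prems(3) by simp
qed

text \<open>Lexicographic order by size and then by length, as a single number: the length of a
  composition is at most its size.\<close>

definition rank :: "nat list \<Rightarrow> nat" where
  "rank \<beta> = sum_list \<beta> * sum_list \<beta> + card (D \<beta>)"

text \<open>Unitriangularity with respect to \<open>rank\<close>, for the matrix that expands the
  \<open>H \<beta>\<close> in the \<open>Rtilde \<alpha>\<close>.\<close>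

lemma lookup_H_rep:
  assumes "\<alpha> \<in> compositions" "\<beta> \<in> compositions"
  shows "coeff (H \<alpha>) (rep \<alpha>) = 1"
    "coeff (H \<beta>) (rep \<alpha>) \<noteq> 0 \<Longrightarrow> \<alpha> = \<beta> \<or> rank \<alpha> < rank \<beta>"
proof -
  show "coeff (H \<alpha>) (rep \<alpha>) = 1"
    unfolding rep_def by (rule lookup_H_diag) (use assms rep_word in auto)
  assume nz: "coeff (H \<beta>) (rep \<alpha>) \<noteq> 0"
  have *: "sum_list \<alpha> \<le> sum_list \<beta>" "sum_list \<alpha> = sum_list \<beta> \<Longrightarrow> D \<alpha> \<subseteq> D \<beta>"
    using lookup_H_nonzero[OF rep_word(1)[OF assms(1)] assms(2) nz[unfolded rep_def]]
    unfolding rep_word[OF assms(1)] by auto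
  show "\<alpha> = \<beta> \<or> rank \<alpha> < rank \<beta>"
  proof (cases "sum_list \<alpha> = sum_list \<beta>")
    case True
    show ?thesis
    proof (cases "D \<alpha> = D \<beta>")
      case True
      then show ?thesis using D_inject[OF assms \<open>sum_list \<alpha> = sum_list \<beta>\<close>] by blast
    next
      case False
      then have "card (D \<alpha>) < card (D \<beta>)"
        using *(2)[OF True] finite_D[OF assms(2)] by (intro psubset_card_mono) auto
      then show ?thesis using True by (simp add: rank_def)
    qed
  next
    case False
    then have lt: "sum_list \<alpha> + 1 \<le> sum_list \<beta>" using * by simp
    \<comment> \<open>\<open>card (D \<alpha>)\<close> is too small to bridge the gap between
      consecutive squares, so a smaller size always means a smaller rank.\<close>
    have "card (D \<alpha>) \<le> card {1..<sum_list \<alpha>}" using D_subset[OF assms(1)] by (intro card_mono) auto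
    then have "rank \<alpha> < (sum_list \<alpha> + 1) * (sum_list \<alpha> + 1)" by (simp add: rank_def)
    also have "\<dots> \<le> sum_list \<beta> * sum_list \<beta>" by (rule mult_le_mono[OF lt lt])
    finally show ?thesis by (simp add: rank_def)
  qed
qed

text \<open>Inverts the unitriangular matrix by induction on \<open>rank\<close>:
  \<open>H \<beta>\<close> is \<open>Rtilde \<beta>\<close> plus a combination of
  \<open>Rtilde \<alpha>\<close> of smaller rank.\<close>

lemma MNSym_span_H: "MNSym = frag.span (H ` compositions)"
proof
  show "frag.span (H ` compositions) \<subseteq> MNSym"
    by (rule frag.span_minimal[OF _ subspace_MNSym]) (auto simp: H_MNSym)
  have "Rtilde \<beta> \<in> frag.span (H ` compositions)" if "\<beta> \<in> compositions" for \<beta>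
    using that
  proof (induction "rank \<beta>" arbitrary: \<beta> rule: less_induct)
    case less
    let ?S = "{\<alpha> \<in> compositions. coeff (H \<beta>) (rep \<alpha>) \<noteq> 0}"
    have ti: "type_invariant (H \<beta>)" using H_MNSym by (simp add: MNSym_eq)
    note S = type_invariant_expansion[OF H_free_on ti]
    have \<beta>: "\<beta> \<in> ?S" using less.prems lookup_H_rep(1)[OF less.prems less.prems] by simp
    have "H \<beta> = Rtilde \<beta> + (\<Sum>\<alpha>\<in>?S - {\<beta>}. frag_cmul (coeff (H \<beta>) (rep \<alpha>)) (Rtilde \<alpha>))"
      by (subst S(2), subst sum.remove[OF S(1) \<beta>])
        (use lookup_H_rep(1)[OF less.prems less.prems] in simp)
    then have "Rtilde \<beta> = H \<beta> - (\<Sum>\<alpha>\<in>?S - {\<beta>}. frag_cmul (coeff (H \<beta>) (rep \<alpha>)) (Rtilde \<alpha>))"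
      by (simp add: algebra_simps)
    also have "\<dots> \<in> frag.span (H ` compositions)"
    proof (intro frag.span_diff frag.span_sum frag.span_scale)
      fix \<alpha> assume "\<alpha> \<in> ?S - {\<beta>}"
      then show "Rtilde \<alpha> \<in> frag.span (H ` compositions)"
        using less.hyps[of \<alpha>] lookup_H_rep(2)[of \<alpha> \<beta>] less.prems by blast
    qed (use less.prems in \<open>auto intro: frag.span_base\<close>)
    finally show ?case .
  qed
  then show "MNSym \<subseteq> frag.span (H ` compositions)"
    unfolding MNSym_def by (intro frag.span_minimal frag.subspace_span) auto
qed

text \<open>Reduces linear statements on MNSym to the elements \<open>H \<beta>\<close>, where
  product, coproduct and pairing have closed forms.\<close>

lemma MNSym_induct [consumes 1, case_names H zero add scale]:
  assumes "x \<in> MNSym" "\<And>\<beta>. \<beta> \<in> compositions \<Longrightarrow> P (H \<beta>)" "P 0"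
    "\<And>x y. x \<in> MNSym \<Longrightarrow> y \<in> MNSym \<Longrightarrow> P x \<Longrightarrow> P y \<Longrightarrow> P (x + y)"
    "\<And>c x. x \<in> MNSym \<Longrightarrow> P x \<Longrightarrow> P (frag_cmul c x)"
  shows "P x"
proof -
  have "x \<in> MNSym \<and> P x"
    using assms(1)[unfolded MNSym_span_H]
  proof (induction rule: frag.span_induct_alt)
    case base
    then show ?case using assms(3) frag.subspace_0[OF subspace_MNSym] by blast
  next
    case (step c x y)
    then obtain \<beta> where \<beta>: "\<beta> \<in> compositions" "x = H \<beta>" by blast
    then have "frag_cmul c x \<in> MNSym" "P (frag_cmul c x)"
      using assms(2,5) H_MNSym frag.subspace_scale[OF subspace_MNSym] by blast+
    then show ?case using step assms(4) frag.subspace_add[OF subspace_MNSym] by blast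
  qed
  then show ?thesis ..
qed

theorem hopf_subalgebra_MNSym:
  "hopf_subalgebra MNSym M_perms_all MMR_mult MMR_unit MMR_comult MMR_counit MMR_antipode"
proof -
  have "MMR_comult x \<in> frag.span {tens y z |y z. y \<in> MNSym \<and> z \<in> MNSym}" if "x \<in> MNSym" for x
    using that
  proof (induction rule: MNSym_induct)
    case (H \<beta>)
    show ?case
      unfolding MMR_comult_H by (intro frag.span_sum frag.span_base) (use H_MNSym in blast)
  qed (auto simp: MMR_comult_simps intro: frag.span_add frag.span_scale frag.span_zero)
  moreover have "MMR_antipode x \<in> MNSym" if "x \<in> MNSym" for x
    using that
  proof (induction rule: MNSym_induct)
    case zero
    then show ?case by (simp add: MMR_antipode_simps frag.subspace_0[OF subspace_MNSym])
  next
    case (add x y)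
    then show ?case by (simp add: MMR_antipode_simps frag.subspace_add[OF subspace_MNSym])
  next
    case (scale c x)
    then show ?case by (simp add: MMR_antipode_simps frag.subspace_scale[OF subspace_MNSym])
  qed (rule MMR_antipode_H)
  ultimately show ?thesis
    unfolding hopf_subalgebra_def
    using hopf_algebra_MMR subspace_MNSym MNSym_free_on MNSym_mult MMR_unit_MNSym by blast
qed

section \<open>Recursion for the multi-fundamental series\<close>

text \<open>The condition on sequences in \<open>L_word\<close>, made recursive in the first letter
  so that the smallest variable can be peeled off.\<close>

fun admissible :: "nat list \<Rightarrow> nat set list \<Rightarrow> bool" where
  "admissible [] \<sigma> \<longleftrightarrow> \<sigma> = []"
| "admissible (x # p) [] \<longleftrightarrow> False"
| "admissible (x # p) (S # \<sigma>) \<longleftrightarrow> finite S \<and> S \<noteq> {} \<and> admissible p \<sigma> \<and>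
    (p \<noteq> [] \<longrightarrow> (x < hd p \<longrightarrow> Max S \<le> Min (hd \<sigma>)) \<and> (x > hd p \<longrightarrow> Max S < Min (hd \<sigma>)))"

declare Max.bounded_iff [simp del] Max_less_iff [simp del]

definition weight :: "nat set list \<Rightarrow> monom" where
  "weight \<sigma> = sum_list (map (\<lambda>S. \<Sum>r\<in>S. Poly_Mapping.single r 1) \<sigma>)"

lemma admissible_length: "admissible p \<sigma> \<Longrightarrow> length \<sigma> = length p"
  by (induction p \<sigma> rule: admissible.induct) auto

lemma all_less_Suc_Cons:
  "(\<forall>i. Suc i < length (x # p) \<longrightarrow> Q i) \<longleftrightarrow> (p \<noteq> [] \<longrightarrow> Q 0) \<and> (\<forall>i. Suc i < length p \<longrightarrow> Q (Suc i))"
  (is "?l \<longleftrightarrow> ?r")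
proof
  assume l: ?l
  then show ?r using l[rule_format, of 0] by auto
next
  assume r: ?r
  show ?l
  proof (intro allI impI)
    fix i assume "Suc i < length (x # p)"
    then show "Q i" using r by (cases i) auto
  qed
qed

lemma admissible_iff:
  "admissible p \<sigma> \<longleftrightarrow> length \<sigma> = length p \<and> (\<forall>P\<in>set \<sigma>. finite P \<and> P \<noteq> {}) \<and>
    (\<forall>i. Suc i < length p \<longrightarrow>
      (p ! i < p ! Suc i \<longrightarrow> Max (\<sigma> ! i) \<le> Min (\<sigma> ! Suc i)) \<and>
      (p ! i > p ! Suc i \<longrightarrow> Max (\<sigma> ! i) < Min (\<sigma> ! Suc i)))"
proof (induction p \<sigma> rule: admissible.induct)
  case (3 x p S \<sigma>)
  show ?case
  proof (cases "length \<sigma> = length p")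
    case True
    define Q where "Q p \<sigma> i \<longleftrightarrow> (p ! i < p ! Suc i \<longrightarrow> Max (\<sigma> ! i) \<le> Min (\<sigma> ! Suc i)) \<and>
      (p ! i > p ! Suc i \<longrightarrow> Max (\<sigma> ! i) < Min (\<sigma> ! Suc i))" for p :: "nat list" and \<sigma> :: "nat set list" and i
    have "Q (x # p) (S # \<sigma>) (Suc i) \<longleftrightarrow> Q p \<sigma> i" for i by (simp add: Q_def)
    moreover have "Q (x # p) (S # \<sigma>) 0 \<longleftrightarrow>
      (x < hd p \<longrightarrow> Max S \<le> Min (hd \<sigma>)) \<and> (x > hd p \<longrightarrow> Max S < Min (hd \<sigma>))" if "p \<noteq> []"
      using that True by (cases p; cases \<sigma>) (auto simp: Q_def)
    ultimately show ?thesis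
      unfolding Q_def[symmetric] all_less_Suc_Cons[of x p "Q (x # p) (S # \<sigma>)"] admissible.simps
        3[folded Q_def]
      by (cases "p = []") (auto simp: True)
  next
    case False
    then show ?thesis using admissible_length[of p \<sigma>] by auto
  qed
qed auto

lemma L_word_eq: "L_word p m = int (card {\<sigma>. admissible p \<sigma> \<and> weight \<sigma> = m})"
proof -
  have "weight \<sigma> = (\<Sum>i<length \<sigma>. \<Sum>r\<in>\<sigma> ! i. Poly_Mapping.single r 1)" for \<sigma>
    unfolding weight_def by (simp add: sum_list_sum_nth atLeast0LessThan)
  then show ?thesis unfolding L_word_def admissible_iff by (simp add: conj_assoc)
qed

lemma weight_simps [simp]:
  "weight [] = 0"
  "weight (S # \<sigma>) = (\<Sum>r\<in>S. Poly_Mapping.single r 1) + weight \<sigma>"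
  by (simp_all add: weight_def)

lemma lookup_sum_single:
  "finite S \<Longrightarrow> coeff (\<Sum>r\<in>S. Poly_Mapping.single r (Suc 0)) k = of_bool (k \<in> S)"
  by (simp add: lookup_sum lookup_single when_def)

lemma keys_weight: "admissible p \<sigma> \<Longrightarrow> Poly_Mapping.keys (weight \<sigma>) = \<Union>(set \<sigma>)"
proof (induction p \<sigma> rule: admissible.induct)
  case (3 x p S \<sigma>)
  then have "r \<in> Poly_Mapping.keys (weight (S # \<sigma>)) \<longleftrightarrow> r \<in> S \<or> r \<in> Poly_Mapping.keys (weight \<sigma>)" for r
    unfolding in_keys_iff weight_simps lookup_add by (simp add: lookup_sum_single)
  then show ?case using 3 by auto
qed auto

lemma finite_admissible: "finite {\<sigma>. admissible p \<sigma> \<and> weight \<sigma> = m}"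
proof (rule finite_subset)
  show "{\<sigma>. admissible p \<sigma> \<and> weight \<sigma> = m} \<subseteq>
    {\<sigma>. set \<sigma> \<subseteq> Pow (Poly_Mapping.keys m) \<and> length \<sigma> = length p}"
    using keys_weight admissible_length by blast
qed (simp add: finite_lists_length_eq)

text \<open>Unequal adjacent letters impose a comparison at every step, so the sets move weakly to
  the right; strictness at the first step persists.\<close>

lemma admissible_ge:
  assumes "admissible (x # p) (S # \<sigma>)" "distinct_adj (x # p)" "r \<in> \<Union>(set \<sigma>)"
  shows "Max S \<le> r" "x > hd p \<Longrightarrow> Max S < r"
proof -
  have "Max S \<le> r \<and> (x > hd p \<longrightarrow> Max S < r)"
    using assms
  proof (induction p arbitrary: x S \<sigma>)
    case (Cons y p)
    then obtain T \<tau> where \<sigma>: "\<sigma> = T # \<tau>" by (cases \<sigma>) auto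
    note a0 = Cons.prems(1)[unfolded \<sigma> admissible.simps(3)[of x "y # p" S "T # \<tau>"]]
    have adm: "admissible (y # p) (T # \<tau>)" using a0 by blast
    have T: "finite T" "T \<noteq> {}" using adm unfolding admissible.simps(3) by blast+
    have "x \<noteq> y" "distinct_adj (y # p)" using Cons.prems(2) by (auto simp: distinct_adj_Cons)
    then have S: "Max S \<le> Min T" "x > y \<Longrightarrow> Max S < Min T"
      using a0 \<open>x \<noteq> y\<close> unfolding list.sel by (metis linorder_neqE_nat less_imp_le list.distinct(1))+
    have "Min T \<le> r"
    proof (cases "r \<in> T")
      case True
      then show ?thesis using T by simp
    next
      case False
      then have "r \<in> \<Union>(set \<tau>)" using Cons.prems(3) by (simp add: \<sigma>)
      then have "Max T \<le> r" using Cons.IH[OF adm \<open>distinct_adj (y # p)\<close>] by blast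
      moreover have "Min T \<le> Max T" using T by simp
      ultimately show ?thesis by simp
    qed
    then show ?case unfolding list.sel using S by (meson le_trans less_le_trans)
  qed auto
  then show "Max S \<le> r" "x > hd p \<Longrightarrow> Max S < r" by auto
qed

lemma single_add_cancel:
  fixes a b m :: monom
  shows "Poly_Mapping.single k (1::nat) + a = Poly_Mapping.single k (Suc c) + m \<longleftrightarrow>
    a = Poly_Mapping.single k c + m"
proof -
  have "Poly_Mapping.single k (Suc c) = Poly_Mapping.single k (1::nat) + Poly_Mapping.single k c"
    by (simp flip: single_add)
  then show ?thesis by (simp add: add.assoc)
qed

text \<open>Here \<open>k\<close> is the smallest variable, with exponent \<open>Suc c\<close>. The
  first set contains \<open>k\<close>. If it is \<open>{k}\<close>, it can be removed together with
  its letter. Otherwise its maximum exceeds \<open>k\<close>, all later sets avoid \<open>k\<close>,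
  the exponent is 1, and deleting \<open>k\<close> from the set leaves its maximum, hence the
  comparison with the next set, unchanged.\<close>

lemma admissible_peel:
  assumes p: "distinct_adj (x # q)" and k: "\<forall>r\<in>Poly_Mapping.keys m. k < r"
    and adm: "admissible (x # q) (S # \<tau>)" "weight (S # \<tau>) = Poly_Mapping.single k (Suc c) + m"
  shows "k \<in> S" "S = {k} \<Longrightarrow> weight \<tau> = Poly_Mapping.single k c + m"
    "S = {k} \<Longrightarrow> 0 < c \<Longrightarrow> q \<noteq> [] \<and> x < hd q"
    "S \<noteq> {k} \<Longrightarrow> c = 0 \<and> admissible (x # q) ((S - {k}) # \<tau>) \<and> weight ((S - {k}) # \<tau>) = m"
proof -
  have keys: "S \<union> \<Union>(set \<tau>) = insert k (Poly_Mapping.keys m)"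
  proof -
    have "Poly_Mapping.keys (Poly_Mapping.single k (Suc c) + m) = insert k (Poly_Mapping.keys m)"
      by (auto simp: in_keys_iff lookup_add lookup_single when_def split: if_splits)
    then show ?thesis using keys_weight[OF adm(1)] unfolding adm(2) by auto
  qed
  have ge: "k \<le> r" if "r \<in> S \<union> \<Union>(set \<tau>)" for r
    using that k unfolding keys by (auto intro: less_imp_le)
  have S: "finite S" "S \<noteq> {}" using adm(1) by auto
  show kS: "k \<in> S"
  proof (rule ccontr)
    assume "k \<notin> S"
    \<comment> \<open>If \<open>k\<close> occurred only later, then the maximum of \<open>S\<close>
      would be at most \<open>k\<close> and, by minimality, equal to it.\<close>
    then have "k \<in> \<Union>(set \<tau>)" using keys by auto
    then have "Max S \<le> k" by (rule admissible_ge(1)[OF adm(1) p])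
    moreover have "Max S \<in> S" using S by simp
    moreover have "k \<le> Max S" using ge \<open>Max S \<in> S\<close> by auto
    ultimately show False using \<open>k \<notin> S\<close> by (metis le_antisym)
  qed
  show 2: "weight \<tau> = Poly_Mapping.single k c + m" if "S = {k}"
    using adm(2) that single_add_cancel[of k "weight \<tau>" c m] by simp
  show "q \<noteq> [] \<and> x < hd q" if "S = {k}" "0 < c"
  proof -
    \<comment> \<open>With exponent above 1 the variable \<open>k\<close> recurs in a later set,
      which a descent at the first letter forbids.\<close>
    have "k \<in> Poly_Mapping.keys (weight \<tau>)"
      using that(2) unfolding 2[OF that(1)] by (simp add: in_keys_iff lookup_add)
    then have k\<tau>: "k \<in> \<Union>(set \<tau>)" using keys_weight[of q \<tau>] adm(1) by auto
    then have "q \<noteq> []" using adm(1) by (cases q) auto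
    moreover have "\<not> x > hd q" using admissible_ge(2)[OF adm(1) p k\<tau>] that(1) by auto
    moreover have "x \<noteq> hd q" using p \<open>q \<noteq> []\<close> by (auto simp: distinct_adj_Cons)
    ultimately show ?thesis by simp
  qed
  show "c = 0 \<and> admissible (x # q) ((S - {k}) # \<tau>) \<and> weight ((S - {k}) # \<tau>) = m" if "S \<noteq> {k}"
  proof -
    have ne: "S - {k} \<noteq> {}" using that kS by auto
    \<comment> \<open>A second element of \<open>S\<close> exceeds \<open>k\<close> and pushes every
      later set beyond \<open>k\<close>.\<close>
    then obtain s where s: "s \<in> S" "s \<noteq> k" by auto
    have "k < s" using s ge[of s] by auto
    also have "s \<le> Max S" using S s by simp
    finally have Mk: "k < Max S" .
    have MS: "Max (S - {k}) = Max S"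
      using S ne Mk kS by (metis Max_insert insert_Diff max_absorb2 max_def less_imp_le finite_Diff not_le)
    have "k \<notin> \<Union>(set \<tau>)" using admissible_ge(1)[OF adm(1) p, of k] Mk by auto
    then have "coeff (weight \<tau>) k = 0"
      using keys_weight[of q \<tau>] adm(1) by (auto simp: in_keys_iff)
    then have "coeff (weight (S # \<tau>)) k = 1"
      using S kS by (simp add: lookup_add lookup_sum_single)
    then have "c = 0" unfolding adm(2) by (simp add: lookup_add)
    moreover have "admissible (x # q) ((S - {k}) # \<tau>)"
      using adm(1) ne finite_Diff[OF S(1), of "{k}"] unfolding admissible.simps(3) MS by blast
    moreover have "weight (S # \<tau>) = Poly_Mapping.single k 1 + weight ((S - {k}) # \<tau>)"
      using S kS by (simp add: sum.remove add.assoc)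
    then have "weight ((S - {k}) # \<tau>) = m"
      using adm(2) single_add_cancel[of k "weight ((S - {k}) # \<tau>)" 0 m] \<open>c = 0\<close> by simp
    ultimately show ?thesis using \<open>c = 0\<close> by blast
  qed
qed

lemma admissible_lead:
  assumes k: "\<forall>r\<in>Poly_Mapping.keys (weight \<tau>). k \<le> r" and \<tau>: "admissible q \<tau>"
    and x: "q \<noteq> [] \<Longrightarrow> k \<in> Poly_Mapping.keys (weight \<tau>) \<Longrightarrow> x < hd q"
  shows "admissible (x # q) ({k} # \<tau>)"
proof (cases q)
  case Nil
  then show ?thesis using \<tau> by simp
next
  case (Cons y q')
  then obtain T \<tau>' where T: "\<tau> = T # \<tau>'" "finite T" "T \<noteq> {}" using \<tau> by (cases \<tau>) auto
  then have "Min T \<in> T" by simp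
  then have M: "Min T \<in> Poly_Mapping.keys (weight \<tau>)" unfolding keys_weight[OF \<tau>] by (auto simp: T)
  then have "k \<le> Min T" using k by blast
  moreover have "k < Min T" if "\<not> x < y"
  proof (rule ccontr)
    assume "\<not> k < Min T"
    then have "Min T = k" using \<open>k \<le> Min T\<close> by simp
    then show False using x M that Cons by auto
  qed
  ultimately show ?thesis using \<tau> by (simp add: Cons T)
qed

text \<open>For exponent at least 2 the first set has to be \<open>{k}\<close>, followed by an
  ascent; one letter and one unit of the exponent disappear together.\<close>

lemma L_word_peel_Suc:
  assumes p: "distinct_adj (x # q)" and k: "\<forall>r\<in>Poly_Mapping.keys m. k < r" and c: "0 < c"
  shows "L_word (x # q) (Poly_Mapping.single k (Suc c) + m) =
    (if q \<noteq> [] \<and> x < hd q then L_word q (Poly_Mapping.single k c + m) else 0)"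
proof -
  let ?A = "{\<sigma>. admissible (x # q) \<sigma> \<and> weight \<sigma> = Poly_Mapping.single k (Suc c) + m}"
  let ?B = "{\<sigma>. admissible q \<sigma> \<and> weight \<sigma> = Poly_Mapping.single k c + m}"
  have "?A = (if q \<noteq> [] \<and> x < hd q then (#) {k} ` ?B else {})"
  proof (intro set_eqI)
    fix \<sigma>
    have 1: "\<sigma> \<in> (#) {k} ` ?B \<and> q \<noteq> [] \<and> x < hd q" if A: "\<sigma> \<in> ?A"
    proof -
      obtain S \<tau> where \<sigma>: "\<sigma> = S # \<tau>" using A by (cases \<sigma>) auto
      have adm: "admissible (x # q) (S # \<tau>)" "weight (S # \<tau>) = Poly_Mapping.single k (Suc c) + m"
        using A unfolding \<sigma> by blast+
      note peel = admissible_peel[OF p k adm]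
      have S: "S = {k}" using peel(4) c by blast
      have "admissible q \<tau>" using adm(1) unfolding admissible.simps(3) by blast
      then show ?thesis using peel(2,3)[OF S] c unfolding \<sigma> S by blast
    qed
    have 2: "\<sigma> \<in> ?A" if B: "\<sigma> \<in> (#) {k} ` ?B" "q \<noteq> []" "x < hd q"
    proof -
      obtain \<tau> where \<tau>: "\<sigma> = {k} # \<tau>" "admissible q \<tau>" "weight \<tau> = Poly_Mapping.single k c + m"
        using B(1) by blast
      have "\<forall>r\<in>Poly_Mapping.keys (weight \<tau>). k \<le> r"
        unfolding \<tau>(3) using k keys_add[of "Poly_Mapping.single k c" m]
        by (auto split: if_splits intro: less_imp_le)
      then have "admissible (x # q) ({k} # \<tau>)" by (rule admissible_lead) (use \<tau> B in auto)
      then show ?thesis using \<tau>(1,3) single_add_cancel[of k "weight \<tau>" c m] by simp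
    qed
    show "\<sigma> \<in> ?A \<longleftrightarrow> \<sigma> \<in> (if q \<noteq> [] \<and> x < hd q then (#) {k} ` ?B else {})"
    proof (cases "q \<noteq> [] \<and> x < hd q")
      case True
      show ?thesis unfolding if_P[OF True] using 1 2 True by blast
    next
      case False
      show ?thesis unfolding if_not_P[OF False] using 1 False by blast
    qed
  qed
  then show ?thesis by (simp add: L_word_eq card_image)
qed

text \<open>For exponent 1 the first set is either \<open>{k}\<close>, and its letter goes, or
  \<open>k\<close> with larger variables, and the letter stays. The second case corresponds to a
  shared letter in the product of words.\<close>

lemma L_word_peel_1:
  assumes p: "distinct_adj (x # q)" and k: "\<forall>r\<in>Poly_Mapping.keys m. k < r"
  shows "L_word (x # q) (Poly_Mapping.single k 1 + m) = L_word q m + L_word (x # q) m"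
proof -
  let ?A = "{\<sigma>. admissible (x # q) \<sigma> \<and> weight \<sigma> = Poly_Mapping.single k 1 + m}"
  let ?B = "{\<sigma>. admissible q \<sigma> \<and> weight \<sigma> = m}"
  let ?C = "{\<sigma>. admissible (x # q) \<sigma> \<and> weight \<sigma> = m}"
  define ins where "ins \<sigma> = insert k (hd \<sigma>) # tl \<sigma>" for \<sigma>
  have C: "\<exists>S \<tau>. \<sigma> = S # \<tau> \<and> finite S \<and> S \<noteq> {} \<and> (\<forall>s\<in>S. k < s)" if \<sigma>: "\<sigma> \<in> ?C" for \<sigma>
  proof -
    obtain S \<tau> where S: "\<sigma> = S # \<tau>" using \<sigma> by (cases \<sigma>) auto
    have "S \<subseteq> Poly_Mapping.keys m" using keys_weight[of "x # q" \<sigma>] \<sigma> by (auto simp: S)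
    then show ?thesis using \<sigma> k S by auto
  qed
  have "?A = (#) {k} ` ?B \<union> ins ` ?C"
  proof (intro equalityI subsetI)
    fix \<sigma> assume \<sigma>: "\<sigma> \<in> ?A"
    then obtain S \<tau> where S: "\<sigma> = S # \<tau>" by (cases \<sigma>) auto
    note peel = admissible_peel[OF p k, of S \<tau> 0]
    have adm: "admissible (x # q) (S # \<tau>)" "weight (S # \<tau>) = Poly_Mapping.single k (Suc 0) + m"
      using \<sigma> unfolding S One_nat_def by blast+
    show "\<sigma> \<in> (#) {k} ` ?B \<union> ins ` ?C"
    proof (cases "S = {k}")
      case True
      then have "\<tau> \<in> ?B" using peel(2)[OF adm True] adm(1) by simp
      then show ?thesis by (simp add: S True)
    next
      case False
      then have "(S - {k}) # \<tau> \<in> ?C" using peel(4)[OF adm False] by simp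
      moreover have "\<sigma> = ins ((S - {k}) # \<tau>)" using peel(1)[OF adm] by (auto simp: S ins_def)
      ultimately show ?thesis by blast
    qed
  next
    fix \<sigma> assume "\<sigma> \<in> (#) {k} ` ?B \<union> ins ` ?C"
    then consider \<tau> where "\<sigma> = {k} # \<tau>" "\<tau> \<in> ?B" | \<tau> where "\<sigma> = ins \<tau>" "\<tau> \<in> ?C" by blast
    then show "\<sigma> \<in> ?A"
    proof cases
      case (1 \<tau>)
      have "admissible (x # q) ({k} # \<tau>)"
        by (rule admissible_lead) (use 1 k in \<open>auto intro: less_imp_le\<close>)
      then show ?thesis using 1 by simp
    next
      case (2 \<tau>)
      obtain S \<tau>' where S: "\<tau> = S # \<tau>'" "finite S" "S \<noteq> {}" "\<forall>s\<in>S. k < s" using C[OF 2(2)] by blast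
      have "Max S \<in> S" using S by simp
      then have "k < Max S" using S(4) by blast
      then have "Max (insert k S) = Max S" using S(2,3) by simp
      moreover have "k \<notin> S" using S by auto
      ultimately show ?thesis using 2 S by (simp add: ins_def add.assoc)
    qed
  qed
  moreover have "(#) {k} ` ?B \<inter> ins ` ?C = {}"
    using C by (fastforce simp: ins_def)
  moreover have "inj_on ins ?C"
  proof (rule inj_onI)
    fix \<sigma> \<tau> assume st: "\<sigma> \<in> ?C" "\<tau> \<in> ?C" "ins \<sigma> = ins \<tau>"
    obtain S \<sigma>' where S: "\<sigma> = S # \<sigma>'" "\<forall>s\<in>S. k < s" using C[OF st(1)] by blast
    obtain T \<tau>' where T: "\<tau> = T # \<tau>'" "\<forall>s\<in>T. k < s" using C[OF st(2)] by blast
    have "k \<notin> S" "k \<notin> T" using S T by auto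
    then show "\<sigma> = \<tau>" using st(3) S T by (auto simp: ins_def)
  qed
  ultimately have "card ?A = card ?B + card ?C"
    by (simp add: card_Un_disjoint finite_admissible card_image)
  then show ?thesis by (simp add: L_word_eq)
qed

lemma L_word_Nil: "L_word [] m = of_bool (m = 0)"
proof -
  have "{\<sigma>. admissible [] \<sigma> \<and> weight \<sigma> = m} = (if m = 0 then {[]} else {})" by auto
  then show ?thesis by (simp add: L_word_eq)
qed

lemma L_word_0: "L_word p 0 = of_bool (p = [])"
proof (cases p)
  case Nil
  then show ?thesis by (simp add: L_word_Nil)
next
  case (Cons x q)
  have "\<not> (admissible p \<sigma> \<and> weight \<sigma> = 0)" for \<sigma>
  proof
    assume *: "admissible p \<sigma> \<and> weight \<sigma> = 0"
    then obtain S \<tau> where S: "\<sigma> = S # \<tau>" "S \<noteq> {}" by (cases \<sigma>) (auto simp: Cons)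
    have "\<Union>(set \<sigma>) = {}" using keys_weight[of p \<sigma>] * by simp
    then show False using S by simp
  qed
  then have "{\<sigma>. admissible p \<sigma> \<and> weight \<sigma> = 0} = {}" by blast
  then show ?thesis unfolding L_word_eq by (simp only: card.empty) (simp add: Cons)
qed

text \<open>All units of the exponent but the last consume a letter each, joined by ascents; the
  last unit either consumes its letter or shares a set with larger variables. This is the recursion
  of \<open>lookup_H_Cons\<close>.\<close>

lemma L_word_recursion:
  assumes "distinct_adj p" "\<forall>r\<in>Poly_Mapping.keys m. k < r" "0 < b"
  shows "L_word p (Poly_Mapping.single k b + m) =
    (if b \<le> length p \<and> sorted_wrt (<) (take b p) then L_word (drop b p) m + L_word (drop (b - 1) p) m else 0)"
  using assms
proof (induction b arbitrary: p)
  case (Suc b)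
  show ?case
  proof (cases p)
    case Nil
    have "coeff (Poly_Mapping.single k (Suc b) + m) k \<noteq> 0" by (simp add: lookup_add)
    then have "Poly_Mapping.single k (Suc b) + m \<noteq> 0" by (metis lookup_zero)
    then show ?thesis by (simp add: Nil L_word_Nil)
  next
    case (Cons x q)
    show ?thesis
    proof (cases "b = 0")
      case True
      then show ?thesis using L_word_peel_1[of x q m k] Suc.prems by (simp add: Cons)
    next
      case False
      have q: "distinct_adj q" using Suc.prems(1) Cons by (auto dest: distinct_adj_ConsD)
      have s: "sorted_wrt (<) (take (Suc b) p) \<longleftrightarrow> x < hd q \<and> sorted_wrt (<) (take b q)"
        if bq: "b \<le> length q"
      proof -
        obtain y q' where q': "q = y # q'" using bq False by (cases q) auto
        obtain b' where b': "b = Suc b'" using False by (cases b) auto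
        show ?thesis by (auto simp: Cons q' b')
      qed
      have "L_word p (Poly_Mapping.single k (Suc b) + m) =
        (if q \<noteq> [] \<and> x < hd q then L_word q (Poly_Mapping.single k b + m) else 0)"
        unfolding Cons by (rule L_word_peel_Suc) (use Suc.prems Cons False in auto)
      also have "L_word q (Poly_Mapping.single k b + m) =
        (if b \<le> length q \<and> sorted_wrt (<) (take b q) then L_word (drop b q) m + L_word (drop (b - 1) q) m else 0)"
        by (rule Suc.IH) (use q Suc.prems False in auto)
      finally show ?thesis using s False by (cases b) (auto simp: Cons)
    qed
  qed
qed simp

section \<open>Monomials and lists of exponents\<close>

text \<open>The monomial with exponents \<open>c\<close> in the variables \<open>ks\<close>. Unlike
  in \<open>exponents\<close>, zeros are kept, so that both parts of a splitting can be written over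
  the same variables.\<close>

definition mon :: "nat list \<Rightarrow> nat list \<Rightarrow> monom" where
  "mon ks c = sum_list (map2 Poly_Mapping.single ks c)"

lemma mon_simps [simp]:
  "mon ks [] = 0" "mon [] c = 0"
  "mon (k # ks) (x # c) = Poly_Mapping.single k x + mon ks c"
  by (simp_all add: mon_def)

lemma keys_mon: "Poly_Mapping.keys (mon ks c) \<subseteq> set ks"
proof (induction ks arbitrary: c)
  case (Cons k ks)
  show ?case
  proof (cases c)
    case (Cons x c')
    then show ?thesis
      using keys_add[of "Poly_Mapping.single k x" "mon ks c'"] Cons.IH[of c'] by (auto split: if_splits)
  qed simp
qed simp

text \<open>Both sides satisfy the same recursion in the first entry of \<open>c\<close>; a zero
  entry contributes the unit on one side and no variable on the other.\<close>

lemma lookup_H_eq_L_word: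
  assumes "distinct_adj p" "sorted_wrt (<) ks" "length ks = length c"
  shows "L_word p (mon ks c) = coeff (H c) (word_comp p)"
  using assms
proof (induction c arbitrary: p ks)
  case Nil
  then show ?case by (simp add: L_word_0 MMR_unit_def)
next
  case (Cons b c)
  obtain k ks' where ks: "ks = k # ks'" using Cons.prems by (cases ks) auto
  have IH: "L_word (drop i p) (mon ks' c) = coeff (H c) (word_comp (drop i p))" for i
    using Cons.prems by (intro Cons.IH) (auto simp: ks distinct_adj_drop)
  show ?case
  proof (cases "b = 0")
    case True
    then show ?thesis using IH[of 0] H_Cons_0[of c] unfolding ks mon_simps True by simp
  next
    case False
    then have b: "0 < b" by simp
    have "\<forall>r\<in>Poly_Mapping.keys (mon ks' c). k < r"
      using Cons.prems(2) keys_mon[of ks' c] by (auto simp: ks)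
    then show ?thesis
      using L_word_recursion[OF Cons.prems(1), of "mon ks' c" k b]
      unfolding lookup_H_Cons[OF Cons.prems(1), OF b] ks mon_simps IH
      using b by simp
  qed
qed

lemma exponents_0 [simp]: "exponents 0 = []"
  by (simp add: exponents_def)

lemma exponents_single_add:
  assumes "\<forall>r\<in>Poly_Mapping.keys m. k < r" "0 < x"
  shows "exponents (Poly_Mapping.single k x + m) = x # exponents m"
proof -
  have keys: "Poly_Mapping.keys (Poly_Mapping.single k x + m) = insert k (Poly_Mapping.keys m)"
    using assms by (auto simp: in_keys_iff lookup_add lookup_single when_def split: if_splits)
  have "sorted_list_of_set (insert k (Poly_Mapping.keys m)) = k # sorted_list_of_set (Poly_Mapping.keys m)"
    using assms(1) by (intro sorted_distinct_set_unique)
      (auto intro: less_imp_le simp del: sorted_list_of_set_insert_remove)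
  moreover have "k \<notin> Poly_Mapping.keys m" using assms(1) by auto
  ultimately show ?thesis
    unfolding exponents_def keys using assms(1)
    by (auto simp: lookup_add lookup_single when_def in_keys_iff)
qed

lemma exponents_mon:
  assumes "sorted_wrt (<) ks" "length ks = length c"
  shows "exponents (mon ks c) = filter (\<lambda>x. x \<noteq> 0) c"
  using assms
proof (induction c arbitrary: ks)
  case (Cons x c)
  obtain k ks' where ks: "ks = k # ks'" using Cons.prems by (cases ks) auto
  have "\<forall>r\<in>Poly_Mapping.keys (mon ks' c). k < r"
    using Cons.prems(1) keys_mon[of ks' c] by (auto simp: ks)
  then show ?case
    using Cons exponents_single_add[of "mon ks' c" k x] by (cases "x = 0") (auto simp: ks)
qed simp

lemma lookup_mon_map:
  assumes "distinct ks"
  shows "coeff (mon ks (map f ks)) r = (if r \<in> set ks then f r else 0)"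
  using assms
  by (induction ks) (auto simp: lookup_add lookup_single when_def)

lemma mon_lookup:
  assumes "distinct ks" "Poly_Mapping.keys m \<subseteq> set ks"
  shows "mon ks (map (coeff m) ks) = m"
  using assms by (intro poly_mapping_eqI) (auto simp: lookup_mon_map in_keys_iff)

lemma lookup_mon:
  assumes "distinct ks" "length ks = length c"
  shows "map (coeff (mon ks c)) ks = c"
  using assms
proof (induction c arbitrary: ks)
  case (Cons x c)
  obtain k ks' where ks: "ks = k # ks'" using Cons.prems by (cases ks) auto
  have "k \<notin> Poly_Mapping.keys (mon ks' c)" using keys_mon[of ks' c] Cons.prems(1) by (auto simp: ks)
  then have "coeff (mon ks' c) k = 0" by (simp add: in_keys_iff)
  have "map (coeff (mon (k # ks') (x # c))) ks' = map (coeff (mon ks' c)) ks'"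
    using Cons.prems(1) by (auto simp: ks lookup_add lookup_single when_def)
  also have "\<dots> = c" using Cons by (simp add: ks)
  finally have "map (coeff (mon (k # ks') (x # c))) ks' = c" .
  with \<open>coeff (mon ks' c) k = 0\<close> show ?case
    unfolding ks list.map by (simp add: lookup_add)
qed simp

lemma mon_exponents: "mon (sorted_list_of_set (Poly_Mapping.keys m)) (exponents m) = m"
  unfolding exponents_def by (rule mon_lookup) auto

lemma monomial_of_eq: "monomial_of c = mon [0..<length c] c"
proof -
  have "map2 Poly_Mapping.single [0..<length c] c = map (\<lambda>i. Poly_Mapping.single i (c ! i)) [0..<length c]"
    by (intro nth_equalityI) auto
  then show ?thesis by (simp add: monomial_of_def mon_def sum_list_distinct_conv_sum_set atLeast0LessThan)
qed

lemma exponents_compositions: "exponents m \<in> compositions"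
  by (auto simp: compositions_def exponents_def in_keys_iff)

lemma exponents_monomial_of: "exponents (monomial_of c) = filter (\<lambda>x. x \<noteq> 0) c"
  unfolding monomial_of_eq by (rule exponents_mon) auto

lemma exponents_monomial_of_composition [simp]: "c \<in> compositions \<Longrightarrow> exponents (monomial_of c) = c"
  unfolding exponents_monomial_of by (rule filter_True) (auto simp: compositions_def intro: gr0I)

lemma L_word_exponents:
  assumes "distinct_adj p"
  shows "L_word p m = coeff (H (exponents m)) (word_comp p)"
  using lookup_H_eq_L_word[OF assms, of "sorted_list_of_set (Poly_Mapping.keys m)" "exponents m"]
  unfolding mon_exponents by (simp add: exponents_def)

lemma Ltilde_eq:
  assumes "\<alpha> \<in> compositions"
  shows "Ltilde \<alpha> m = coeff (H (exponents m)) (rep \<alpha>)"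
  unfolding Ltilde_def rep_def rep_word_def[symmetric] by (rule L_word_exponents[OF rep_word(1)[OF assms]])

text \<open>A factor of a monomial involves only variables of the monomial, so factorizations are
  entrywise splittings of the exponents.\<close>

lemma sum_mon_splits:
  assumes "sorted_wrt (<) ks" "length ks = length c"
  shows "(\<Sum>(a, b)\<in>{(a, b). a + b = mon ks c}. f (a, b)) =
    (\<Sum>ab\<in>list_splits c. f (mon ks (fst ab), mon ks (snd ab)))"
    and "finite {(a, b). a + b = mon ks c}"
proof -
  have d: "distinct ks" using assms(1) by (simp add: strict_sorted_iff)
  define i where "i ab = (mon ks (fst ab), mon ks (snd ab))" for ab
  define j where "j ab = (map (coeff (fst ab)) ks, map (coeff (snd ab)) ks)"
    for ab :: "monom \<times> monom"
  have 1: "j ab \<in> list_splits c" "i (j ab) = ab" if ab: "ab \<in> {(a, b). a + b = mon ks c}" for ab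
  proof -
    obtain a b where ab': "ab = (a, b)" "a + b = mon ks c" using ab by auto
    have "Poly_Mapping.keys a \<subseteq> Poly_Mapping.keys (a + b)" "Poly_Mapping.keys b \<subseteq> Poly_Mapping.keys (a + b)"
      by (auto simp: in_keys_iff lookup_add)
    then have k: "Poly_Mapping.keys a \<subseteq> set ks" "Poly_Mapping.keys b \<subseteq> set ks"
      using keys_mon[of ks c] unfolding ab'(2) by auto
    then show "i (j ab) = ab" by (simp add: i_def j_def ab' mon_lookup d)
    have "coeff a (ks ! l) + coeff b (ks ! l) = c ! l" if "l < length c" for l
    proof -
      have "coeff (a + b) (ks ! l) = map (coeff (mon ks c)) ks ! l"
        using that assms(2) by (simp add: ab'(2))
      then show ?thesis unfolding lookup_mon[OF d assms(2)] lookup_add .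
    qed
    then show "j ab \<in> list_splits c" using assms(2) by (simp add: j_def ab' list_splits_iff)
  qed
  have 2: "i ab \<in> {(a, b). a + b = mon ks c}" "j (i ab) = ab" if ab: "ab \<in> list_splits c" for ab
  proof -
    obtain a b where ab': "ab = (a, b)" by fastforce
    have len: "length ks = length a" "length ks = length b" using ab assms(2) by (auto simp: ab' list_splits_iff)
    show "j (i ab) = ab" using len by (simp add: ab' i_def j_def lookup_mon d)
    have "mon ks a + mon ks b = mon ks c"
      using ab[unfolded ab'] assms(2)
    proof (induction c arbitrary: ks a b)
      case (Cons x c)
      then obtain k ks' where "ks = k # ks'" by (cases ks) auto
      with Cons.prems obtain i a' b' where ab: "a = i # a'" "b = (x - i) # b'" "i \<le> x"
        "(a', b') \<in> list_splits c" "length ks' = length c" by auto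
      have "Poly_Mapping.single k i + Poly_Mapping.single k (x - i) = Poly_Mapping.single k x"
        using ab(3) by (simp flip: single_add)
      then show ?case
        using Cons.IH[OF ab(4,5)] unfolding ab(1,2) \<open>ks = k # ks'\<close> mon_simps
        by (metis add.assoc add.left_commute)
    qed simp
    then show "i ab \<in> {(a, b). a + b = mon ks c}" by (simp add: i_def ab')
  qed
  have "(\<Sum>ab\<in>{(a, b). a + b = mon ks c}. f ab) = (\<Sum>ab\<in>list_splits c. f (i ab))"
    by (rule sum.reindex_bij_witness[where i = i and j = j]) (use 1 2 in auto)
  then show "(\<Sum>(a, b)\<in>{(a, b). a + b = mon ks c}. f (a, b)) =
    (\<Sum>ab\<in>list_splits c. f (mon ks (fst ab), mon ks (snd ab)))"
    by (simp add: i_def)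
  have "{(a, b). a + b = mon ks c} \<subseteq> i ` list_splits c"
  proof
    fix ab assume "ab \<in> {(a, b). a + b = mon ks c}"
    from 1[OF this] show "ab \<in> i ` list_splits c" by (metis image_eqI)
  qed
  then show "finite {(a, b). a + b = mon ks c}" by (rule finite_subset) simp
qed

section \<open>Infinite linear combinations\<close>

lemma inf_comb_in_inf_span [simp]: "inf_comb I v c \<in> inf_span I v"
  by (simp add: inf_span_def)

lemma inf_comb_delta:
  assumes "infinite_basis I v" "t \<in> I"
  shows "inf_comb I v (\<lambda>s. if s = t then 1 else 0) = v t"
proof
  fix m
  have "finite {s \<in> I. v s m \<noteq> 0}" using assms by (simp add: infinite_basis_def)
  then show "inf_comb I v (\<lambda>s. if s = t then 1 else 0) m = v t m"
    using assms(2) unfolding inf_comb_def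
    by (simp add: if_distrib[of "\<lambda>x. x * _"] cong: if_cong)
qed

text \<open>A choice of coefficients; for an \<open>infinite_basis\<close> it is unique on
  \<open>I\<close>, by \<open>coef_inf_comb\<close>.\<close>

definition coef :: "'s set \<Rightarrow> ('s \<Rightarrow> 'm \<Rightarrow> int) \<Rightarrow> ('m \<Rightarrow> int) \<Rightarrow> 's \<Rightarrow> int" where
  "coef I v g = (SOME c. inf_comb I v c = g)"

lemma inf_comb_coef: "g \<in> inf_span I v \<Longrightarrow> inf_comb I v (coef I v g) = g"
  unfolding coef_def by (rule someI_ex[of "\<lambda>c. inf_comb I v c = g"]) (auto simp: inf_span_def)

lemma coef_inf_comb:
  assumes "infinite_basis I v" "s \<in> I"
  shows "coef I v (inf_comb I v c) s = c s"
  using assms inf_comb_coef[OF inf_comb_in_inf_span, of I v c] unfolding infinite_basis_def by metis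

lemma continuous_functionalI:
  assumes "finite A" "A \<subseteq> I" "\<And>s. s \<in> I - A \<Longrightarrow> \<phi> (v s) = 0"
    "\<And>c. \<phi> (inf_comb I v c) = (\<Sum>s\<in>A. c s * \<phi> (v s))"
  shows "continuous_functional I v \<phi>"
proof -
  have sub: "{s \<in> I. \<phi> (v s) \<noteq> 0} \<subseteq> A" using assms(3) by auto
  then have "(\<Sum>s\<in>A. c s * \<phi> (v s)) = (\<Sum>s\<in>{s \<in> I. \<phi> (v s) \<noteq> 0}. c s * \<phi> (v s))" for c
    using assms(1,2) by (intro sum.mono_neutral_right) auto
  then show ?thesis
    unfolding continuous_functional_def using assms(4) finite_subset[OF sub assms(1)] by auto
qed

lemma continuous_functional_eval:
  assumes "infinite_basis I v"
  shows "continuous_functional I v (\<lambda>g. g m)"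
  by (rule continuous_functionalI[of "{s \<in> I. v s m \<noteq> 0}"])
    (use assms in \<open>auto simp: infinite_basis_def inf_comb_def\<close>)

lemma continuous_functional_add:
  assumes "continuous_functional I v \<phi>" "continuous_functional I v \<psi>"
  shows "continuous_functional I v (\<lambda>g. \<phi> g + \<psi> g)"
proof (rule continuous_functionalI)
  let ?A = "{s \<in> I. \<phi> (v s) \<noteq> 0}" and ?B = "{s \<in> I. \<psi> (v s) \<noteq> 0}"
  have fin: "finite ?A" "finite ?B" using assms by (auto simp: continuous_functional_def)
  then show "finite (?A \<union> ?B)" by simp
  show "\<phi> (inf_comb I v c) + \<psi> (inf_comb I v c) = (\<Sum>s\<in>?A \<union> ?B. c s * (\<phi> (v s) + \<psi> (v s)))" for c
  proof -
    have "\<phi> (inf_comb I v c) = (\<Sum>s\<in>?A \<union> ?B. c s * \<phi> (v s))"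
      using assms(1) fin unfolding continuous_functional_def by (auto intro!: sum.mono_neutral_left)
    moreover have "\<psi> (inf_comb I v c) = (\<Sum>s\<in>?A \<union> ?B. c s * \<psi> (v s))"
      using assms(2) fin unfolding continuous_functional_def by (auto intro!: sum.mono_neutral_left)
    ultimately show ?thesis by (simp add: distrib_left sum.distrib)
  qed
qed auto

lemma continuous_functional_sum:
  assumes "finite F" "\<And>i. i \<in> F \<Longrightarrow> continuous_functional I v (\<phi> i)"
  shows "continuous_functional I v (\<lambda>g. \<Sum>i\<in>F. \<phi> i g)"
  using assms
proof (induction F rule: finite_induct)
  case empty
  then show ?case by (simp add: continuous_functional_def)
next
  case (insert x F)
  then show ?case using continuous_functional_add[of I v "\<phi> x"] by simp
qed

text \<open>At each pair of coordinates the nonzero terms form a product of two finite sets, so a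
  double combination may be evaluated one variable at a time, in either order.\<close>

lemma inf_comb_tensf_family:
  assumes "infinite_basis I v"
  shows "inf_comb (I \<times> I) (tensf_family v) c (a, b) =
    inf_comb I v (\<lambda>s. inf_comb I v (\<lambda>t. c (s, t)) b) a"
    "inf_comb (I \<times> I) (tensf_family v) c (a, b) =
    inf_comb I v (\<lambda>t. inf_comb I v (\<lambda>s. c (s, t)) a) b"
proof -
  define A where "A m = {s \<in> I. v s m \<noteq> 0}" for m
  have fin: "finite (A m)" for m using assms by (simp add: A_def infinite_basis_def)
  have "{st \<in> I \<times> I. tensf_family v st (a, b) \<noteq> 0} = A a \<times> A b"
    by (auto simp: A_def tensf_family_def tensf_def)
  then have *: "inf_comb (I \<times> I) (tensf_family v) c (a, b) = (\<Sum>(s, t)\<in>A a \<times> A b. c (s, t) * (v s a * v t b))"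
    by (simp add: inf_comb_def tensf_family_def tensf_def case_prod_unfold)
  show "inf_comb (I \<times> I) (tensf_family v) c (a, b) =
    inf_comb I v (\<lambda>s. inf_comb I v (\<lambda>t. c (s, t)) b) a"
    unfolding * sum.cartesian_product[symmetric]
    by (simp add: inf_comb_def A_def sum_distrib_right sum_distrib_left mult_ac)
  show "inf_comb (I \<times> I) (tensf_family v) c (a, b) =
    inf_comb I v (\<lambda>t. inf_comb I v (\<lambda>s. c (s, t)) a) b"
    unfolding * sum.cartesian_product[symmetric]
    by (subst sum.swap) (simp add: inf_comb_def A_def sum_distrib_right sum_distrib_left mult_ac)
qed

text \<open>Uniqueness of coefficients is applied in the first variable with \<open>b\<close> fixed,
  and then to the resulting coefficients as functions of \<open>b\<close>.\<close>

lemma infinite_basis_tensf_family: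
  fixes v :: "'s \<Rightarrow> 'm \<Rightarrow> int"
  assumes "infinite_basis I v"
  shows "infinite_basis (I \<times> I) (tensf_family v)"
  unfolding infinite_basis_def
proof (intro conjI allI impI)
  fix m :: "'m \<times> 'm"
  obtain a b where m: "m = (a, b)" by fastforce
  have "{st \<in> I \<times> I. tensf_family v st m \<noteq> 0} = {s \<in> I. v s a \<noteq> 0} \<times> {s \<in> I. v s b \<noteq> 0}"
    by (auto simp: m tensf_family_def tensf_def)
  then show "finite {st \<in> I \<times> I. tensf_family v st m \<noteq> 0}"
    using assms by (simp add: infinite_basis_def)
next
  fix c d assume cd: "inf_comb (I \<times> I) (tensf_family v) c = inf_comb (I \<times> I) (tensf_family v) d"
  have uniq: "c s = d s" if "inf_comb I v c = inf_comb I v d" "s \<in> I" for c d s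
    using assms that unfolding infinite_basis_def by blast
  have "inf_comb I v (\<lambda>s. inf_comb I v (\<lambda>t. c (s, t)) b) = inf_comb I v (\<lambda>s. inf_comb I v (\<lambda>t. d (s, t)) b)" for b
    using cd by (intro ext) (simp flip: inf_comb_tensf_family(1)[OF assms])
  then have "inf_comb I v (\<lambda>t. c (s, t)) b = inf_comb I v (\<lambda>t. d (s, t)) b" if "s \<in> I" for s b
    using uniq[OF _ that] by blast
  then have "inf_comb I v (\<lambda>t. c (s, t)) = inf_comb I v (\<lambda>t. d (s, t))" if "s \<in> I" for s
    using that by (intro ext)
  then have "c (s, t) = d (s, t)" if "s \<in> I" "t \<in> I" for s t
    using uniq[OF _ that(2)] that(1) by blast
  then show "\<forall>st\<in>I \<times> I. c st = d st" by auto
qed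

section \<open>Duality of bases\<close>

text \<open>The keys \<open>rep t\<close> form a dual system to the \<open>f s\<close> inside the
  free group itself, so coordinates in the span are ordinary coefficients. The same pattern then
  applies to tensor squares.\<close>

locale dual_bases =
  fixes I :: "'s set" and v :: "'s \<Rightarrow> 'm \<Rightarrow> int" and f :: "'s \<Rightarrow> 'a \<Rightarrow>\<^sub>0 int" and rep :: "'s \<Rightarrow> 'a"
  assumes basis: "infinite_basis I v"
    and dual: "s \<in> I \<Longrightarrow> t \<in> I \<Longrightarrow> coeff (f s) (rep t) = (if s = t then 1 else 0)"
begin

definition support :: "('a \<Rightarrow>\<^sub>0 int) \<Rightarrow> 's set" where
  "support x = {s \<in> I. coeff x (rep s) \<noteq> 0}"

text \<open>Only coefficients at the keys \<open>rep s\<close> enter, and these have finite support;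
  hence the pairing is a finite sum on the whole free group.\<close>

definition B :: "('a \<Rightarrow>\<^sub>0 int) \<Rightarrow> ('m \<Rightarrow> int) \<Rightarrow> int" where
  "B x g = (\<Sum>s\<in>support x. coeff x (rep s) * coef I v g s)"

lemma finite_support: "finite (support x)"
proof (rule finite_imageD)
  have "rep ` support x \<subseteq> Poly_Mapping.keys x" by (auto simp: support_def in_keys_iff)
  then show "finite (rep ` support x)" by (rule finite_subset) simp
  show "inj_on rep (support x)"
  proof (rule inj_onI)
    fix s t assume "s \<in> support x" "t \<in> support x" "rep s = rep t"
    then show "s = t" using dual[of s s] dual[of s t] by (auto simp: support_def split: if_splits)
  qed
qed

lemma B_eq:
  assumes "finite A" "A \<subseteq> I" "support x \<subseteq> A"
  shows "B x g = (\<Sum>s\<in>A. coeff x (rep s) * coef I v g s)"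
  unfolding B_def using assms by (intro sum.mono_neutral_left) (auto simp: support_def)

lemma support_I: "support x \<subseteq> I"
  by (auto simp: support_def)

lemma B_add: "B (x + y) g = B x g + B y g"
proof -
  let ?A = "support x \<union> support y"
  have "support (x + y) \<subseteq> ?A" by (auto simp: support_def lookup_add)
  then show ?thesis
    using support_I finite_support
    by (simp add: B_eq[of ?A] lookup_add distrib_right sum.distrib)
qed

lemma B_scale: "B (frag_cmul c x) g = c * B x g"
proof -
  have "support (frag_cmul c x) \<subseteq> support x" by (auto simp: support_def)
  then show ?thesis
    using support_I finite_support
    by (simp add: B_eq[of "support x"] sum_distrib_left mult.assoc)
qed

lemma B_zero: "B 0 g = 0"
  by (simp add: B_def support_def)

lemma B_sum: "B (\<Sum>i\<in>S. h i) g = (\<Sum>i\<in>S. B (h i) g)"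
  by (induction S rule: infinite_finite_induct) (simp_all add: B_zero B_add)

lemma B_basis:
  assumes "s \<in> I"
  shows "B (f s) g = coef I v g s"
  using assms dual by (subst B_eq[of "{s}"]) (auto simp: support_def split: if_splits)

lemma B_inf_comb: "B x (inf_comb I v c) = (\<Sum>s\<in>support x. coeff x (rep s) * c s)"
  unfolding B_def by (intro sum.cong refl) (simp add: support_def coef_inf_comb[OF basis])

lemma B_v:
  assumes "t \<in> I"
  shows "B x (v t) = coeff x (rep t)"
proof -
  have "B x (v t) = (\<Sum>s\<in>support x. if s = t then coeff x (rep t) else 0)"
    unfolding inf_comb_delta[OF basis assms, symmetric] B_inf_comb by (intro sum.cong refl) auto
  then show ?thesis using finite_support[of x] assms by (auto simp: support_def)
qed

lemma continuous_B: "continuous_functional I v (B x)"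
proof (rule continuous_functionalI[OF finite_support[of x] support_I])
  show "B x (inf_comb I v c) = (\<Sum>s\<in>support x. c s * B x (v s))" for c
    unfolding B_inf_comb by (intro sum.cong refl) (simp add: B_v support_def)
qed (simp add: B_v support_def)

text \<open>Identifies the elements that act as evaluation at a coordinate \<open>m\<close>: their
  coordinates are the values of the \<open>v s\<close> at \<open>m\<close>.\<close>

lemma B_eval:
  assumes "\<And>s. s \<in> I \<Longrightarrow> coeff x (rep s) = v s m" "g \<in> inf_span I v"
  shows "B x g = g m"
proof -
  have "support x = {s \<in> I. v s m \<noteq> 0}" using assms(1) by (auto simp: support_def)
  then have "B x g = inf_comb I v (coef I v g) m"
    unfolding B_def inf_comb_def by (auto simp: assms(1) mult.commute intro!: sum.cong)
  then show ?thesis by (simp add: inf_comb_coef[OF assms(2)])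
qed

lemma span_expansion:
  assumes "x \<in> frag.span (f ` I)"
  shows "x = (\<Sum>s\<in>support x. frag_cmul (coeff x (rep s)) (f s))"
proof -
  define E where "E x = (\<Sum>s\<in>support x. frag_cmul (coeff x (rep s)) (f s))" for x
  have E_eq: "E x = (\<Sum>s\<in>A. frag_cmul (coeff x (rep s)) (f s))"
    if "finite A" "A \<subseteq> I" "support x \<subseteq> A" for A x
    unfolding E_def using that by (intro sum.mono_neutral_left) (auto simp: support_def)
  have "E x = x"
    using assms
  proof (induction rule: frag.span_induct_alt)
    case base
    then show ?case by (simp add: E_def support_def)
  next
    case (step c y z)
    then obtain s where s: "s \<in> I" "y = f s" by blast
    let ?A = "insert s (support z)"
    have A: "finite ?A" "?A \<subseteq> I" "support z \<subseteq> ?A" using s finite_support support_I by auto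
    have sy: "support y \<subseteq> ?A" using s dual by (auto simp: support_def split: if_splits)
    have "support (frag_cmul c y + z) \<subseteq> support y \<union> support z"
      by (auto simp: support_def lookup_add)
    then have syz: "support (frag_cmul c y + z) \<subseteq> ?A" using sy A(3) by blast
    have "E (frag_cmul c y + z) = frag_cmul c (E y) + E z"
      unfolding E_eq[OF A(1,2) syz] E_eq[OF A(1,2) sy] E_eq[OF A]
      by (simp only: lookup_add lookup_frag_cmul frag_cmul_distrib sum.distrib frag_cmul_sum frag_cmul_cmul)
    moreover have "E y = y"
      using s dual by (subst E_eq[of "{s}"]) (auto simp: support_def split: if_splits)
    ultimately show ?case using step by simp
  qed
  then show ?thesis by (simp add: E_def)
qed

theorem continuous_duals_via_B: "continuous_duals_via I v f B"
proof -
  have v_span: "v t \<in> inf_span I v" if "t \<in> I" for t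
    by (subst inf_comb_delta[OF basis that, symmetric]) simp
  have "bij_betw (\<lambda>x. restrict (B x) (inf_span I v)) (frag.span (f ` I)) (continuous_dual I v)"
    unfolding bij_betw_def
  proof (intro conjI inj_onI equalityI subsetI)
    fix x y assume xy: "x \<in> frag.span (f ` I)" "y \<in> frag.span (f ` I)"
      "restrict (B x) (inf_span I v) = restrict (B y) (inf_span I v)"
    have "coeff x (rep t) = coeff y (rep t)" if "t \<in> I" for t
      using fun_cong[OF xy(3), of "v t"] v_span[OF that] by (simp add: B_v[OF that])
    then have "support x = support y" and
      "(\<Sum>s\<in>support y. frag_cmul (coeff x (rep s)) (f s)) =
       (\<Sum>s\<in>support y. frag_cmul (coeff y (rep s)) (f s))"
      using support_I by (auto simp: support_def intro!: sum.cong)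
    then show "x = y" using span_expansion[OF xy(1)] span_expansion[OF xy(2)] by simp
  next
    fix \<phi> assume "\<phi> \<in> (\<lambda>x. restrict (B x) (inf_span I v)) ` frag.span (f ` I)"
    then obtain x where x: "\<phi> = restrict (B x) (inf_span I v)" by blast
    have eq: "\<phi> (v s) = B x (v s)" if "s \<in> I" for s using v_span[OF that] by (simp add: x)
    then have S: "{s \<in> I. \<phi> (v s) \<noteq> 0} = {s \<in> I. B x (v s) \<noteq> 0}" by auto
    have "continuous_functional I v \<phi>"
      using continuous_B[of x] eq unfolding continuous_functional_def S
      by (auto simp: x intro!: sum.cong)
    then show "\<phi> \<in> continuous_dual I v" by (simp add: continuous_dual_def x)
  next
    fix \<phi> assume \<phi>: "\<phi> \<in> continuous_dual I v"
    let ?S = "{s \<in> I. \<phi> (v s) \<noteq> 0}"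
    \<comment> \<open>A continuous functional has finitely many nonzero values on the
      \<open>v s\<close>; these serve as the coordinates of the element that represents it.\<close>
    define x where "x = (\<Sum>s\<in>?S. frag_cmul (\<phi> (v s)) (f s))"
    have x: "x \<in> frag.span (f ` I)"
      unfolding x_def by (intro frag.span_sum frag.span_scale frag.span_base) auto
    have "\<phi> = restrict (B x) (inf_span I v)"
    proof (rule extensionalityI[of _ "inf_span I v"])
      show "\<phi> \<in> extensional (inf_span I v)" using \<phi> by (simp add: continuous_dual_def)
      fix g assume "g \<in> inf_span I v"
      then obtain c where g: "g = inf_comb I v c" by (auto simp: inf_span_def)
      have "B x g = (\<Sum>s\<in>?S. \<phi> (v s) * coef I v g s)"
        unfolding x_def B_sum B_scale by (intro sum.cong refl) (simp add: B_basis)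
      also have "\<dots> = (\<Sum>s\<in>?S. c s * \<phi> (v s))"
        by (intro sum.cong refl) (simp add: g coef_inf_comb[OF basis])
      also have "\<dots> = \<phi> g"
        using \<phi> by (simp add: g continuous_dual_def continuous_functional_def)
      finally show "\<phi> g = restrict (B x) (inf_span I v) g" by (simp add: g)
    qed simp
    then show "\<phi> \<in> (\<lambda>x. restrict (B x) (inf_span I v)) ` frag.span (f ` I)" using x by blast
  qed
  then show ?thesis
    unfolding continuous_duals_via_def using basis B_add dual by (auto simp: B_v)
qed

end

lemma dual_bases_tens:
  assumes "dual_bases I v f r"
  shows "dual_bases (I \<times> I) (tensf_family v) (\<lambda>(s, t). tens (f s) (f t)) (map_prod r r)"
proof
  interpret dual_bases I v f r by (rule assms)
  show "infinite_basis (I \<times> I) (tensf_family v)" by (rule infinite_basis_tensf_family[OF basis])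
  show "coeff ((\<lambda>(s, t). tens (f s) (f t)) st) (map_prod r r st') = (if st = st' then 1 else 0)"
    if "st \<in> I \<times> I" "st' \<in> I \<times> I" for st st'
    using that by (auto simp: dual split: if_splits)
qed

text \<open>Kept apart from \<open>dual_bases\<close> so that the passage to the tensor square
  happens once and is not iterated.\<close>

locale dual_bases_pair = dual_bases
begin

sublocale pair: dual_bases "I \<times> I" "tensf_family v" "\<lambda>(s, t). tens (f s) (f t)" "map_prod rep rep"
  using dual_bases_tens[OF dual_bases_axioms] .

lemma support_tens: "pair.support (tens x y) = support x \<times> support y"
  by (auto simp: pair.support_def support_def)

lemma pair_B_tens_inf_comb:
  "pair.B (tens x y) (inf_comb (I \<times> I) (tensf_family v) c) =
    (\<Sum>s\<in>support x. \<Sum>t\<in>support y. coeff x (rep s) * coeff y (rep t) * c (s, t))"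
  unfolding pair.B_inf_comb support_tens by (simp add: sum.cartesian_product case_prod_unfold map_prod_def)

lemma pair_B_tensf:
  assumes "g \<in> inf_span I v" "h \<in> inf_span I v"
  shows "pair.B (tens x y) (tensf g h) = B x g * B y h"
proof -
  obtain c d where gh: "g = inf_comb I v c" "h = inf_comb I v d" using assms by (auto simp: inf_span_def)
  have *: "inf_comb I v (\<lambda>t. k * d t) b = k * inf_comb I v d b"
    "inf_comb I v (\<lambda>s. c s * k) a = inf_comb I v c a * k" for k a b
    unfolding inf_comb_def sum_distrib_left sum_distrib_right by (intro sum.cong refl; simp)+
  have "inf_comb (I \<times> I) (tensf_family v) (\<lambda>(s, t). c s * d t) (a, b) = tensf g h (a, b)" for a b
    unfolding inf_comb_tensf_family(1)[OF basis] by (simp only: * gh tensf_def case_prod_conv)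
  then have "tensf g h = inf_comb (I \<times> I) (tensf_family v) (\<lambda>(s, t). c s * d t)"
    by (intro ext) (simp add: split_paired_all)
  then show ?thesis
    by (simp add: pair_B_tens_inf_comb gh B_inf_comb sum_product mult_ac)
qed

text \<open>If one tensor factor acts as evaluation at \<open>m\<close>, then the other is paired
  with the slice of \<open>z\<close> at \<open>m\<close>; this is how \<open>map_left\<close> and
  \<open>map_right\<close> meet the pairing.\<close>

lemma pair_B_slice:
  assumes z: "z \<in> inf_span (I \<times> I) (tensf_family v)" and y: "\<And>s. s \<in> I \<Longrightarrow> coeff y (rep s) = v s m"
  shows "pair.B (tens x y) z = B x (\<lambda>a. z (a, m))" "pair.B (tens y x) z = B x (\<lambda>b. z (m, b))"
proof -
  obtain c where c: "z = inf_comb (I \<times> I) (tensf_family v) c" using z by (auto simp: inf_span_def)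
  have S: "support y = {s \<in> I. v s m \<noteq> 0}" using y by (auto simp: support_def)
  have I: "inf_comb I v d m = (\<Sum>t\<in>support y. coeff y (rep t) * d t)" for d
    unfolding inf_comb_def S by (intro sum.cong refl) (simp add: y)
  have "(\<lambda>a. z (a, m)) = inf_comb I v (\<lambda>s. inf_comb I v (\<lambda>t. c (s, t)) m)"
    unfolding c by (intro ext inf_comb_tensf_family(1)[OF basis])
  then show "pair.B (tens x y) z = B x (\<lambda>a. z (a, m))"
    by (simp add: B_inf_comb c pair_B_tens_inf_comb I sum_distrib_left mult.assoc)
  have "(\<lambda>b. z (m, b)) = inf_comb I v (\<lambda>t. inf_comb I v (\<lambda>s. c (s, t)) m)"
    unfolding c by (intro ext inf_comb_tensf_family(2)[OF basis])
  then show "pair.B (tens y x) z = B x (\<lambda>b. z (m, b))"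
    by (simp add: B_inf_comb c pair_B_tens_inf_comb I sum_distrib_left mult.assoc)
      (subst sum.swap, simp add: mult_ac)
qed

end

section \<open>The complete Hopf algebra \<mm>QSym\<close>

definition quasisym :: "series \<Rightarrow> bool" where
  "quasisym f \<longleftrightarrow> (\<forall>m m'. exponents m = exponents m' \<longrightarrow> f m = f m')"

definition quasisym2 :: "(monom \<times> monom \<Rightarrow> int) \<Rightarrow> bool" where
  "quasisym2 h \<longleftrightarrow> (\<forall>a a' b b'. exponents a = exponents a' \<longrightarrow> exponents b = exponents b' \<longrightarrow> h (a, b) = h (a', b'))"

lemma quasisymD: "quasisym f \<Longrightarrow> exponents m = exponents m' \<Longrightarrow> f m = f m'"
  unfolding quasisym_def by blast

lemma quasisym2D:
  "quasisym2 h \<Longrightarrow> exponents a = exponents a' \<Longrightarrow> exponents b = exponents b' \<Longrightarrow> h (a, b) = h (a', b')"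
  unfolding quasisym2_def by blast

lemma finite_Ltilde: "finite {\<alpha> \<in> compositions. Ltilde \<alpha> m \<noteq> 0}"
proof -
  have "{\<alpha> \<in> compositions. Ltilde \<alpha> m \<noteq> 0} =
    {\<alpha> \<in> compositions. coeff (H (exponents m)) (rep \<alpha>) \<noteq> 0}"
    by (auto simp: Ltilde_eq)
  also have "finite \<dots>"
    using type_invariant_expansion(1)[OF H_free_on] H_MNSym by (simp add: MNSym_eq)
  finally show ?thesis .
qed

lemma Ltilde_diag: "\<alpha> \<in> compositions \<Longrightarrow> Ltilde \<alpha> (monomial_of \<alpha>) = 1"
  by (simp add: Ltilde_eq lookup_H_rep)

lemma Ltilde_triangular:
  "\<alpha> \<in> compositions \<Longrightarrow> Ltilde \<alpha> m \<noteq> 0 \<Longrightarrow> \<alpha> = exponents m \<or> rank \<alpha> < rank (exponents m)"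
  using lookup_H_rep(2)[OF _ exponents_compositions] by (simp add: Ltilde_eq)

lemma inf_comb_Ltilde:
  assumes "\<beta> \<in> compositions"
  shows "inf_comb compositions Ltilde c (monomial_of \<beta>) = c \<beta> +
    (\<Sum>\<alpha>\<in>{\<alpha> \<in> compositions. rank \<alpha> < rank \<beta> \<and> Ltilde \<alpha> (monomial_of \<beta>) \<noteq> 0}. c \<alpha> * Ltilde \<alpha> (monomial_of \<beta>))"
proof -
  let ?S = "{\<alpha> \<in> compositions. Ltilde \<alpha> (monomial_of \<beta>) \<noteq> 0}"
  have \<beta>: "\<beta> \<in> ?S" using Ltilde_diag[OF assms] assms by simp
  have "?S - {\<beta>} = {\<alpha> \<in> compositions. rank \<alpha> < rank \<beta> \<and> Ltilde \<alpha> (monomial_of \<beta>) \<noteq> 0}"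
    using Ltilde_triangular[of _ "monomial_of \<beta>"] assms by auto
  then show ?thesis
    unfolding inf_comb_def using sum.remove[OF finite_Ltilde \<beta>, of "\<lambda>\<alpha>. c \<alpha> * Ltilde \<alpha> (monomial_of \<beta>)"]
    by (simp add: Ltilde_diag[OF assms])
qed

context
  notes sum.cong [fundef_cong]
begin

text \<open>Forward substitution along \<open>rank\<close> in the triangular system given by
  \<open>inf_comb_Ltilde\<close>.\<close>

function Ltilde_coef :: "(nat list \<Rightarrow> int) \<Rightarrow> nat list \<Rightarrow> int" where
  "Ltilde_coef F \<beta> = F \<beta> -
    (\<Sum>\<alpha>\<in>{\<alpha> \<in> compositions. rank \<alpha> < rank \<beta> \<and> Ltilde \<alpha> (monomial_of \<beta>) \<noteq> 0}.
      Ltilde_coef F \<alpha> * Ltilde \<alpha> (monomial_of \<beta>))"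
  by auto
termination by (relation "measure (\<lambda>(F, \<beta>). rank \<beta>)") auto

end

declare Ltilde_coef.simps [simp del]

lemma quasisym_inf_comb: "quasisym (inf_comb compositions Ltilde c)"
  unfolding quasisym_def
proof (intro allI impI)
  fix m m' :: monom assume "exponents m = exponents m'"
  then have "Ltilde \<alpha> m = Ltilde \<alpha> m'" if "\<alpha> \<in> compositions" for \<alpha>
    using that by (simp add: Ltilde_eq)
  then show "inf_comb compositions Ltilde c m = inf_comb compositions Ltilde c m'"
    unfolding inf_comb_def by (auto intro!: sum.cong)
qed

text \<open>Each equation of the triangular system has leading coefficient 1 and finitely many
  earlier unknowns, so arbitrary prescribed values at the monomials
  \<open>monomial_of \<beta>\<close> are attained over the integers; quasisymmetry extends the
  agreement to all monomials.\<close>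

lemma inf_span_Ltilde: "inf_span compositions Ltilde = {f. quasisym f}"
proof (intro equalityI subsetI)
  fix f assume "f \<in> inf_span compositions Ltilde"
  then show "f \<in> {f. quasisym f}" by (auto simp: inf_span_def quasisym_inf_comb)
next
  fix f assume f: "f \<in> {f. quasisym f}"
  define c where "c = Ltilde_coef (\<lambda>\<beta>. f (monomial_of \<beta>))"
  have *: "inf_comb compositions Ltilde c (monomial_of \<beta>) = f (monomial_of \<beta>)" if "\<beta> \<in> compositions" for \<beta>
    unfolding inf_comb_Ltilde[OF that] c_def by (subst (1) Ltilde_coef.simps) simp
  have "inf_comb compositions Ltilde c m = f m" for m
  proof -
    have e: "exponents m = exponents (monomial_of (exponents m))" by (simp add: exponents_compositions)
    have "inf_comb compositions Ltilde c m = inf_comb compositions Ltilde c (monomial_of (exponents m))"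
      using e by (rule quasisymD[OF quasisym_inf_comb])
    also have "\<dots> = f (monomial_of (exponents m))" by (rule *[OF exponents_compositions])
    also have "\<dots> = f m" using f e by (auto intro: quasisymD)
    finally show ?thesis .
  qed
  then have "f = inf_comb compositions Ltilde c" by auto
  then show "f \<in> inf_span compositions Ltilde" by simp
qed

lemma infinite_basis_Ltilde: "infinite_basis compositions Ltilde"
  unfolding infinite_basis_def
proof (intro conjI allI impI ballI)
  fix c d \<beta> assume cd: "inf_comb compositions Ltilde c = inf_comb compositions Ltilde d" and "\<beta> \<in> compositions"
  then show "c \<beta> = d \<beta>"
  proof (induction "rank \<beta>" arbitrary: \<beta> rule: less_induct)
    case less
    have "(\<Sum>\<alpha>\<in>{\<alpha> \<in> compositions. rank \<alpha> < rank \<beta> \<and> Ltilde \<alpha> (monomial_of \<beta>) \<noteq> 0}. c \<alpha> * Ltilde \<alpha> (monomial_of \<beta>)) =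
      (\<Sum>\<alpha>\<in>{\<alpha> \<in> compositions. rank \<alpha> < rank \<beta> \<and> Ltilde \<alpha> (monomial_of \<beta>) \<noteq> 0}. d \<alpha> * Ltilde \<alpha> (monomial_of \<beta>))"
      using less.hyps cd by (intro sum.cong refl) simp
    then show ?case
      using inf_comb_Ltilde[OF less.prems(2), of c] inf_comb_Ltilde[OF less.prems(2), of d] cd by simp
  qed
qed (rule finite_Ltilde)

text \<open>A function of two monomials is expanded in the first one; the coefficients are
  quasisymmetric in the second and are expanded in turn.\<close>

lemma inf_span_tensf_Ltilde: "inf_span (compositions \<times> compositions) (tensf_family Ltilde) = {h. quasisym2 h}"
proof (intro equalityI subsetI)
  fix h assume "h \<in> inf_span (compositions \<times> compositions) (tensf_family Ltilde)"
  then obtain c where c: "h = inf_comb (compositions \<times> compositions) (tensf_family Ltilde) c"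
    by (auto simp: inf_span_def)
  have "h (a, b) = h (a', b')" if "exponents a = exponents a'" "exponents b = exponents b'" for a a' b b'
  proof -
    have "h (a, b) = h (a', b)"
      unfolding c inf_comb_tensf_family(1)[OF infinite_basis_Ltilde]
      by (rule quasisymD[OF quasisym_inf_comb that(1)])
    also have "\<dots> = h (a', b')"
      unfolding c inf_comb_tensf_family(2)[OF infinite_basis_Ltilde]
      by (rule quasisymD[OF quasisym_inf_comb that(2)])
    finally show ?thesis .
  qed
  then show "h \<in> {h. quasisym2 h}" unfolding quasisym2_def mem_Collect_eq by blast
next
  fix h assume "h \<in> {h. quasisym2 h}"
  then have h: "quasisym2 h" by simp
  let ?C = "coef compositions Ltilde"
  define e where "e b = ?C (\<lambda>a. h (a, b))" for b
  have e: "inf_comb compositions Ltilde (e b) = (\<lambda>a. h (a, b))" for b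
    unfolding e_def
  proof (rule inf_comb_coef)
    show "(\<lambda>a. h (a, b)) \<in> inf_span compositions Ltilde"
      unfolding inf_span_Ltilde mem_Collect_eq quasisym_def using quasisym2D[OF h _ refl] by blast
  qed
  \<comment> \<open>Equal exponents give the same slice, hence the same chosen coefficients.\<close>
  have "e b = e b'" if "exponents b = exponents b'" for b b'
  proof -
    have "(\<lambda>a. h (a, b)) = (\<lambda>a. h (a, b'))" using quasisym2D[OF h refl that] by simp
    then show ?thesis by (simp add: e_def)
  qed
  then have "quasisym (\<lambda>b. e b s)" for s unfolding quasisym_def by metis
  then have d: "inf_comb compositions Ltilde (?C (\<lambda>b. e b s)) = (\<lambda>b. e b s)" for s
    by (intro inf_comb_coef) (simp add: inf_span_Ltilde)
  have "h (a, b) = inf_comb (compositions \<times> compositions) (tensf_family Ltilde) (\<lambda>(s, t). ?C (\<lambda>b. e b s) t) (a, b)"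
    for a b
    unfolding inf_comb_tensf_family(1)[OF infinite_basis_Ltilde] case_prod_conv d
    using fun_cong[OF e[of b], of a] by simp
  then have "h = inf_comb (compositions \<times> compositions) (tensf_family Ltilde) (\<lambda>(s, t). ?C (\<lambda>b. e b s) t)"
    by auto
  then show "h \<in> inf_span (compositions \<times> compositions) (tensf_family Ltilde)"
    by (metis inf_comb_in_inf_span)
qed

interpretation dual_bases_pair compositions Ltilde Rtilde rep
  by unfold_locales (simp_all add: infinite_basis_Ltilde lookup_Rtilde_rep)

section \<open>The pairing with \<open>H c\<close> as evaluation\<close>

lemma lookup_H_rep_mon:
  assumes "\<alpha> \<in> compositions" "sorted_wrt (<) ks" "length ks = length c"
  shows "coeff (H c) (rep \<alpha>) = Ltilde \<alpha> (mon ks c)"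
  unfolding Ltilde_eq[OF assms(1)] exponents_mon[OF assms(2,3)] H_filter ..

text \<open>Any increasing list of variables may carry the exponents, zeros included, so all terms
  of a splitting can be evaluated over common variables.\<close>

lemma B_H:
  assumes "quasisym g" "sorted_wrt (<) ks" "length ks = length c"
  shows "B (H c) g = g (mon ks c)"
  by (rule B_eval) (use assms lookup_H_rep_mon in \<open>auto simp: inf_span_Ltilde\<close>)

lemma pair_B_H:
  assumes "quasisym2 h" "sorted_wrt (<) ks" "length ks = length c" "sorted_wrt (<) ls" "length ls = length d"
  shows "pair.B (tens (H c) (H d)) h = h (mon ks c, mon ls d)"
proof (rule pair.B_eval)
  show "h \<in> inf_span (compositions \<times> compositions) (tensf_family Ltilde)"
    using assms(1) by (simp add: inf_span_tensf_Ltilde)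
qed (use assms lookup_H_rep_mon in \<open>auto simp: tensf_family_def tensf_def\<close>)

lemma monom_eq_mon:
  obtains ks where "sorted_wrt (<) ks" "length ks = length (exponents m)" "m = mon ks (exponents m)"
proof (rule that)
  show "length (sorted_list_of_set (Poly_Mapping.keys m)) = length (exponents m)"
    by (simp add: exponents_def)
qed (simp_all add: mon_exponents)

lemma finite_monom_splits: "finite {(a, b). a + b = (m :: monom)}"
proof -
  obtain ks where ks: "sorted_wrt (<) ks" "length ks = length (exponents m)" "m = mon ks (exponents m)"
    by (rule monom_eq_mon)
  show ?thesis using sum_mon_splits(2)[OF ks(1,2)] unfolding ks(3)[symmetric] .
qed

lemma series_mult_mon:
  assumes "sorted_wrt (<) ks" "length ks = length c"
  shows "series_mult z (mon ks c) = (\<Sum>ab\<in>list_splits c. z (mon ks (fst ab), mon ks (snd ab)))"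
  unfolding series_mult_def using sum_mon_splits(1)[OF assms, of z] by simp

lemma list_splits_length:
  "ab \<in> list_splits c \<Longrightarrow> length (fst ab) = length c \<and> length (snd ab) = length c"
  by (cases ab) (simp add: list_splits_iff)

lemma quasisym_series_mult:
  assumes "quasisym2 z"
  shows "quasisym (series_mult z)"
  unfolding quasisym_def
proof (intro allI impI)
  fix m m' assume e: "exponents m = exponents m'"
  obtain ks where ks: "sorted_wrt (<) ks" "length ks = length (exponents m)" "m = mon ks (exponents m)"
    by (rule monom_eq_mon)
  obtain ls where ls: "sorted_wrt (<) ls" "length ls = length (exponents m)" "m' = mon ls (exponents m)"
    using monom_eq_mon[of m'] e by metis
  have "series_mult z (mon ks (exponents m)) = series_mult z (mon ls (exponents m))"
    unfolding series_mult_mon[OF ks(1,2)] series_mult_mon[OF ls(1,2)]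
    by (intro sum.cong refl quasisym2D[OF assms])
      (use ks ls list_splits_length in \<open>auto simp: exponents_mon\<close>)
  then show "series_mult z m = series_mult z m'" using ks(3) ls(3) by simp
qed

lemma exponents_append_compositions: "exponents a @ exponents b \<in> compositions"
  using exponents_compositions[of a] exponents_compositions[of b] by (auto simp: compositions_def)

lemma quasisym2_series_comult: "quasisym2 (series_comult f)"
  by (simp add: quasisym2_def series_comult_def)

lemma quasisym_monomial_of: "quasisym f \<Longrightarrow> f (monomial_of (exponents m)) = f m"
  by (rule quasisymD) (simp_all add: exponents_compositions)

lemma exponents_eq_Nil [simp]: "exponents m = [] \<longleftrightarrow> m = 0"
  using mon_exponents[of m] by auto

lemma quasisym_series_one: "quasisym series_one"
  unfolding quasisym_def series_one_def by (metis exponents_eq_Nil)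

text \<open>For \<open>H \<beta>\<close> and \<open>H \<gamma>\<close> both sides evaluate
  \<open>g\<close> at the monomial with the concatenated exponents.\<close>

lemma B_mult:
  assumes x: "x \<in> MNSym" and y: "y \<in> MNSym" and g: "quasisym g"
  shows "B (MMR_mult (tens x y)) g = pair.B (tens x y) (series_comult g)"
  using x
proof (induction rule: MNSym_induct)
  case (H \<beta>)
  show ?case
    using y
  proof (induction rule: MNSym_induct)
    case (H \<gamma>)
    have "B (H (\<beta> @ \<gamma>)) g = g (monomial_of (\<beta> @ \<gamma>))"
      unfolding monomial_of_eq by (rule B_H[OF g]) auto
    also have "\<dots> = series_comult g (monomial_of \<beta>, monomial_of \<gamma>)"
      using H \<open>\<beta> \<in> compositions\<close> by (simp add: series_comult_def)
    also have "\<dots> = pair.B (tens (H \<beta>) (H \<gamma>)) (series_comult g)"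
      unfolding monomial_of_eq by (rule pair_B_H[OF quasisym2_series_comult, symmetric]) auto
    finally show ?case unfolding H_append .
  qed (simp_all add: tens_simps MMR_mult_simps B_add B_scale B_zero pair.B_add pair.B_scale pair.B_zero)
qed (simp_all add: tens_simps MMR_mult_simps B_add B_scale B_zero pair.B_add pair.B_scale pair.B_zero)

text \<open>For \<open>H \<beta>\<close> both sides sum \<open>h\<close> over the entrywise
  splittings of \<beta>.\<close>

lemma B_comult:
  assumes "x \<in> MNSym" and h: "quasisym2 h"
  shows "pair.B (MMR_comult x) h = B x (series_mult h)"
  using assms(1)
proof (induction rule: MNSym_induct)
  case (H \<beta>)
  have "pair.B (MMR_comult (H \<beta>)) h = (\<Sum>ab\<in>list_splits \<beta>. h (mon [0..<length \<beta>] (fst ab), mon [0..<length \<beta>] (snd ab)))"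
    unfolding MMR_comult_H pair.B_sum
    by (intro sum.cong refl pair_B_H[OF h]) (auto dest!: list_splits_length)
  also have "\<dots> = series_mult h (mon [0..<length \<beta>] \<beta>)" by (simp add: series_mult_mon)
  also have "\<dots> = B (H \<beta>) (series_mult h)"
    by (rule B_H[OF quasisym_series_mult[OF h], symmetric]) auto
  finally show ?case .
qed (simp_all add: MMR_comult_simps B_add B_scale B_zero pair.B_add pair.B_scale pair.B_zero)

lemma B_unit:
  assumes "quasisym g"
  shows "B MMR_unit g = constant_term g"
  using B_H[OF assms, of "[]" "[]"] by (simp add: constant_term_def)

lemma MMR_counit_H: "MMR_counit (H c) = of_bool (\<forall>b\<in>set c. b = 0)"
proof (induction c)
  case (Cons b c)
  have "MMR_counit (H1 b) = of_bool (b = 0)" by (simp add: H1_def)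
  then show ?case using Cons by (auto simp: MMR_counit_mult)
qed (simp add: MMR_unit_def)

lemma MMR_counit_eq:
  assumes "x \<in> MNSym"
  shows "MMR_counit x = B x series_one"
  using assms
proof (induction rule: MNSym_induct)
  case (H \<beta>)
  have "B (H \<beta>) series_one = series_one (monomial_of \<beta>)"
    unfolding monomial_of_eq by (rule B_H[OF quasisym_series_one]) auto
  also have "\<dots> = of_bool (\<beta> = [])"
    using exponents_eq_Nil[of "monomial_of \<beta>"] H by (auto simp: series_one_def)
  also have "\<dots> = MMR_counit (H \<beta>)"
    unfolding MMR_counit_H using H by (cases \<beta>) auto
  finally show ?case ..
qed (simp_all add: B_add B_scale B_zero, simp add: MMR_counit_def)

text \<open>The transpose of \<open>MMR_antipode\<close>, prescribed on evaluations: the coefficient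
  at \<open>m\<close> is the pairing with the antipode of \<open>H (exponents m)\<close>.\<close>

definition series_antipode :: "series \<Rightarrow> series" where
  "series_antipode g = (\<lambda>m. B (MMR_antipode (H (exponents m))) g)"

lemma quasisym_series_antipode: "quasisym (series_antipode g)"
  by (simp add: quasisym_def series_antipode_def)

lemma B_antipode:
  assumes "x \<in> MNSym"
  shows "B (MMR_antipode x) g = B x (series_antipode g)"
  using assms
proof (induction rule: MNSym_induct)
  case (H \<beta>)
  have "B (H \<beta>) (series_antipode g) = series_antipode g (monomial_of \<beta>)"
    unfolding monomial_of_eq by (rule B_H[OF quasisym_series_antipode]) auto
  then show ?case using H by (simp add: series_antipode_def)
qed (simp_all add: MMR_antipode_simps B_add B_scale B_zero)

lemma MNSym_antipode: "x \<in> MNSym \<Longrightarrow> MMR_antipode x \<in> MNSym"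
  using hopf_subalgebra_MNSym by (simp add: hopf_subalgebra_def)

text \<open>At a monomial with exponents \<open>c\<close>, both sides are pairings of
  \<open>f\<close> with the two sides of the antipode identity for \<open>H c\<close>.\<close>

lemma series_antipode:
  assumes f: "quasisym f"
  shows "series_mult (map_left series_antipode (series_comult f)) = (\<lambda>m. constant_term f * series_one m)"
    "series_mult (map_right series_antipode (series_comult f)) = (\<lambda>m. constant_term f * series_one m)"
proof -
  have sl: "series_comult f \<in> inf_span (compositions \<times> compositions) (tensf_family Ltilde)"
    by (simp add: inf_span_tensf_Ltilde quasisym2_series_comult)
  have He: "coeff (H (exponents m)) (rep \<alpha>) = Ltilde \<alpha> m" if "\<alpha> \<in> compositions" for \<alpha> m
    using that by (simp add: Ltilde_eq)
  \<comment> \<open>Evaluation at \<open>b\<close> is pairing with \<open>H (exponents b)\<close>,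
    so the slice formula and the transpose of the product combine into a single pairing.\<close>
  have left: "map_left series_antipode (series_comult f) (a, b) =
    B (MMR_mult (tens (MMR_antipode (H (exponents a))) (H (exponents b)))) f" for a b
    unfolding map_left_def series_antipode_def case_prod_conv B_mult[OF MNSym_antipode[OF H_MNSym] H_MNSym f]
    by (rule pair_B_slice(1)[OF sl He, symmetric])
  have right: "map_right series_antipode (series_comult f) (a, b) =
    B (MMR_mult (tens (H (exponents a)) (MMR_antipode (H (exponents b))))) f" for a b
    unfolding map_right_def series_antipode_def case_prod_conv B_mult[OF H_MNSym MNSym_antipode[OF H_MNSym] f]
    by (rule pair_B_slice(2)[OF sl He, symmetric])
  have S: "MMR_antipode = frag_extend anti_left" by (simp add: MMR_antipode_def fun_eq_iff)
  have "series_mult (map_left series_antipode (series_comult f)) m = constant_term f * series_one m \<and>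
    series_mult (map_right series_antipode (series_comult f)) m = constant_term f * series_one m" for m
  proof -
    define c where "c = exponents m"
    obtain ks where ks: "sorted_wrt (<) ks" "length ks = length c" "m = mon ks c"
      unfolding c_def by (rule monom_eq_mon)
    \<comment> \<open>Exponents of the two factors omit the zeros of a splitting, which
      \<open>H\<close> ignores anyway.\<close>
    have H: "H (exponents (mon ks (fst ab))) = H (fst ab)" "H (exponents (mon ks (snd ab))) = H (snd ab)"
      if "ab \<in> list_splits c" for ab
    proof -
      have len: "length ks = length (fst ab)" "length ks = length (snd ab)"
        using list_splits_length[OF that] ks(2) by simp_all
      show "H (exponents (mon ks (fst ab))) = H (fst ab)" "H (exponents (mon ks (snd ab))) = H (snd ab)"
        unfolding exponents_mon[OF ks(1) len(1)] exponents_mon[OF ks(1) len(2)] H_filter by (rule refl)+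
    qed
    have "MMR_counit (H c) = series_one m"
      using MMR_counit_eq[OF H_MNSym, of c] B_H[OF quasisym_series_one ks(1,2)] ks(3) by simp
    then have final: "B (frag_cmul (MMR_counit (H c)) MMR_unit) f = constant_term f * series_one m"
      by (simp add: B_scale B_unit[OF f])
    have "series_mult (map_left series_antipode (series_comult f)) m =
      B (\<Sum>ab\<in>list_splits c. MMR_mult (tens (MMR_antipode (H (fst ab))) (H (snd ab)))) f"
      unfolding ks(3) series_mult_mon[OF ks(1,2)] B_sum left by (intro sum.cong refl) (simp add: H)
    also have "\<dots> = B (MMR_mult (tensor_map MMR_antipode id (MMR_comult (H c)))) f"
      unfolding MMR_comult_H tensor_map_sum MMR_mult_sum S tensor_map_id_tens ..
    finally have L: "series_mult (map_left series_antipode (series_comult f)) m = constant_term f * series_one m"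
      unfolding MMR_antipode(1)[OF H_free_on] final .
    have "series_mult (map_right series_antipode (series_comult f)) m =
      B (\<Sum>ab\<in>list_splits c. MMR_mult (tens (H (fst ab)) (MMR_antipode (H (snd ab))))) f"
      unfolding ks(3) series_mult_mon[OF ks(1,2)] B_sum right by (intro sum.cong refl) (simp add: H)
    also have "\<dots> = B (MMR_mult (tensor_map id MMR_antipode (MMR_comult (H c)))) f"
      unfolding MMR_comult_H tensor_map_sum MMR_mult_sum S tensor_map_id_tens ..
    finally have "series_mult (map_right series_antipode (series_comult f)) m = constant_term f * series_one m"
      unfolding MMR_antipode(2)[OF H_free_on] final .
    with L show ?thesis ..
  qed
  then show "series_mult (map_left series_antipode (series_comult f)) = (\<lambda>m. constant_term f * series_one m)"
    "series_mult (map_right series_antipode (series_comult f)) = (\<lambda>m. constant_term f * series_one m)"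
    by auto
qed

section \<open>Product and coproduct of series\<close>

lemma series_mult_assoc:
  "series_mult (tensf (series_mult (tensf f g)) h) = series_mult (tensf f (series_mult (tensf g h)))"
proof
  fix m :: monom
  let ?S = "\<lambda>m. {(a, b). a + b = (m :: monom)}"
  have "series_mult (tensf (series_mult (tensf f g)) h) m =
    (\<Sum>uc\<in>?S m. \<Sum>ab\<in>?S (fst uc). f (fst ab) * g (snd ab) * h (snd uc))"
    by (simp add: series_mult_def tensf_def case_prod_unfold sum_distrib_right)
  also have "\<dots> = (\<Sum>(uc, ab)\<in>Sigma (?S m) (\<lambda>uc. ?S (fst uc)). f (fst ab) * g (snd ab) * h (snd uc))"
    by (rule sum.Sigma) (simp_all add: finite_monom_splits)
  also have "\<dots> = (\<Sum>(au, bc)\<in>Sigma (?S m) (\<lambda>au. ?S (snd au)). f (fst au) * (g (fst bc) * h (snd bc)))"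
    by (rule sum.reindex_bij_witness[where
        i = "\<lambda>((a, u), (b, c)). ((a + b, c), (a, b))" and j = "\<lambda>((u, c), (a, b)). ((a, b + c), (b, c))"])
      (auto simp: add.assoc mult.assoc)
  also have "\<dots> = (\<Sum>au\<in>?S m. \<Sum>bc\<in>?S (snd au). f (fst au) * (g (fst bc) * h (snd bc)))"
    by (rule sum.Sigma[symmetric]) (simp_all add: finite_monom_splits)
  also have "\<dots> = series_mult (tensf f (series_mult (tensf g h))) m"
    by (simp add: series_mult_def tensf_def case_prod_unfold sum_distrib_left)
  finally show "series_mult (tensf (series_mult (tensf f g)) h) m =
    series_mult (tensf f (series_mult (tensf g h))) m" .
qed

lemma series_mult_one: "series_mult (tensf series_one f) = f" "series_mult (tensf f series_one) = f"
proof -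
  show "series_mult (tensf series_one f) = f"
  proof
    fix m
    have "series_mult (tensf series_one f) m = (\<Sum>z\<in>{(a, b). a + b = m}. if z = (0, m) then f m else 0)"
      unfolding series_mult_def by (intro sum.cong refl) (auto simp: tensf_def series_one_def split: if_splits)
    then show "series_mult (tensf series_one f) m = f m" by (simp add: finite_monom_splits)
  qed
  show "series_mult (tensf f series_one) = f"
  proof
    fix m
    have "series_mult (tensf f series_one) m = (\<Sum>z\<in>{(a, b). a + b = m}. if z = (m, 0) then f m else 0)"
      unfolding series_mult_def by (intro sum.cong refl) (auto simp: tensf_def series_one_def split: if_splits)
    then show "series_mult (tensf f series_one) m = f m" by (simp add: finite_monom_splits)
  qed
qed

lemma sum_list_splits_append:
  "(\<Sum>ab\<in>list_splits (c @ d). F (fst ab) (snd ab)) =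
    (\<Sum>ab\<in>list_splits c. \<Sum>a'b'\<in>list_splits d. F (fst ab @ fst a'b') (snd ab @ snd a'b'))"
proof (induction c arbitrary: F)
  case (Cons x c)
  show ?case
    unfolding append_Cons sum_list_splits_Cons[of F] Cons.IH[of "\<lambda>a b. F (i # a) ((x - i) # b)" for i]
    by (subst sum_list_splits_Cons[of "\<lambda>a b. \<Sum>a'b'\<in>list_splits d. F (a @ fst a'b') (b @ snd a'b')"]) simp
qed simp

lemma quasisym_mon_filter:
  assumes "quasisym f" "sorted_wrt (<) ks" "length ks = length c"
  shows "f (mon ks c) = f (monomial_of (filter (\<lambda>x. x \<noteq> 0) c))"
  by (rule quasisymD[OF assms(1)]) (simp add: exponents_mon[OF assms(2,3)] exponents_monomial_of)

text \<open>Splitting a concatenation of exponent lists means splitting both lists. Dropping zeros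
  before evaluation makes the results independent of the variables that carry them.\<close>

lemma series_comult_mult:
  assumes f: "quasisym f" and g: "quasisym g"
  shows "series_comult (series_mult (tensf f g)) =
    map_right series_mult (map_left series_mult (\<lambda>((a, c), (b, d)). series_comult f (a, b) * series_comult g (c, d)))"
proof (rule ext, clarify)
  fix k l :: monom
  define c d where "c = exponents k" and "d = exponents l"
  obtain ks where ks: "sorted_wrt (<) ks" "length ks = length c" "k = mon ks c"
    unfolding c_def by (rule monom_eq_mon)
  obtain ls where ls: "sorted_wrt (<) ls" "length ls = length d" "l = mon ls d"
    unfolding d_def by (rule monom_eq_mon)
  let ?n = "[0..<length (c @ d)]" and ?F = "filter (\<lambda>x::nat. x \<noteq> 0)"
  have "series_comult (series_mult (tensf f g)) (k, l) = series_mult (tensf f g) (mon ?n (c @ d))"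
    by (simp add: series_comult_def c_def d_def monomial_of_eq)
  also have "\<dots> = (\<Sum>ab\<in>list_splits (c @ d). f (mon ?n (fst ab)) * g (mon ?n (snd ab)))"
    by (subst series_mult_mon) (simp_all add: tensf_def)
  also have "\<dots> = (\<Sum>ab\<in>list_splits (c @ d). f (monomial_of (?F (fst ab))) * g (monomial_of (?F (snd ab))))"
    using list_splits_length[of _ "c @ d"]
    by (intro sum.cong refl arg_cong2[where f = "(*)"] quasisym_mon_filter f g) auto
  also have "\<dots> = (\<Sum>ab\<in>list_splits c. \<Sum>a'b'\<in>list_splits d.
      f (monomial_of (?F (fst ab @ fst a'b'))) * g (monomial_of (?F (snd ab @ snd a'b'))))"
    by (rule sum_list_splits_append[of "\<lambda>a b. f (monomial_of (?F a)) * g (monomial_of (?F b))"])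
  also have "\<dots> = (\<Sum>a'b'\<in>list_splits d. \<Sum>ab\<in>list_splits c.
      series_comult f (mon ks (fst ab), mon ls (fst a'b')) * series_comult g (mon ks (snd ab), mon ls (snd a'b')))"
    by (subst sum.swap, intro sum.cong refl)
      (use ks(1,2) ls(1,2) list_splits_length in \<open>auto simp: series_comult_def exponents_mon\<close>)
  also have "\<dots> = map_right series_mult (map_left series_mult
      (\<lambda>((a, c), (b, d)). series_comult f (a, b) * series_comult g (c, d))) (k, l)"
    unfolding map_right_def map_left_def case_prod_conv ks(3) ls(3)
    by (simp add: series_mult_mon[OF ks(1,2)] series_mult_mon[OF ls(1,2)])
  finally show "series_comult (series_mult (tensf f g)) (k, l) = map_right series_mult (map_left series_mult
      (\<lambda>((a, c), (b, d)). series_comult f (a, b) * series_comult g (c, d))) (k, l)" .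
qed

text \<open>A coefficient of a product is a finite sum of evaluations, because a monomial has
  finitely many factorizations.\<close>

lemma continuous_functional_series_mult:
  "continuous_functional (compositions \<times> compositions) (tensf_family Ltilde) (\<lambda>z. series_mult z m)"
  unfolding series_mult_def case_prod_unfold prod.collapse
  by (intro continuous_functional_sum continuous_functional_eval infinite_basis_tensf_family infinite_basis_Ltilde)
    (use finite_monom_splits[of m] in \<open>simp add: case_prod_unfold\<close>)

theorem complete_hopf_algebra_Ltilde:
  "complete_hopf_algebra compositions Ltilde
    series_mult series_one series_comult constant_term series_antipode"
proof -
  note eval = continuous_functional_eval[OF infinite_basis_Ltilde]
  have "continuous_functional compositions Ltilde (\<lambda>g. series_comult g ab)" for ab
    unfolding series_comult_def case_prod_unfold by (rule eval)
  moreover have "continuous_functional compositions Ltilde constant_term"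
    unfolding constant_term_def by (rule eval)
  moreover have "continuous_functional compositions Ltilde (\<lambda>g. series_antipode g m)" for m
    unfolding series_antipode_def by (rule continuous_B)
  moreover have "map_left series_comult (series_comult f) ((a, b), c) =
    map_right series_comult (series_comult f) (a, (b, c))" for f a b c
    by (simp add: map_left_def map_right_def series_comult_def exponents_append_compositions)
  moreover have "(\<lambda>b. constant_term (\<lambda>a. series_comult f (a, b))) = f"
    "(\<lambda>a. constant_term (\<lambda>b. series_comult f (a, b))) = f" if "quasisym f" for f
    by (simp_all add: constant_term_def series_comult_def quasisym_monomial_of[OF that])
  moreover have "series_comult series_one = tensf series_one series_one"
  proof (rule ext, clarify)
    fix a b
    have "monomial_of (exponents a @ exponents b) = 0 \<longleftrightarrow> a = 0 \<and> b = 0"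
      using exponents_eq_Nil[of "monomial_of (exponents a @ exponents b)"]
      by (simp only: exponents_monomial_of_composition[OF exponents_append_compositions]) simp
    then show "series_comult series_one (a, b) = tensf series_one series_one (a, b)"
      by (simp add: series_comult_def tensf_def series_one_def)
  qed
  moreover have "constant_term (series_mult (tensf f g)) = constant_term f * constant_term g" for f g
    using series_mult_mon[of "[]" "[]" "tensf f g"] by (simp add: constant_term_def tensf_def)
  moreover have "constant_term series_one = 1"
    by (simp add: constant_term_def series_one_def)
  ultimately show ?thesis
    unfolding complete_hopf_algebra_def continuous_map_def inf_span_Ltilde inf_span_tensf_Ltilde mem_Collect_eq
    using infinite_basis_Ltilde continuous_functional_series_mult quasisym_series_mult quasisym_series_one
      quasisym2_series_comult quasisym_series_antipode series_mult_assoc series_mult_one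
      series_comult_mult series_antipode
    by (intro conjI ballI allI) (simp_all add: Ball_def)
qed

theorem hopf_continuous_duals_MNSym:
  "hopf_continuous_duals compositions Rtilde Ltilde
    MMR_mult MMR_unit MMR_comult MMR_counit MMR_antipode
    series_mult series_one series_comult constant_term series_antipode"
proof -
  \<comment> \<open>The span of pure tensors is reached from \<open>B_mult\<close> by linearity of
    both sides.\<close>
  have mult: "B (MMR_mult z) g = pair.B z (series_comult g)"
    if "z \<in> frag.span {tens x y |x y. x \<in> MNSym \<and> y \<in> MNSym}" "quasisym g" for z g
    using that(1)
  proof (induction rule: frag.span_induct_alt)
    case base
    then show ?case by (simp add: MMR_mult_simps B_zero pair.B_zero)
  next
    case (step c x y)
    then show ?case using B_mult[OF _ _ that(2)]
      by (auto simp: MMR_mult_simps B_add B_scale pair.B_add pair.B_scale)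
  qed
  show ?thesis
    unfolding hopf_continuous_duals_def Let_def MNSym_def[symmetric]
    using continuous_duals_via_B pair.continuous_duals_via_B pair_B_tensf mult B_unit B_comult MMR_counit_eq
      B_antipode
    by (intro exI[of _ B] exI[of _ pair.B]) (simp add: inf_span_Ltilde inf_span_tensf_Ltilde)
qed

theorem theorem8p4:
  shows "\<exists>antiM antiQ.
    hopf_subalgebra MNSym M_perms_all MMR_mult MMR_unit MMR_comult MMR_counit antiM \<and>
    complete_hopf_algebra compositions Ltilde
      series_mult series_one series_comult constant_term antiQ \<and>
    hopf_continuous_duals compositions Rtilde Ltilde
      MMR_mult MMR_unit MMR_comult MMR_counit antiM
      series_mult series_one series_comult constant_term antiQ"
  using hopf_subalgebra_MNSym complete_hopf_algebra_Ltilde hopf_continuous_duals_MNSym by blast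

end
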